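(* Let $\mathbb{K}$ be a field of characteristic zero, $n\ge 4$, and $m=\binom n2$. Consider the system of parameters of $\mathcal{I}_n$ composed of the $m$ elementary symmetric polynomials in the variables $x_{\{i,j\}}$, and let $e_1\le\dots\le e_t$ be the degrees of the corresponding secondary invariants. Then $$t=\frac{m!}{n!}=\frac{\binom n2!}{n!},\qquad e_t=\binom m2-\mu_n=\binom{\binom n2}{2}-\mu_n,\qquad \beta(\mathcal{I}_n)\le\binom{\binom n2}{2}-\mu_n,$$ where $\mu_n=0$ if $n$ is even, and $\mu_n=\lceil\frac34(n-1)\rceil$ if $n$ is odd.
   Context: Let $\mathbb{K}[x_{\{i,j\}}]$ be the polynomial ring in the $m=\binom n2$ variables indexed by the pairs $\{i,j\}$, $1\le i<j\le n$. The symmetric group $\mathfrak{S}_n$ acts on it by $\sigma\cdot x_{\{i,j\}}=x_{\{\sigma(i),\sigma(j)\}}$, and $\mathcal{I}_n:=\mathbb{K}[x_{\{i,j\}}]^{\mathfrak{S}_n}$. A system of parameters of $\mathcal{I}_n$ is a set of $m$ homogeneous invariants $\theta_1,\dots,\theta_m$ such that $\mathcal{I}_n$ is a finitely generated module over $\mathbb{K}[\theta_1,\dots,\theta_m]$; then $\mathcal{I}_n$ is a free module over $\mathbb{K}[\theta_1,\dots,\theta_m]$, so there are homogeneous invariants $\eta_1,\dots,\eta_t$ (secondary invariants) with $\mathcal{I}_n=\bigoplus_{i=1}^t\eta_i\,\mathbb{K}[\theta_1,\dots,\theta_m]$; their number $t$ and their degrees (as a multiset) depend only on the degrees of the $\theta_i$.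 $\beta(\mathcal{I}_n)$ denotes the smallest integer $d$ such that $\mathcal{I}_n$ is generated as a $\mathbb{K}$-algebra by its invariants of degree at most $d$. *)

theory Defs
  imports Complex_Main "HOL-Library.Poly_Mapping" "HOL-Library.FuncSet"
    "HOL-Combinatorics.Permutations"
begin

text \<open>
  Polynomials in indeterminates indexed by sets of naturals, over the coefficients
  \<open>'k\<close>; the ring structure is that of \<^theory>\<open>HOL-Library.Poly_Mapping\<close>
  (a monomial is its finitely supported exponent function).
  The variable $x_{\{i,j\}}$ is \<open>var {i, j}\<close>.
\<close>

type_synonym 'k mpoly = "(nat set \<Rightarrow>\<^sub>0 nat) \<Rightarrow>\<^sub>0 'k"

definition const :: "'k \<Rightarrow> 'k::field_char_0 mpoly" where
  "const c = Poly_Mapping.single 0 c"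

definition var :: "nat set \<Rightarrow> 'k::field_char_0 mpoly" where
  "var v = Poly_Mapping.single (Poly_Mapping.single v 1) 1"

definition mon_degree :: "(nat set \<Rightarrow>\<^sub>0 nat) \<Rightarrow> nat" where
  "mon_degree a = (\<Sum>v\<in>Poly_Mapping.keys a. Poly_Mapping.lookup a v)"

text \<open>The zero polynomial is homogeneous of every degree and has degree at most \<open>d\<close> for all \<open>d\<close>.\<close>

definition homogeneous :: "nat \<Rightarrow> 'k::field_char_0 mpoly \<Rightarrow> bool" where
  "homogeneous d p \<longleftrightarrow> (\<forall>a\<in>Poly_Mapping.keys p. mon_degree a = d)"

definition degree_at_most :: "nat \<Rightarrow> 'k::field_char_0 mpoly \<Rightarrow> bool" where
  "degree_at_most d p \<longleftrightarrow> (\<forall>a\<in>Poly_Mapping.keys p. mon_degree a \<le> d)"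

definition pairs :: "nat \<Rightarrow> nat set set" where
  "pairs n = {{i, j} | i j. 1 \<le> i \<and> i < j \<and> j \<le> n}"

definition pair_polys :: "nat \<Rightarrow> 'k::field_char_0 mpoly set" where
  "pair_polys n = {p. \<forall>a\<in>Poly_Mapping.keys p. Poly_Mapping.keys a \<subseteq> pairs n}"

text \<open>The \<open>'k\<close>-algebra endomorphism substituting \<open>var (\<sigma> ` v)\<close> for \<open>var v\<close>.\<close>

definition act :: "(nat \<Rightarrow> nat) \<Rightarrow> 'k::field_char_0 mpoly \<Rightarrow> 'k mpoly" where
  "act \<sigma> p = (\<Sum>a\<in>Poly_Mapping.keys p. const (Poly_Mapping.lookup p a) *
      (\<Prod>v\<in>Poly_Mapping.keys a. var (\<sigma> ` v) ^ Poly_Mapping.lookup a v))"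

definition invariants :: "nat \<Rightarrow> 'k::field_char_0 mpoly set" where
  "invariants n = {p \<in> pair_polys n. \<forall>\<sigma>. \<sigma> permutes {1..n} \<longrightarrow> act \<sigma> p = p}"

inductive_set generated_algebra :: "'k::field_char_0 mpoly set \<Rightarrow> 'k mpoly set"
  for S :: "'k mpoly set" where
  const: "const c \<in> generated_algebra S"
| gen: "p \<in> S \<Longrightarrow> p \<in> generated_algebra S"
| add: "p \<in> generated_algebra S \<Longrightarrow> q \<in> generated_algebra S \<Longrightarrow> p + q \<in> generated_algebra S"
| mult: "p \<in> generated_algebra S \<Longrightarrow> q \<in> generated_algebra S \<Longrightarrow> p * q \<in> generated_algebra S"

definition system_of_parameters :: "nat \<Rightarrow> 'k::field_char_0 mpoly set \<Rightarrow> bool" where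
  "system_of_parameters n \<Theta> \<longleftrightarrow>
     finite \<Theta> \<and> card \<Theta> = n choose 2 \<and> \<Theta> \<subseteq> invariants n \<and>
     (\<forall>\<theta>\<in>\<Theta>. \<exists>d. homogeneous d \<theta>) \<and>
     (\<exists>S. finite S \<and> S \<subseteq> invariants n \<and>
        (\<forall>f\<in>invariants n. \<exists>q. (\<forall>s\<in>S. q s \<in> generated_algebra \<Theta>) \<and> f = (\<Sum>s\<in>S. s * q s)))"

text \<open>
  \<open>\<eta> 1, \<dots>, \<eta> t\<close> are homogeneous invariants of degrees \<open>e 1, \<dots>, e t\<close> forming a basis of
  the invariant ring as a module over the algebra generated by \<open>\<Theta>\<close>. Uniqueness of the
  coefficients, taken extensional on \<open>{1..t}\<close>, forces every \<open>\<eta> i\<close> to be nonzero.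
\<close>

definition secondary_invariants ::
  "nat \<Rightarrow> 'k::field_char_0 mpoly set \<Rightarrow> nat \<Rightarrow> (nat \<Rightarrow> 'k mpoly) \<Rightarrow> (nat \<Rightarrow> nat) \<Rightarrow> bool" where
  "secondary_invariants n \<Theta> t \<eta> e \<longleftrightarrow>
     (\<forall>i\<in>{1..t}. \<eta> i \<in> invariants n \<and> homogeneous (e i) (\<eta> i)) \<and>
     (\<forall>f\<in>invariants n. \<exists>!q. q \<in> {1..t} \<rightarrow>\<^sub>E generated_algebra \<Theta> \<and> f = (\<Sum>i=1..t. \<eta> i * q i))"

definition elem_sym :: "nat \<Rightarrow> nat \<Rightarrow> 'k::field_char_0 mpoly" where
  "elem_sym n k = (\<Sum>A | A \<subseteq> pairs n \<and> card A = k. \<Prod>v\<in>A. var v)"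

text \<open>The type argument fixes the coefficient field.\<close>

definition beta :: "'k::field_char_0 itself \<Rightarrow> nat \<Rightarrow> nat" where
  "beta _ n = (LEAST d.
     generated_algebra {f \<in> invariants n. degree_at_most d f} = (invariants n :: 'k mpoly set))"

definition mu :: "nat \<Rightarrow> int" where
  "mu n = (if even n then 0 else \<lceil>3 / 4 * (real n - 1)\<rceil>)"

end

theory Submission
  imports Defs "HOL-Computational_Algebra.Primes" "HOL-Computational_Algebra.Polynomial"
begin

text \<open>
  Let \<open>R\<close> be the polynomial ring in the \<open>m\<close> pair variables, \<open>A\<close> the algebra of symmetric
  polynomials, \<open>I\<close> the ideal of \<open>R\<close> generated by those without constant term, and \<open>G\<close> the image of
  the symmetric group on \<open>{1..n}\<close> in the permutations of the variables. The Artin monomials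
  generate \<open>R\<close> over \<open>A\<close>, and antisymmetrization sends every \<open>f\<close> to a multiple of the
  discriminant root; the quotient is an \<open>A\<close>-bilinear form \<open>(f, g) \<mapsto> \<langle>f g\<rangle>\<close> with values in
  \<open>A\<close>, which modulo \<open>I\<close> is a perfect pairing between complementary degrees \<open>d\<close> and
  \<open>(m choose 2) - d\<close>. Nondegeneracy shows that invariants which are linearly independent
  modulo \<open>I\<close> are independent over \<open>A\<close>, so a minimal homogeneous generating set of the invariants
  is a basis. Restricting a basis to the orbit of a point with distinct coordinates gives a basis
  of the \<open>G\<close>-invariant functions on \<open>m!\<close> points, whence \<open>t = m!/n!\<close>. Since the form picks up
  the sign of a permutation, the top degree of the invariants modulo \<open>I\<close> is
  \<open>(m choose 2) - \<mu>\<close>, where \<open>\<mu>\<close> is the least degree of a nonzero polynomial on which \<open>G\<close> acts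
  by the sign. For even \<open>n\<close> all of \<open>G\<close> is even and \<open>\<mu> = 0\<close>; for odd \<open>n\<close> the sign is that of
  the vertex permutation, and \<open>\<mu>\<close> is the least number of edges of a multigraph on \<open>n\<close> vertices
  without odd automorphisms.
\<close>

text \<open>Two points carry the numbers. For an invariant \<open>f\<close> and any
  \<open>g\<close>, replacing \<open>g\<close> by its signed sum over \<open>G\<close> only
  multiplies the antisymmetrization of \<open>f * g\<close> by \<open>card G\<close>. Hence, modulo
  the ideal, invariants of degree \<open>d\<close> pair with sign-semi-invariants of complementary
  degree, and the largest degree on one side is fixed by the smallest degree on the other. The
  parity of \<open>n\<close> enters because exchanging two vertices \<open>a\<close>,
  \<open>b\<close> exchanges the pairs \<open>{a, c}\<close> and \<open>{b, c}\<close> for each of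
  the \<open>n - 2\<close> other vertices \<open>c\<close>, which has sign \<open>(- 1) ^ n\<close>.
  The constant 3/4 is half of 3/2: in a multigraph that no exchange of two vertices preserves, the
  non-isolated vertices, at least \<open>n - 1\<close> of them, have average degree at least 3/2,
  and the degrees sum to twice the number of edges. The discriminant root is not introduced as a
  product of differences. It is the antisymmetrized staircase monomial: divisibility by it follows
  from the Artin expansion, because every other Artin monomial is fixed by some transposition, and
  cancellation follows from evaluation at points with distinct coordinates, where it does not
  vanish.\<close>

abbreviation lookup :: "('a \<Rightarrow>\<^sub>0 'b::zero) \<Rightarrow> 'a \<Rightarrow> 'b" where
  "lookup \<equiv> Poly_Mapping.lookup"

abbreviation keys :: "('a \<Rightarrow>\<^sub>0 'b::zero) \<Rightarrow> 'a set" where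
  "keys \<equiv> Poly_Mapping.keys"

abbreviation single :: "'a \<Rightarrow> 'b::zero \<Rightarrow> 'a \<Rightarrow>\<^sub>0 'b" where
  "single \<equiv> Poly_Mapping.single"

abbreviation map_key :: "('a \<Rightarrow> 'b) \<Rightarrow> ('b \<Rightarrow>\<^sub>0 'c::zero) \<Rightarrow> 'a \<Rightarrow>\<^sub>0 'c" where
  "map_key \<equiv> Poly_Mapping.map_key"

abbreviation tswap :: "'a \<Rightarrow> 'a \<Rightarrow> 'a \<Rightarrow> 'a" where
  "tswap \<equiv> Transposition.transpose"

type_synonym expo = "nat set \<Rightarrow>\<^sub>0 nat"

section \<open>Substitution homomorphisms\<close>

definition mhom :: "(nat set \<Rightarrow> 'r::comm_semiring_1) \<Rightarrow> expo \<Rightarrow> 'r" where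
  "mhom x a = (\<Prod>v\<in>keys a. x v ^ lookup a v)"

text \<open>Coefficients pass through \<open>h\<close> and the target ring is arbitrary, so that
  evaluation at a point (\<open>ev\<close>) and the action on variables (\<open>actv\<close>) are
  instances of one homomorphism.\<close>

definition psubst :: "('k \<Rightarrow> 'r::comm_semiring_1) \<Rightarrow> (nat set \<Rightarrow> 'r) \<Rightarrow> 'k::field_char_0 mpoly \<Rightarrow> 'r" where
  "psubst h x p = (\<Sum>a\<in>keys p. h (lookup p a) * mhom x a)"

lemma poly_expand: "p = (\<Sum>a\<in>keys p. single a (lookup p a))"
  by (rule poly_mapping_eqI)
     (auto simp: lookup_sum lookup_single when_def sum.delta' in_keys_iff)

lemma mhom_superset:
  assumes "finite F" "keys a \<subseteq> F"
  shows "mhom x a = (\<Prod>v\<in>F. x v ^ lookup a v)"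
  unfolding mhom_def using assms
  by (intro prod.mono_neutral_left) (auto simp: in_keys_iff)

lemma mhom_0 [simp]: "mhom x 0 = 1"
  by (simp add: mhom_def)

lemma mhom_add: "mhom x (a + b) = mhom x a * mhom x b"
proof -
  let ?F = "keys a \<union> keys b"
  have "mhom x (a + b) = (\<Prod>v\<in>?F. x v ^ lookup (a + b) v)"
    by (rule mhom_superset) (auto simp: keys_add)
  also have "\<dots> = (\<Prod>v\<in>?F. x v ^ lookup a v) * (\<Prod>v\<in>?F. x v ^ lookup b v)"
    by (simp add: lookup_add power_add prod.distrib)
  also have "(\<Prod>v\<in>?F. x v ^ lookup a v) = mhom x a"
    by (rule mhom_superset [symmetric]) auto
  also have "(\<Prod>v\<in>?F. x v ^ lookup b v) = mhom x b"
    by (rule mhom_superset [symmetric]) auto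
  finally show ?thesis .
qed

lemma mhom_single [simp]: "mhom x (single v k) = x v ^ k"
  by (cases "k = 0") (auto simp: mhom_def)

locale coeff_hom =
  fixes h :: "'k::field_char_0 \<Rightarrow> 'r::comm_semiring_1"
  assumes h0: "h 0 = 0" and h1: "h 1 = 1"
    and h_add: "h (a + b) = h a + h b" and h_mult: "h (a * b) = h a * h b"
begin

lemma psubst_superset:
  assumes "finite F" "keys p \<subseteq> F"
  shows "psubst h x p = (\<Sum>a\<in>F. h (lookup p a) * mhom x a)"
  unfolding psubst_def using assms
  by (intro sum.mono_neutral_left) (auto simp: in_keys_iff h0)

lemma psubst_0 [simp]: "psubst h x 0 = 0"
  by (simp add: psubst_def)

lemma psubst_add: "psubst h x (p + q) = psubst h x p + psubst h x q"
proof -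
  let ?F = "keys p \<union> keys q"
  have "psubst h x (p + q) = (\<Sum>v\<in>?F. h (lookup (p + q) v) * mhom x v)"
    by (rule psubst_superset) (auto simp: keys_add)
  also have "\<dots> = (\<Sum>v\<in>?F. h (lookup p v) * mhom x v) + (\<Sum>v\<in>?F. h (lookup q v) * mhom x v)"
    by (simp add: lookup_add h_add sum.distrib distrib_right)
  also have "(\<Sum>v\<in>?F. h (lookup p v) * mhom x v) = psubst h x p"
    by (rule psubst_superset [symmetric]) auto
  also have "(\<Sum>v\<in>?F. h (lookup q v) * mhom x v) = psubst h x q"
    by (rule psubst_superset [symmetric]) auto
  finally show ?thesis .
qed

lemma psubst_sum: "psubst h x (\<Sum>i\<in>S. f i) = (\<Sum>i\<in>S. psubst h x (f i))"
  by (induction S rule: infinite_finite_induct) (auto simp: psubst_add)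

lemma psubst_single: "psubst h x (single a c) = h c * mhom x a"
  by (cases "c = 0") (auto simp: psubst_def h0)

lemma psubst_mult: "psubst h x (p * q) = psubst h x p * psubst h x q"
proof -
  have "p * q = (\<Sum>a\<in>keys p. single a (lookup p a)) * (\<Sum>b\<in>keys q. single b (lookup q b))"
    using poly_expand [of p] poly_expand [of q] by simp
  also have "\<dots> = (\<Sum>a\<in>keys p. \<Sum>b\<in>keys q. single (a + b) (lookup p a * lookup q b))"
    by (simp add: sum_product mult_single)
  finally have "psubst h x (p * q) =
      (\<Sum>a\<in>keys p. \<Sum>b\<in>keys q. (h (lookup p a) * mhom x a) * (h (lookup q b) * mhom x b))"
    by (simp add: psubst_sum psubst_single h_mult mhom_add mult_ac)
  then show ?thesis
    by (simp add: psubst_def sum_product)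
qed

lemma psubst_const [simp]: "psubst h x (const c) = h c"
  by (simp add: const_def psubst_single)

lemma psubst_1 [simp]: "psubst h x 1 = 1"
  using psubst_single [of x 0 1] by (simp add: h1)

lemma psubst_var [simp]: "psubst h x (var v) = x v"
  by (simp add: var_def psubst_single h1)

lemma psubst_power: "psubst h x (p ^ k) = psubst h x p ^ k"
  by (induction k) (auto simp: psubst_mult)

lemma psubst_prod: "psubst h x (\<Prod>i\<in>S. f i) = (\<Prod>i\<in>S. psubst h x (f i))"
  by (induction S rule: infinite_finite_induct) (auto simp: psubst_mult)

end

lemma const_0 [simp]: "const 0 = 0" and const_1 [simp]: "const 1 = 1"
  by (simp_all add: const_def)

lemma const_add: "const (a + b) = const a + const b"
  and const_mult: "const (a * b) = const a * const b"
  and const_uminus: "const (- a) = - const a"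
  by (simp_all add: const_def single_add mult_single single_uminus)

definition ev :: "(nat set \<Rightarrow> 'k) \<Rightarrow> 'k::field_char_0 mpoly \<Rightarrow> 'k" where
  "ev x = psubst (\<lambda>c. c) x"

text \<open>Any map of variables is allowed: antisymmetrization runs over all permutations of the
  variables, not only over those induced by vertices.\<close>

definition actv :: "(nat set \<Rightarrow> nat set) \<Rightarrow> 'k::field_char_0 mpoly \<Rightarrow> 'k mpoly" where
  "actv \<pi> = psubst const (\<lambda>v. var (\<pi> v))"

abbreviation ev0 :: "'k::field_char_0 mpoly \<Rightarrow> 'k" where
  "ev0 \<equiv> ev (\<lambda>_. 0)"

abbreviation sgn_const :: "('a \<Rightarrow> 'a) \<Rightarrow> 'k::field_char_0 mpoly" where
  "sgn_const h \<equiv> const (of_int (sign h))"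

interpretation ev: coeff_hom "\<lambda>c. c"
  by unfold_locales auto

interpretation actv: coeff_hom const
  by unfold_locales (auto simp: const_add const_mult)

lemma act_eq: "act \<sigma> = actv (image \<sigma>)"
  by (intro ext) (simp add: act_def actv_def psubst_def mhom_def)

lemmas ev_simps = ev.psubst_add [folded ev_def] ev.psubst_mult [folded ev_def]
  ev.psubst_sum [folded ev_def] ev.psubst_prod [folded ev_def] ev.psubst_power [folded ev_def]
  ev.psubst_0 [folded ev_def] ev.psubst_1 [folded ev_def]
  ev.psubst_const [folded ev_def] ev.psubst_var [folded ev_def]

lemmas actv_simps = actv.psubst_add [of "\<lambda>v. var (\<pi> v)", folded actv_def] actv.psubst_mult [of "\<lambda>v. var (\<pi> v)", folded actv_def]
  actv.psubst_sum [of "\<lambda>v. var (\<pi> v)", folded actv_def] actv.psubst_prod [of "\<lambda>v. var (\<pi> v)", folded actv_def] actv.psubst_power [of "\<lambda>v. var (\<pi> v)", folded actv_def]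
  actv.psubst_0 [of "\<lambda>v. var (\<pi> v)", folded actv_def] actv.psubst_1 [of "\<lambda>v. var (\<pi> v)", folded actv_def]
  actv.psubst_const [of "\<lambda>v. var (\<pi> v)", folded actv_def] actv.psubst_var [of "\<lambda>v. var (\<pi> v)", folded actv_def]
  for \<pi>

lemma ev_minus: "ev x (p - q) = ev x p - ev x q"
proof -
  have "ev x p = ev x (p - q) + ev x q"
    by (simp flip: ev_simps(1))
  then show ?thesis by simp
qed

lemma actv_minus: "actv \<pi> (p - q) = actv \<pi> p - actv \<pi> q"
proof -
  have "actv \<pi> p = actv \<pi> (p - q) + actv \<pi> q"
    by (simp flip: actv_simps(1))
  then show ?thesis by simp
qed

section \<open>Polynomials in a given set of variables\<close>

definition polys :: "nat set set \<Rightarrow> 'k::field_char_0 mpoly set" where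
  "polys U = {p. \<forall>a\<in>keys p. keys a \<subseteq> U}"

lemma pair_polys_eq: "pair_polys n = polys (pairs n)"
  by (simp add: pair_polys_def polys_def)

lemma mhom_var: "mhom var a = single a (1 :: 'k::field_char_0)"
proof -
  have pow: "(var v :: 'k mpoly) ^ k = single (single v k) 1" for v k
    by (induction k) (simp_all add: var_def mult_single add.commute flip: single_add)
  have prd: "(\<Prod>v\<in>F. single (single v (lookup a v)) (1::'k)) = single (\<Sum>v\<in>F. single v (lookup a v)) 1"
    if "finite F" for F :: "nat set set"
    using that by (induction F) (auto simp: mult_single)
  show ?thesis
    unfolding mhom_def pow by (simp add: prd flip: poly_expand)
qed

lemma single_eq: "single a c = const c * mhom var a"
  by (simp add: mhom_var const_def mult_single)

lemma poly_expand': "p = (\<Sum>a\<in>keys p. const (lookup p a) * mhom var a)"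
  using poly_expand [of p] by (simp add: single_eq)

lemma polys_const [simp, intro]: "const c \<in> polys U"
  by (cases "c = 0") (auto simp: polys_def const_def)

lemma polys_0 [simp, intro]: "0 \<in> polys U" and polys_1 [simp, intro]: "1 \<in> polys U"
  using polys_const [of 0 U] polys_const [of 1 U] by auto

lemma polys_var [simp, intro]: "v \<in> U \<Longrightarrow> var v \<in> polys U"
  by (auto simp: polys_def var_def)

lemma polys_add [intro]: "p \<in> polys U \<Longrightarrow> q \<in> polys U \<Longrightarrow> p + q \<in> polys U"
  using keys_add [of p q] by (fastforce simp: polys_def)

lemma polys_mult [intro]: "p \<in> polys U \<Longrightarrow> q \<in> polys U \<Longrightarrow> p * q \<in> polys U"
  unfolding polys_def
proof (safe, goal_cases)
  case (1 a u)
  from keys_mult [of p q] \<open>a \<in> keys (p * q)\<close>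
  obtain b c where "a = b + c" "b \<in> keys p" "c \<in> keys q" by auto
  with 1 show ?case using keys_add [of b c] by blast
qed

lemma polys_sum [intro]: "(\<And>i. i \<in> S \<Longrightarrow> f i \<in> polys U) \<Longrightarrow> (\<Sum>i\<in>S. f i) \<in> polys U"
  by (induction S rule: infinite_finite_induct) auto

lemma polys_prod [intro]: "(\<And>i. i \<in> S \<Longrightarrow> f i \<in> polys U) \<Longrightarrow> (\<Prod>i\<in>S. f i) \<in> polys U"
  by (induction S rule: infinite_finite_induct) auto

lemma polys_power [intro]: "p \<in> polys U \<Longrightarrow> p ^ k \<in> polys U"
  by (induction k) auto

lemma polys_uminus [intro]: "p \<in> polys U \<Longrightarrow> - p \<in> polys U"
  using polys_mult [OF polys_const [of "-1"], of p U] by (simp add: const_uminus)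

lemma polys_minus [intro]: "p \<in> polys U \<Longrightarrow> q \<in> polys U \<Longrightarrow> p - q \<in> polys U"
  using polys_add [of p U "- q"] by auto

lemma polys_mono: "U \<subseteq> W \<Longrightarrow> polys U \<subseteq> polys W"
  by (auto simp: polys_def)

lemma polys_UNIV [simp]: "p \<in> polys UNIV"
  by (simp add: polys_def)

text \<open>Reduces identities between substitution homomorphisms to constants and
  variables.\<close>

lemma polys_induct [consumes 1, case_names const var add mult]:
  assumes p: "p \<in> polys U"
    and const: "\<And>c. Q (const c)"
    and var: "\<And>v. v \<in> U \<Longrightarrow> Q (var v)"
    and add: "\<And>p q. Q p \<Longrightarrow> Q q \<Longrightarrow> p \<in> polys U \<Longrightarrow> q \<in> polys U \<Longrightarrow> Q (p + q)"
    and mult: "\<And>p q. Q p \<Longrightarrow> Q q \<Longrightarrow> p \<in> polys U \<Longrightarrow> q \<in> polys U \<Longrightarrow> Q (p * q)"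
  shows "Q p"
proof -
  have Q1: "Q 1" and Q0: "Q 0" using const [of 1] const [of 0] by auto
  have pow: "Q (var v ^ k) \<and> var v ^ k \<in> polys U" if "v \<in> U" for v k
  proof (induction k)
    case (Suc k)
    then show ?case
      using that var [OF that] mult [of "var v" "var v ^ k"] by auto
  qed (use Q1 in auto)
  have prd: "Q (\<Prod>v\<in>F. var v ^ f v) \<and> (\<Prod>v\<in>F. var v ^ f v) \<in> polys U"
    if "F \<subseteq> U" for F and f :: "nat set \<Rightarrow> nat"
    using that
  proof (induction F rule: infinite_finite_induct)
    case (insert v F)
    then show ?case
      using pow [of v "f v"] mult [of "var v ^ f v" "\<Prod>v\<in>F. var v ^ f v"] by auto
  qed (use Q1 in auto)
  have sm: "Q (\<Sum>a\<in>F. const (f a) * mhom var a) \<and> (\<Sum>a\<in>F. const (f a) * mhom var a) \<in> polys U"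
    if "\<And>a. a \<in> F \<Longrightarrow> keys a \<subseteq> U" for F and f :: "expo \<Rightarrow> 'a"
    using that
  proof (induction F rule: infinite_finite_induct)
    case (insert a F)
    have "Q (mhom var a)" "mhom var a \<in> polys U"
      using prd [of "keys a"] insert.prems [of a] by (auto simp: mhom_def)
    then have "Q (const (f a) * mhom var a)" "const (f a) * mhom var a \<in> polys U"
      using mult const by auto
    with insert show ?case by (auto intro: add)
  qed (use Q0 in auto)
  show ?thesis
    using sm [of "keys p" "lookup p"] p poly_expand' [of p] by (auto simp: polys_def)
qed

lemma ev_actv: "ev x (actv \<pi> p) = ev (x \<circ> \<pi>) p"
  using polys_UNIV [of p] by (induction p rule: polys_induct) (auto simp: ev_simps actv_simps)

lemma actv_comp: "actv \<pi> (actv \<rho> p) = actv (\<pi> \<circ> \<rho>) p"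
  using polys_UNIV [of p] by (induction p rule: polys_induct) (auto simp: actv_simps)

lemma actv_id [simp]: "actv id p = p"
  using polys_UNIV [of p] by (induction p rule: polys_induct) (auto simp: actv_simps)

lemma actv_cong: "p \<in> polys U \<Longrightarrow> (\<And>v. v \<in> U \<Longrightarrow> \<pi> v = \<rho> v) \<Longrightarrow> actv \<pi> p = actv \<rho> p"
  by (induction p rule: polys_induct) (auto simp: actv_simps)

lemma actv_polys: "p \<in> polys U \<Longrightarrow> \<pi> ` U \<subseteq> W \<Longrightarrow> actv \<pi> p \<in> polys W"
  by (induction p rule: polys_induct) (auto simp: actv_simps)

section \<open>Homogeneous components\<close>

lemma mon_degree_superset:
  assumes "finite F" "keys a \<subseteq> F"
  shows "mon_degree a = (\<Sum>v\<in>F. lookup a v)"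
  unfolding mon_degree_def using assms
  by (intro sum.mono_neutral_left) (auto simp: in_keys_iff)

lemma mon_degree_add: "mon_degree (a + b) = mon_degree a + mon_degree b"
proof -
  let ?F = "keys a \<union> keys b"
  have "mon_degree (a + b) = (\<Sum>v\<in>?F. lookup (a + b) v)"
    by (rule mon_degree_superset) (auto simp: keys_add)
  also have "\<dots> = (\<Sum>v\<in>?F. lookup a v) + (\<Sum>v\<in>?F. lookup b v)"
    by (simp add: lookup_add sum.distrib)
  also have "(\<Sum>v\<in>?F. lookup a v) = mon_degree a"
    by (rule mon_degree_superset [symmetric]) auto
  also have "(\<Sum>v\<in>?F. lookup b v) = mon_degree b"
    by (rule mon_degree_superset [symmetric]) auto
  finally show ?thesis .
qed

lemma mon_degree_0 [simp]: "mon_degree 0 = 0"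
  by (simp add: mon_degree_def)

lemma mon_degree_single [simp]: "mon_degree (single v k) = k"
  by (cases "k = 0") (auto simp: mon_degree_def)

lemma mon_degree_eq_0_iff: "mon_degree a = 0 \<longleftrightarrow> a = 0"
  by (auto simp: mon_degree_def in_keys_iff intro!: poly_mapping_eqI)

lemma homogeneous_const [simp, intro]: "homogeneous 0 (const c)"
  by (cases "c = 0") (auto simp: homogeneous_def const_def)

lemma homogeneous_1 [simp, intro]: "homogeneous 0 1"
  using homogeneous_const [of 1] by simp

lemma homogeneous_0 [simp, intro]: "homogeneous d 0"
  by (simp add: homogeneous_def)

lemma homogeneous_var [simp, intro]: "homogeneous 1 (var v)"
  by (auto simp: homogeneous_def var_def)

lemma homogeneous_add [intro]: "homogeneous d p \<Longrightarrow> homogeneous d q \<Longrightarrow> homogeneous d (p + q)"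
  using keys_add [of p q] by (fastforce simp: homogeneous_def)

lemma homogeneous_mult [intro]:
  "homogeneous d p \<Longrightarrow> homogeneous e q \<Longrightarrow> homogeneous (d + e) (p * q)"
  using keys_mult [of p q] by (fastforce simp: homogeneous_def mon_degree_add)

lemma homogeneous_sum [intro]:
  "(\<And>i. i \<in> S \<Longrightarrow> homogeneous d (f i)) \<Longrightarrow> homogeneous d (\<Sum>i\<in>S. f i)"
  by (induction S rule: infinite_finite_induct) auto

lemma homogeneous_power: "homogeneous d p \<Longrightarrow> homogeneous (k * d) (p ^ k)"
  by (induction k) auto

lemma homogeneous_prod:
  "finite S \<Longrightarrow> (\<And>i. i \<in> S \<Longrightarrow> homogeneous (d i) (f i)) \<Longrightarrow> homogeneous (\<Sum>i\<in>S. d i) (\<Prod>i\<in>S. f i)"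
  by (induction S rule: finite_induct) auto

lemma homogeneous_const_mult [intro]: "homogeneous d p \<Longrightarrow> homogeneous d (const c * p)"
  using homogeneous_mult [of 0 "const c" d p] by auto

definition hcomp :: "nat \<Rightarrow> 'k::field_char_0 mpoly \<Rightarrow> 'k mpoly" where
  "hcomp d p = (\<Sum>a\<in>{a \<in> keys p. mon_degree a = d}. single a (lookup p a))"

lemma lookup_hcomp: "lookup (hcomp d p) a = (if mon_degree a = d then lookup p a else 0)"
proof -
  have "lookup (hcomp d p) a = (\<Sum>b\<in>{b \<in> keys p. mon_degree b = d}. if b = a then lookup p a else 0)"
    by (auto simp: hcomp_def lookup_sum lookup_single when_def intro!: sum.cong)
  also have "\<dots> = (if mon_degree a = d then lookup p a else 0)"
    by (subst sum.delta) (auto simp: in_keys_iff)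
  finally show ?thesis .
qed

lemma homogeneous_hcomp [simp, intro]: "homogeneous d (hcomp d p)"
  by (auto simp: homogeneous_def in_keys_iff lookup_hcomp split: if_splits)

lemma hcomp_0 [simp]: "hcomp d 0 = 0"
  by (simp add: hcomp_def)

lemma hcomp_add: "hcomp d (p + q) = hcomp d p + hcomp d q"
  by (rule poly_mapping_eqI) (auto simp: lookup_hcomp lookup_add)

lemma hcomp_minus: "hcomp d (p - q) = hcomp d p - hcomp d q"
  by (rule poly_mapping_eqI) (auto simp: lookup_hcomp lookup_minus)

lemma hcomp_sum: "hcomp d (\<Sum>i\<in>S. f i) = (\<Sum>i\<in>S. hcomp d (f i))"
  by (induction S rule: infinite_finite_induct) (auto simp: hcomp_add)

lemma hcomp_homogeneous: "homogeneous e p \<Longrightarrow> hcomp d p = (if d = e then p else 0)"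
  by (rule poly_mapping_eqI) (auto simp: lookup_hcomp homogeneous_def in_keys_iff)

lemma hcomp_polys [intro]: "p \<in> polys U \<Longrightarrow> hcomp d p \<in> polys U"
  by (auto simp: polys_def in_keys_iff lookup_hcomp split: if_splits)

lemma hcomp_expand: "p = (\<Sum>d\<in>mon_degree ` keys p. hcomp d p)"
  by (rule poly_mapping_eqI) (auto simp: lookup_sum lookup_hcomp in_keys_iff)

lemma hcomp_homogeneous_mult:
  assumes "homogeneous k f"
  shows "hcomp d (f * p) = (if k \<le> d then f * hcomp (d - k) p else 0)"
proof -
  let ?D = "mon_degree ` keys p"
  have "f * p = (\<Sum>j\<in>?D. f * hcomp j p)"
    by (subst hcomp_expand [of p]) (simp add: sum_distrib_left)
  then have "hcomp d (f * p) = (\<Sum>j\<in>?D. hcomp d (f * hcomp j p))"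
    by (simp add: hcomp_sum)
  also have "\<dots> = (\<Sum>j\<in>?D. if d = k + j then f * hcomp j p else 0)"
    by (intro sum.cong refl hcomp_homogeneous homogeneous_mult assms) auto
  also have "\<dots> = (\<Sum>j\<in>?D. if j = d - k then (if k \<le> d then f * hcomp j p else 0) else 0)"
    by (intro sum.cong refl) auto
  also have "\<dots> = (if d - k \<in> ?D then (if k \<le> d then f * hcomp (d - k) p else 0) else 0)"
    by (simp add: sum.delta)
  also have "\<dots> = (if k \<le> d then f * hcomp (d - k) p else 0)"
  proof (cases "d - k \<in> ?D")
    case False
    have "mon_degree a \<noteq> d - k" if "a \<in> keys p" for a
    proof
      assume "mon_degree a = d - k"
      with that have "d - k \<in> mon_degree ` keys p"
        by (metis imageI)
      with False show False by contradiction
    qed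
    then have "{a \<in> keys p. mon_degree a = d - k} = {}"
      by blast
    then have "hcomp (d - k) p = 0"
      unfolding hcomp_def by (simp only: sum.empty)
    then show ?thesis by simp
  qed simp
  finally show ?thesis .
qed

lemma hcomp_const_mult: "hcomp d (const c * p) = const c * hcomp d p"
  using hcomp_homogeneous_mult [of 0 "const c" d p] by simp

lemma hcomp_actv: "hcomp d (actv \<pi> p) = actv \<pi> (hcomp d p)"
proof -
  have hom: "homogeneous e (actv \<pi> f)" if "homogeneous e f" for e and f :: "'a mpoly"
  proof -
    have "homogeneous e (\<Prod>v\<in>keys a. var (\<pi> v) ^ lookup a v :: 'a mpoly)" if "a \<in> keys f" for a
    proof -
      have "homogeneous (lookup a v) (var (\<pi> v) ^ lookup a v :: 'a mpoly)" for v
        using homogeneous_power [OF homogeneous_var, of "lookup a v" "\<pi> v"] by simp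
      then have "homogeneous (mon_degree a) (\<Prod>v\<in>keys a. var (\<pi> v) ^ lookup a v :: 'a mpoly)"
        unfolding mon_degree_def by (intro homogeneous_prod) auto
      with that \<open>homogeneous e f\<close> show ?thesis
        by (auto simp: homogeneous_def)
    qed
    then show ?thesis
      unfolding actv_def psubst_def mhom_def by (intro homogeneous_sum homogeneous_const_mult)
  qed
  have "hcomp d (actv \<pi> p) = (\<Sum>j\<in>mon_degree ` keys p. hcomp d (actv \<pi> (hcomp j p)))"
    by (subst hcomp_expand [of p]) (simp add: actv_simps hcomp_sum)
  also have "\<dots> = (\<Sum>j\<in>mon_degree ` keys p. actv \<pi> (hcomp d (hcomp j p)))"
    by (intro sum.cong refl)
      (simp add: hcomp_homogeneous [OF hom [OF homogeneous_hcomp]]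
        hcomp_homogeneous [OF homogeneous_hcomp] actv_simps)
  also have "\<dots> = actv \<pi> (hcomp d (\<Sum>j\<in>mon_degree ` keys p. hcomp j p))"
    by (simp add: actv_simps hcomp_sum)
  finally show ?thesis by (simp flip: hcomp_expand)
qed

lemma homogeneous_actv: "homogeneous d p \<Longrightarrow> homogeneous d (actv \<pi> p)"
  using hcomp_actv [of d \<pi> p] hcomp_homogeneous [of d p d] homogeneous_hcomp by metis

section \<open>Subalgebras and module spans\<close>

definition subalg :: "'k::field_char_0 mpoly set \<Rightarrow> bool" where
  "subalg A \<longleftrightarrow> (\<forall>c. const c \<in> A) \<and> (\<forall>p\<in>A. \<forall>q\<in>A. p + q \<in> A \<and> p * q \<in> A)"

lemma subalg_generated [simp, intro]: "subalg (generated_algebra S)"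
  by (auto simp: subalg_def intro: generated_algebra.intros)

lemma subalg_polys [simp, intro]: "subalg (polys U)"
  by (auto simp: subalg_def)

context
  fixes A :: "'k::field_char_0 mpoly set"
  assumes A: "subalg A"
begin

lemma subalg_const: "const c \<in> A"
  using A by (simp add: subalg_def)

lemma subalg_0: "0 \<in> A" and subalg_1: "1 \<in> A"
  using subalg_const [of 0] subalg_const [of 1] by simp_all

lemma subalg_add: "p \<in> A \<Longrightarrow> q \<in> A \<Longrightarrow> p + q \<in> A"
  and subalg_mult: "p \<in> A \<Longrightarrow> q \<in> A \<Longrightarrow> p * q \<in> A"
  using A by (auto simp: subalg_def)

lemma subalg_uminus: "p \<in> A \<Longrightarrow> - p \<in> A"
  using subalg_mult [OF subalg_const [of "-1"], of p] by (simp add: const_uminus)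

lemma subalg_minus: "p \<in> A \<Longrightarrow> q \<in> A \<Longrightarrow> p - q \<in> A"
  using subalg_add [of p "- q"] subalg_uminus by simp

lemma subalg_power: "p \<in> A \<Longrightarrow> p ^ k \<in> A"
  by (induction k) (auto intro: subalg_1 subalg_mult)

lemma subalg_sum: "(\<And>i. i \<in> S \<Longrightarrow> f i \<in> A) \<Longrightarrow> (\<Sum>i\<in>S. f i) \<in> A"
  by (induction S rule: infinite_finite_induct) (auto intro: subalg_0 subalg_add)

lemma generated_algebra_subset: "S \<subseteq> A \<Longrightarrow> generated_algebra S \<subseteq> A"
proof
  fix p assume "S \<subseteq> A" "p \<in> generated_algebra S"
  from this(2) show "p \<in> A"
    by induction (use \<open>S \<subseteq> A\<close> subalg_const subalg_add subalg_mult in auto)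
qed

end

text \<open>With \<open>A\<close> the symmetric polynomials this is a submodule, with
  \<open>A = polys U\<close> it is an ideal; both uses share the closure lemmas.\<close>

definition mspan :: "'k::field_char_0 mpoly set \<Rightarrow> 'i set \<Rightarrow> ('i \<Rightarrow> 'k mpoly) \<Rightarrow> 'k mpoly set" where
  "mspan A J \<phi> = {\<Sum>j\<in>J. \<phi> j * q j | q. \<forall>j\<in>J. q j \<in> A}"

lemma mspanI: "(\<And>j. j \<in> J \<Longrightarrow> q j \<in> A) \<Longrightarrow> (\<Sum>j\<in>J. \<phi> j * q j) \<in> mspan A J \<phi>"
  by (auto simp: mspan_def)

lemma mspanE:
  assumes "p \<in> mspan A J \<phi>"
  obtains q where "\<forall>j\<in>J. q j \<in> A" "p = (\<Sum>j\<in>J. \<phi> j * q j)"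
  using assms by (auto simp: mspan_def)

context
  fixes A :: "'k::field_char_0 mpoly set"
  assumes A: "subalg A"
begin

lemma mspan_0: "0 \<in> mspan A J \<phi>"
  using mspanI [of J "\<lambda>_. 0" A \<phi>] subalg_0 [OF A] by simp

lemma mspan_add: "p \<in> mspan A J \<phi> \<Longrightarrow> q \<in> mspan A J \<phi> \<Longrightarrow> p + q \<in> mspan A J \<phi>"
proof (elim mspanE)
  fix f g assume "\<forall>j\<in>J. f j \<in> A" "p = (\<Sum>j\<in>J. \<phi> j * f j)"
    "\<forall>j\<in>J. g j \<in> A" "q = (\<Sum>j\<in>J. \<phi> j * g j)"
  then show ?thesis
    using mspanI [of J "\<lambda>j. f j + g j" A \<phi>] subalg_add [OF A]
    by (simp add: distrib_left sum.distrib)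
qed

lemma mspan_sum: "(\<And>i. i \<in> S \<Longrightarrow> f i \<in> mspan A J \<phi>) \<Longrightarrow> (\<Sum>i\<in>S. f i) \<in> mspan A J \<phi>"
  by (induction S rule: infinite_finite_induct) (auto intro: mspan_0 mspan_add)

lemma mspan_mult: "p \<in> mspan A J \<phi> \<Longrightarrow> a \<in> A \<Longrightarrow> p * a \<in> mspan A J \<phi>"
proof (elim mspanE)
  fix f assume "\<forall>j\<in>J. f j \<in> A" "p = (\<Sum>j\<in>J. \<phi> j * f j)" "a \<in> A"
  then show ?thesis
    using mspanI [of J "\<lambda>j. f j * a" A \<phi>] subalg_mult [OF A]
    by (simp add: sum_distrib_right mult.assoc)
qed

lemma mspan_base:
  assumes "finite J" "j \<in> J"
  shows "\<phi> j \<in> mspan A J \<phi>"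
proof -
  have "(\<Sum>i\<in>J. \<phi> i * (if i = j then 1 else 0)) \<in> mspan A J \<phi>"
    using subalg_0 [OF A] subalg_1 [OF A] by (intro mspanI) auto
  also have "(\<Sum>i\<in>J. \<phi> i * (if i = j then 1 else 0)) = (\<Sum>i\<in>J. if i = j then \<phi> i else 0)"
    by (intro sum.cong) auto
  finally show ?thesis
    using assms by simp
qed

lemma mspan_trans:
  assumes "p \<in> mspan A J \<phi>" "\<And>j. j \<in> J \<Longrightarrow> \<phi> j \<in> mspan A K \<psi>"
  shows "p \<in> mspan A K \<psi>"
  using assms(1) by (elim mspanE) (auto intro!: mspan_sum mspan_mult assms(2))

end

section \<open>Elementary symmetric polynomials\<close>

definition esym :: "nat set set \<Rightarrow> nat \<Rightarrow> 'k::field_char_0 mpoly" where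
  "esym U k = (\<Sum>A | A \<subseteq> U \<and> card A = k. \<Prod>v\<in>A. var v)"

lemma elem_sym_eq: "elem_sym n = esym (pairs n)"
  by (intro ext) (simp add: elem_sym_def esym_def)

lemma esym_0 [simp]:
  assumes "finite U"
  shows "esym U 0 = 1"
proof -
  have "{A. A \<subseteq> U \<and> card A = 0} = {{}}"
    using assms by (auto dest: finite_subset)
  then show ?thesis
    unfolding esym_def by simp
qed

lemma esym_eq_0:
  assumes "finite U" "card U < k"
  shows "esym U k = 0"
proof -
  have "{A. A \<subseteq> U \<and> card A = k} = {}"
    using assms(2) by (auto dest: card_mono [OF assms(1)])
  then show ?thesis
    unfolding esym_def by (simp only: sum.empty)
qed

lemma esym_insert:
  assumes U: "finite U" "v \<notin> U"
  shows "esym (insert v U) (Suc k) = esym U (Suc k) + var v * esym U k"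
proof -
  let ?F = "\<lambda>U k. {A. A \<subseteq> U \<and> card A = k}"
  have split: "?F (insert v U) (Suc k) = ?F U (Suc k) \<union> insert v ` ?F U k"
  proof (intro equalityI subsetI)
    fix A assume A: "A \<in> ?F (insert v U) (Suc k)"
    show "A \<in> ?F U (Suc k) \<union> insert v ` ?F U k"
    proof (cases "v \<in> A")
      case True
      have "finite A" using A U by (auto intro: finite_subset)
      with True A have "A = insert v (A - {v})" "A - {v} \<in> ?F U k"
        by auto
      then show ?thesis by blast
    qed (use A in auto)
  next
    fix A assume "A \<in> ?F U (Suc k) \<union> insert v ` ?F U k"
    then show "A \<in> ?F (insert v U) (Suc k)"
    proof
      assume "A \<in> insert v ` ?F U k"
      then obtain B where B: "A = insert v B" "B \<subseteq> U" "card B = k" by auto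
      then have "finite B" "v \<notin> B" using U by (auto intro: finite_subset)
      with B show ?thesis by auto
    qed auto
  qed
  have fin: "finite (?F U k)" for k
    using U by (auto intro: finite_subset [OF _ finite_Pow_iff [THEN iffD2]])
  have "esym (insert v U) (Suc k) =
      esym U (Suc k) + (\<Sum>A\<in>insert v ` ?F U k. \<Prod>v\<in>A. var v)"
    unfolding esym_def split using U fin
    by (intro sum.union_disjoint) auto
  also have "(\<Sum>A\<in>insert v ` ?F U k. \<Prod>v\<in>A. var v) = (\<Sum>A\<in>?F U k. \<Prod>v\<in>insert v A. var v)"
    using U by (subst sum.reindex) (auto simp: inj_on_def)
  also have "\<dots> = (\<Sum>A\<in>?F U k. var v * (\<Prod>v\<in>A. var v))"
    using U by (intro sum.cong refl prod.insert) (auto intro: finite_subset)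
  finally show ?thesis
    by (simp add: esym_def sum_distrib_left)
qed

text \<open>Unrolls the recursion \<open>esym_insert\<close> downwards: the elementary symmetric
  polynomials without \<open>v\<close> are polynomials in \<open>v\<close> over those with
  \<open>v\<close>. The reductions between \<open>insert v U\<close> and \<open>U\<close> below rest
  on this.\<close>

lemma esym_remove:
  assumes U: "finite U" "v \<notin> U"
  shows "(esym U k :: 'k::field_char_0 mpoly) = (\<Sum>j\<le>k. (- var v) ^ j * esym (insert v U) (k - j))"
proof (induction k)
  case (Suc k)
  have "(esym U (Suc k) :: 'k mpoly) = esym (insert v U) (Suc k) - var v * esym U k"
    by (simp add: esym_insert [OF U])
  also have "\<dots> = esym (insert v U) (Suc k) +
      (\<Sum>j\<le>k. (- var v) ^ Suc j * esym (insert v U) (Suc k - Suc j))"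
    unfolding Suc by (simp add: sum_distrib_left sum_negf mult.assoc)
  finally show ?case
    by (simp only: sum.atMost_Suc_shift) simp
qed (use U in simp)

lemma homogeneous_esym [intro]: "homogeneous k (esym U k)"
proof -
  have "homogeneous k (\<Prod>v\<in>A. var v)" if "card A = k" for A
    using homogeneous_prod [OF _ homogeneous_var, of A "\<lambda>v. v"] that
    by (cases "finite A") auto
  then show ?thesis
    unfolding esym_def by auto
qed

lemma esym_polys [intro]: "esym U k \<in> polys U"
  unfolding esym_def by (auto intro!: polys_sum polys_prod)

lemma actv_esym:
  assumes "\<pi> permutes U"
  shows "actv \<pi> (esym U k) = esym U k"
proof -
  have inj: "inj \<pi>" using assms by (rule permutes_inj)
  have im: "\<pi> ` U = U" using assms by (rule permutes_image)
  have "actv \<pi> (esym U k) = (\<Sum>A | A \<subseteq> U \<and> card A = k. \<Prod>v\<in>A. var (\<pi> v))"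
    by (simp add: esym_def actv_simps)
  also have "\<dots> = (\<Sum>A | A \<subseteq> U \<and> card A = k. \<Prod>v\<in>\<pi> ` A. var v)"
    using inj by (intro sum.cong refl) (simp add: prod.reindex inj_on_subset)
  also have "\<dots> = (\<Sum>A\<in>image \<pi> ` {A. A \<subseteq> U \<and> card A = k}. \<Prod>v\<in>A. var v)"
    using inj by (subst sum.reindex) (auto simp: inj_on_def inj_image_eq_iff)
  also have "image \<pi> ` {A. A \<subseteq> U \<and> card A = k} = {A. A \<subseteq> U \<and> card A = k}"
  proof (intro equalityI subsetI)
    fix A assume "A \<in> {A. A \<subseteq> U \<and> card A = k}"
    then have "A = \<pi> ` (inv \<pi> ` A)" "inv \<pi> ` A \<subseteq> U" "card (inv \<pi> ` A) = k"
      using assms permutes_inv [OF assms]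
      by (auto simp: image_image permutes_inverses permutes_in_image card_image
          permutes_inj_on permutes_surj surj_f_inv_f)
    then show "A \<in> image \<pi> ` {A. A \<subseteq> U \<and> card A = k}" by blast
  next
    fix A assume "A \<in> image \<pi> ` {A. A \<subseteq> U \<and> card A = k}"
    then show "A \<in> {A. A \<subseteq> U \<and> card A = k}"
      using inj im by (auto simp: card_image inj_on_subset)
  qed
  finally show ?thesis
    by (simp add: esym_def)
qed

definition symalg :: "nat set set \<Rightarrow> 'k::field_char_0 mpoly set" where
  "symalg U = generated_algebra (esym U ` {1..card U})"

lemma subalg_symalg [simp, intro]: "subalg (symalg U)"
  by (simp add: symalg_def)

lemma symalg_polys: "symalg U \<subseteq> polys U"
  unfolding symalg_def by (intro generated_algebra_subset) auto

lemma esym_symalg: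
  assumes "finite U"
  shows "esym U k \<in> symalg U"
proof (cases "k \<in> {1..card U}")
  case True
  then show ?thesis by (auto simp: symalg_def intro: generated_algebra.gen)
next
  case False
  then consider "k = 0" | "card U < k" by fastforce
  then show ?thesis
    by cases (use assms in \<open>simp_all add: esym_eq_0 subalg_0 subalg_1\<close>)
qed

lemma actv_symalg:
  assumes "\<pi> permutes U" "p \<in> symalg U"
  shows "actv \<pi> p = p"
  using assms(2) unfolding symalg_def
  by induction (use assms(1) in \<open>auto simp: actv_simps actv_esym\<close>)

lemma hcomp_mult:
  "hcomp d (p * q) = (\<Sum>j\<in>{j\<in>mon_degree ` keys p. j \<le> d}. hcomp j p * hcomp (d - j) q)"
proof -
  have "hcomp d (p * q) = (\<Sum>j\<in>mon_degree ` keys p. hcomp d (hcomp j p * q))"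
    by (subst hcomp_expand [of p]) (simp add: sum_distrib_right hcomp_sum)
  also have "\<dots> = (\<Sum>j\<in>mon_degree ` keys p. if j \<le> d then hcomp j p * hcomp (d - j) q else 0)"
    by (simp add: hcomp_homogeneous_mult [OF homogeneous_hcomp])
  finally show ?thesis
    by (simp add: sum.inter_filter)
qed

lemma hcomp_symalg:
  assumes "p \<in> symalg U"
  shows "hcomp d p \<in> symalg U"
  using assms unfolding symalg_def
proof (induction arbitrary: d)
  case (const c)
  then show ?case
    by (auto simp: hcomp_homogeneous [OF homogeneous_const] subalg_0 subalg_const)
next
  case (gen p)
  then obtain k where "p = esym U k" by auto
  with gen show ?case
    by (auto simp: hcomp_homogeneous [OF homogeneous_esym] subalg_0 intro: generated_algebra.gen)
next
  case (add p q)
  then show ?case by (simp add: hcomp_add subalg_add)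
next
  case (mult p q)
  then show ?case
    unfolding hcomp_mult by (intro subalg_sum subalg_mult) auto
qed

section \<open>Artin monomials\<close>

text \<open>An entry followed by \<open>r\<close> others ranges over \<open>{..r}\<close>, which
  gives \<open>fact n\<close> lists. They serve as the exponents of the Artin monomials: a variable
  in front of \<open>r\<close> others is a root of a monic polynomial of degree
  \<open>r + 1\<close>, so its powers up to \<open>r\<close> suffice.\<close>

fun exps :: "nat \<Rightarrow> nat list set" where
  "exps 0 = {[]}"
| "exps (Suc n) = (\<lambda>(k, ks). k # ks) ` ({..n} \<times> exps n)"

fun artin :: "nat set list \<Rightarrow> nat list \<Rightarrow> 'k::field_char_0 mpoly" where
  "artin (v # vs) (k # ks) = artin vs ks * var v ^ k"
| "artin _ _ = 1"

lemma finite_exps [simp, intro]: "finite (exps n)"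
  by (induction n) auto

lemma card_exps: "card (exps n) = fact n"
proof (induction n)
  case (Suc n)
  have "card (exps (Suc n)) = card ({..n} \<times> exps n)"
    by (simp only: exps.simps) (intro card_image, auto simp: inj_on_def)
  with Suc show ?case by (simp add: card_cartesian_product)
qed simp

lemma sum_exps_Suc: "(\<Sum>ks\<in>exps (Suc n). f ks) = (\<Sum>k\<le>n. \<Sum>ks\<in>exps n. f (k # ks))"
proof -
  have "(\<Sum>ks\<in>exps (Suc n). f ks) = (\<Sum>p\<in>{..n} \<times> exps n. f (fst p # snd p))"
    unfolding exps.simps by (subst sum.reindex) (auto simp: inj_on_def intro!: sum.cong)
  then show ?thesis
    by (simp add: sum.cartesian_product case_prod_unfold)
qed

lemma artin_polys: "artin vs ks \<in> polys (set vs)"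
proof (induction vs ks rule: artin.induct)
  case (1 v vs k ks)
  then show ?case
    using polys_mono [of "set vs" "set (v # vs)"] by auto
qed auto

lemma homogeneous_artin: "\<exists>d. homogeneous d (artin vs ks)"
proof (induction vs ks rule: artin.induct)
  case (1 v vs k ks)
  then show ?case
    using homogeneous_mult homogeneous_power [OF homogeneous_var] by fastforce
qed (auto intro: exI [of _ 0])

text \<open>Each variable is integral: it is a root of \<open>\<Prod>u\<in>U. (T - u)\<close>.\<close>

lemma var_power_card:
  assumes "finite U" "v \<notin> U"
  shows "(- var v) ^ Suc (card U) =
    - (\<Sum>j\<le>card U. (- var v) ^ j * esym (insert v U) (Suc (card U) - j))"
proof -
  have "0 = esym U (Suc (card U))"
    using assms by (simp add: esym_eq_0)
  also have "\<dots> = (\<Sum>j\<le>Suc (card U). (- var v) ^ j * esym (insert v U) (Suc (card U) - j))"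
    by (rule esym_remove [OF assms])
  finally show ?thesis
    using assms by (simp add: eq_neg_iff_add_eq_0 add.commute)
qed

text \<open>The expansion \<open>esym_remove\<close> is in powers of \<open>- var v\<close>; this
  passes to powers of \<open>var v\<close>.\<close>

lemma neg_power_mem:
  fixes x :: "'a::comm_ring_1"
  assumes "\<forall>p\<in>X. - p \<in> X"
  shows "(- x) ^ k \<in> X \<longleftrightarrow> x ^ k \<in> X"
  using bspec [OF assms, of "x ^ k"] bspec [OF assms, of "- (x ^ k)"] by (cases "even k") auto

text \<open>Multiplication by \<open>v\<close> shifts every power by one. Only the highest power
  leaves the range, and the integral equation \<open>var_power_card\<close> brings it back.\<close>

lemma var_power_span:
  assumes U: "finite U" "v \<notin> U"
  shows "var v ^ j \<in> mspan (symalg (insert v U)) {..card U} (\<lambda>k. var v ^ k)" (is "_ \<in> ?X")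
proof (induction j)
  case 0
  show ?case
    using mspan_base [of "symalg (insert v U)" "{..card U}" 0 "\<lambda>k. var v ^ k"] by simp
next
  let ?A = "symalg (insert v U) :: 'a mpoly set"
  have sgn: "- p \<in> ?X" if "p \<in> ?X" for p
    using mspan_mult [OF subalg_symalg that subalg_const [OF subalg_symalg, of "- 1"]]
    by (simp add: const_uminus)
  then have sgn': "\<forall>p\<in>?X. - p \<in> ?X" by blast
  have pow: "(- var v) ^ k \<in> ?X" if "k \<le> card U" for k
    using mspan_base [of ?A "{..card U}" k "\<lambda>k. var v ^ k"] that
    by (intro neg_power_mem [OF sgn', THEN iffD2]) auto
  have "(- var v) ^ Suc (card U) \<in> ?X"
    unfolding var_power_card [OF U]
    by (intro sgn mspan_sum mspan_mult pow esym_symalg) (use U in auto)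
  then have top: "var v ^ Suc (card U) \<in> ?X"
    by (rule neg_power_mem [OF sgn', THEN iffD1])
  case (Suc j)
  then obtain q where q: "\<forall>k\<in>{..card U}. q k \<in> ?A" "var v ^ j = (\<Sum>k\<le>card U. var v ^ k * q k)"
    by (elim mspanE) (rule that)
  have "var v ^ Suc j = (\<Sum>k\<le>card U. var v ^ Suc k * q k)"
    by (simp add: q(2) sum_distrib_left mult.assoc)
  also have "\<dots> \<in> ?X"
  proof (intro mspan_sum mspan_mult)
    fix k assume k: "k \<in> {..card U}"
    show "var v ^ Suc k \<in> ?X"
    proof (cases "k = card U")
      case False
      with k show ?thesis
        using mspan_base [of ?A "{..card U}" "Suc k" "\<lambda>k. var v ^ k"] by auto
    qed (use top in simp)
  qed (use q in auto)
  finally show ?case .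
qed

text \<open>Once the span is known to be a ring, containing \<open>symalg U\<close> can be tested on
  generators.\<close>

lemma subalg_var_span:
  assumes U: "finite U" "v \<notin> U"
  shows "subalg (mspan (symalg (insert v U)) {..card U} (\<lambda>k. var v ^ k))" (is "subalg ?X")
proof -
  have one: "1 \<in> ?X"
    using var_power_span [OF U, of 0] by simp
  have "const c \<in> ?X" for c
    using mspan_mult [OF subalg_symalg one subalg_const [OF subalg_symalg]] by simp
  moreover have "p * q \<in> ?X" if p: "p \<in> ?X" and q: "q \<in> ?X" for p q
  proof -
    obtain f where f: "\<forall>k\<in>{..card U}. f k \<in> symalg (insert v U)" "p = (\<Sum>k\<le>card U. var v ^ k * f k)"
      using p by (elim mspanE) (rule that)
    obtain g where g: "\<forall>k\<in>{..card U}. g k \<in> symalg (insert v U)" "q = (\<Sum>k\<le>card U. var v ^ k * g k)"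
      using q by (elim mspanE) (rule that)
    have "p * q = (\<Sum>k\<le>card U. \<Sum>l\<le>card U. var v ^ (k + l) * (f k * g l))"
      by (simp add: f g sum_product power_add mult_ac)
    also have "\<dots> \<in> ?X"
      by (intro mspan_sum mspan_mult var_power_span U subalg_mult) (use f(1) g(1) in auto)
    finally show ?thesis .
  qed
  ultimately show ?thesis
    by (auto simp: subalg_def intro: mspan_add)
qed

lemma symalg_var_span:
  assumes U: "finite U" "v \<notin> U"
  shows "symalg U \<subseteq> mspan (symalg (insert v U)) {..card U} (\<lambda>k. var v ^ k)" (is "_ \<subseteq> ?X")
proof -
  have X: "subalg ?X" by (rule subalg_var_span [OF U])
  have v: "- var v \<in> ?X"
    using subalg_uminus [OF X] var_power_span [OF U, of 1] by simp
  have incl: "p \<in> ?X" if "p \<in> symalg (insert v U)" for p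
    using mspan_mult [OF subalg_symalg subalg_1 [OF X] that] by simp
  have "esym U k \<in> ?X" for k
    unfolding esym_remove [OF U]
    by (intro subalg_sum [OF X] subalg_mult [OF X] subalg_power [OF X] v incl esym_symalg)
      (use U in auto)
  then show ?thesis
    unfolding symalg_def [of U] by (intro generated_algebra_subset [OF X]) auto
qed

text \<open>Induction along the list. The tail monomials have coefficients in
  \<open>symalg (set vs)\<close>; each of these, times a power of \<open>v\<close>, is rewritten in
  powers of \<open>v\<close> up to \<open>length vs\<close> over the symmetric polynomials of the
  longer list. Because \<open>subalg_var_span\<close> gives a ring, both reductions happen in a
  single step.\<close>

theorem Artin_span:
  assumes "distinct vs"
  shows "polys (set vs) \<subseteq> mspan (symalg (set vs)) (exps (length vs)) (artin vs)"
  using assms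
proof (induction vs)
  case Nil
  show ?case
  proof
    fix p :: "'a mpoly" assume "p \<in> polys (set [])"
    then have "p \<in> symalg {}"
      by (induction p rule: polys_induct)
        (auto simp: subalg_const subalg_add subalg_mult)
    then show "p \<in> mspan (symalg (set [])) (exps (length [])) (artin [])"
      by (auto simp: mspan_def)
  qed
next
  case (Cons v vs)
  let ?U = "set vs" and ?W = "mspan (symalg (set (v # vs))) (exps (length (v # vs))) (artin (v # vs))"
  have U: "finite ?U" "v \<notin> ?U" and card: "card ?U = length vs"
    using Cons.prems by (auto simp: distinct_card)
  let ?X = "mspan (symalg (insert v ?U)) {..card ?U} (\<lambda>k. var v ^ k)"
  have XW: "artin vs ks * p \<in> ?W" if ks: "ks \<in> exps (length vs)" and p: "p \<in> ?X" for ks and p :: "'a mpoly"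
  proof -
    obtain q where q: "\<forall>k\<in>{..card ?U}. q k \<in> symalg (insert v ?U)"
      "p = (\<Sum>k\<le>card ?U. var v ^ k * q k)"
      using p by (elim mspanE) (rule that)
    have "artin vs ks * p = (\<Sum>k\<le>card ?U. artin (v # vs) (k # ks) * q k)"
      by (simp add: q sum_distrib_left mult.assoc)
    also have "\<dots> \<in> ?W"
      using ks card q(1) by (intro mspan_sum mspan_mult mspan_base) auto
    finally show ?thesis .
  qed
  show ?case
  proof
    fix p :: "'a mpoly" assume p: "p \<in> polys (set (v # vs))"
    have "const c * mhom var a \<in> ?W" if a: "keys a \<subseteq> set (v # vs)" for a and c :: 'a
    proof -
      have "mhom var a = (\<Prod>u\<in>insert v ?U. var u ^ lookup a u :: 'a mpoly)"
        using a by (intro mhom_superset) auto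
      also have "\<dots> = (\<Prod>u\<in>?U. var u ^ lookup a u) * var v ^ lookup a v"
        using U by simp
      finally have eq: "const c * mhom var a =
          (const c * (\<Prod>u\<in>?U. var u ^ lookup a u)) * var v ^ lookup a v"
        by (simp add: mult.assoc)
      have "const c * (\<Prod>u\<in>?U. var u ^ lookup a u) \<in> polys ?U"
        by (auto intro!: polys_mult polys_prod polys_power)
      then have "const c * (\<Prod>u\<in>?U. var u ^ lookup a u) \<in> mspan (symalg ?U) (exps (length vs)) (artin vs)"
        using Cons by auto
      then obtain q where q: "\<forall>ks\<in>exps (length vs). q ks \<in> symalg ?U"
        "const c * (\<Prod>u\<in>?U. var u ^ lookup a u) = (\<Sum>ks\<in>exps (length vs). artin vs ks * q ks)"
        by (elim mspanE) (rule that)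
      have "const c * mhom var a = (\<Sum>ks\<in>exps (length vs). artin vs ks * (q ks * var v ^ lookup a v))"
        unfolding eq q(2) by (simp add: sum_distrib_right mult.assoc)
      also have "\<dots> \<in> ?W"
        using q(1) symalg_var_span [OF U] var_power_span [OF U]
        by (intro mspan_sum XW subalg_mult [OF subalg_var_span [OF U]]) auto
      finally show ?thesis .
    qed
    then have "(\<Sum>a\<in>keys p. const (lookup p a) * mhom var a) \<in> ?W"
      using p by (intro mspan_sum) (auto simp: polys_def)
    then show "p \<in> ?W"
      by (simp flip: poly_expand')
  qed
qed

section \<open>The ideal of symmetric polynomials without constant term\<close>

definition symideal :: "nat set set \<Rightarrow> 'k::field_char_0 mpoly set" where
  "symideal U = mspan (polys U) {1..card U} (esym U)"

lemma symideal_add: "p \<in> symideal U \<Longrightarrow> q \<in> symideal U \<Longrightarrow> p + q \<in> symideal U"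
  unfolding symideal_def by (intro mspan_add subalg_polys)

lemma symideal_0: "0 \<in> symideal U"
  unfolding symideal_def by (intro mspan_0 subalg_polys)

lemma symideal_sum: "(\<And>i. i \<in> S \<Longrightarrow> f i \<in> symideal U) \<Longrightarrow> (\<Sum>i\<in>S. f i) \<in> symideal U"
  unfolding symideal_def by (intro mspan_sum subalg_polys)

lemma symideal_mult: "p \<in> symideal U \<Longrightarrow> q \<in> polys U \<Longrightarrow> p * q \<in> symideal U"
  unfolding symideal_def by (intro mspan_mult subalg_polys)

lemma symideal_mult': "p \<in> symideal U \<Longrightarrow> q \<in> polys U \<Longrightarrow> q * p \<in> symideal U"
  using symideal_mult [of p U q] by (simp add: mult.commute)

lemma symideal_uminus: "p \<in> symideal U \<Longrightarrow> - p \<in> symideal U"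
  using symideal_mult [OF _ polys_const [of "- 1"], of p U] by (simp add: const_uminus)

lemma esym_symideal:
  assumes "finite U" "k > 0"
  shows "esym U k \<in> symideal U"
proof (cases "k \<le> card U")
  case True
  then show ?thesis
    unfolding symideal_def using assms by (intro mspan_base subalg_polys) auto
qed (use assms in \<open>simp add: esym_eq_0 symideal_0\<close>)

lemma symidealE:
  assumes "p \<in> symideal U"
  obtains r where "\<And>k. k \<in> {1..card U} \<Longrightarrow> r k \<in> polys U" "p = (\<Sum>k=1..card U. esym U k * r k)"
  using assms unfolding symideal_def by (elim mspanE) (rule that, auto)

lemma symideal_polys: "symideal U \<subseteq> polys U"
  by (auto elim!: symidealE intro!: polys_sum polys_mult)

lemma symideal_induct [consumes 1, case_names sum]:
  assumes "p \<in> symideal U"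
    and "\<And>S r. S \<subseteq> {1..card U} \<Longrightarrow> (\<And>k. k \<in> S \<Longrightarrow> r k \<in> polys U) \<Longrightarrow> Q (\<Sum>k\<in>S. esym U k * r k)"
  shows "Q p"
proof -
  obtain r where "\<And>k. k \<in> {1..card U} \<Longrightarrow> r k \<in> polys U" "p = (\<Sum>k=1..card U. esym U k * r k)"
    using assms(1) by (elim symidealE) (rule that)
  then show ?thesis
    using assms(2) [of "{1..card U}" r] by blast
qed

lemma hcomp_symideal:
  assumes "p \<in> symideal U"
  shows "hcomp d p \<in> symideal U"
  using assms
proof (induction p rule: symideal_induct)
  case (sum S r)
  have "esym U k \<in> symideal U" if "k \<in> S" for k
    using that sum(1) unfolding symideal_def by (intro mspan_base subalg_polys) auto
  then show ?case
    by (auto simp: hcomp_sum hcomp_homogeneous_mult [OF homogeneous_esym] symideal_0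
        intro!: symideal_sum symideal_mult hcomp_polys sum(2))
qed

lemma ev_0_esym:
  assumes "k > 0"
  shows "ev0 (esym U k) = 0"
  unfolding esym_def ev_simps prod_constant
  using assms by (intro sum.neutral) (simp add: power_0_left)

text \<open>The polynomials congruent to their constant term form a subalgebra, and every generator
  lies in the ideal and vanishes at 0. Membership in \<open>polys U\<close> is carried along because
  the ideal absorbs only factors from there.\<close>

lemma symalg_mod_symideal:
  assumes "p \<in> symalg U"
  shows "p - const (ev0 p) \<in> symideal U"
proof -
  have "p \<in> generated_algebra (esym U ` {1..card U})"
    using assms by (simp add: symalg_def)
  then have "p \<in> polys U \<and> p - const (ev0 p) \<in> symideal U"
  proof induction
    case (const c)
    then show ?case by (auto simp: ev_simps symideal_0)
  next
    case (gen p)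
    then obtain k where k: "p = esym U k" "k \<in> {1..card U}" by auto
    then have "p \<in> symideal U"
      unfolding symideal_def by (auto intro!: mspan_base subalg_polys)
    then show ?case using k by (auto simp: ev_0_esym)
  next
    case (add p q)
    then have "(p - const (ev0 p)) + (q - const (ev0 q)) \<in> symideal U"
      by (intro symideal_add) auto
    also have "(p - const (ev0 p)) + (q - const (ev0 q)) =
        p + q - const (ev0 (p + q))"
      by (simp add: ev_simps const_add)
    finally show ?case using add by auto
  next
    case (mult p q)
    have "(p - const (ev0 p)) * q + const (ev0 p) * (q - const (ev0 q)) \<in> symideal U"
      using mult by (intro symideal_add symideal_mult symideal_mult') auto
    also have "(p - const (ev0 p)) * q + const (ev0 p) * (q - const (ev0 q)) =
        p * q - const (ev0 (p * q))"
      by (simp add: ev_simps const_mult algebra_simps)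
    finally show ?case using mult by auto
  qed
  then show ?thesis by simp
qed

section \<open>The socle of the coinvariant algebra\<close>

text \<open>The Artin monomial with all exponents maximal. Its class spans the socle of the
  coinvariant algebra.\<close>

fun stair :: "nat set list \<Rightarrow> 'k::field_char_0 mpoly" where
  "stair [] = 1"
| "stair (v # vs) = stair vs * var v ^ length vs"

lemma stair_polys: "stair vs \<in> polys (set vs)"
proof (induction vs)
  case (Cons v vs)
  then show ?case
    using polys_mono [of "set vs" "set (v # vs)"] by auto
qed auto

lemma homogeneous_stair: "homogeneous (length vs choose 2) (stair vs)"
proof (induction vs)
  case (Cons v vs)
  then show ?case
    using homogeneous_mult [OF Cons homogeneous_power [OF homogeneous_var, of "length vs" v]]
    by (simp add: numeral_2_eq_2 add.commute)
qed (simp add: numeral_2_eq_2)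

text \<open>On the right-hand side of \<open>var_power_card\<close> every elementary symmetric
  polynomial has positive index.\<close>

lemma var_power_symideal:
  assumes U: "finite U" "v \<notin> U" and k: "k > card U"
  shows "var v ^ k \<in> symideal (insert v U)"
proof -
  have neg: "\<forall>p\<in>symideal (insert v U). - p \<in> symideal (insert v U)"
    using symideal_uminus by blast
  have "(- var v) ^ Suc (card U) \<in> symideal (insert v U)"
    unfolding var_power_card [OF U] using U
    by (intro symideal_uminus symideal_sum symideal_mult' esym_symideal polys_power polys_uminus) auto
  then have "var v ^ Suc (card U) \<in> symideal (insert v U)"
    by (rule neg_power_mem [OF neg, THEN iffD1])
  then have "var v ^ Suc (card U) * var v ^ (k - Suc (card U)) \<in> symideal (insert v U)"
    by (rule symideal_mult) auto
  then show ?thesis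
    using k by (simp flip: power_add power_Suc)
qed

text \<open>Expand \<open>esym U k\<close> by \<open>esym_remove\<close>. The terms with
  \<open>j < k\<close> contain a generator of the larger ideal; the term \<open>j = k\<close>
  becomes a power of \<open>v\<close> with exponent \<open>card U + k\<close>, which exceeds
  \<open>card U\<close> since \<open>k\<close> is positive.\<close>

lemma var_power_mult_symideal:
  assumes U: "finite U" "v \<notin> U" and p: "p \<in> symideal U"
  shows "var v ^ card U * p \<in> symideal (insert v U)"
  using p
proof (induction p rule: symideal_induct)
  case (sum S r)
  have neg: "\<forall>p\<in>symideal (insert v U). - p \<in> symideal (insert v U)"
    using symideal_uminus by blast
  have "var v ^ card U * (esym U k * r k) \<in> symideal (insert v U)" if k: "k \<in> S" for k
  proof -
    have "k \<ge> 1" using sum(1) k by auto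
    have "var v ^ card U * ((- var v) ^ j * esym (insert v U) (k - j)) \<in> symideal (insert v U)"
      if j: "j \<le> k" for j
    proof (cases "j = k")
      case True
      have "var v ^ card U * var v ^ k \<in> symideal (insert v U)"
        using \<open>k \<ge> 1\<close> unfolding power_add [symmetric] by (intro var_power_symideal U) auto
      then have "var v ^ card U * (- var v) ^ k \<in> symideal (insert v U)"
        using symideal_uminus by (cases "even k") auto
      then show ?thesis using True U by simp
    next
      case False
      then show ?thesis
        using j U by (intro symideal_mult' esym_symideal polys_power polys_uminus) auto
    qed
    then have "(\<Sum>j\<le>k. var v ^ card U * ((- var v) ^ j * esym (insert v U) (k - j))) \<in> symideal (insert v U)"
      by (intro symideal_sum) auto
    then have "var v ^ card U * esym U k \<in> symideal (insert v U)"
      by (simp add: esym_remove [OF U, of k] sum_distrib_left)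
    moreover have "r k \<in> polys (insert v U)"
      using sum(2) [OF k] polys_mono [of U "insert v U"] by auto
    ultimately have "var v ^ card U * esym U k * r k \<in> symideal (insert v U)"
      by (rule symideal_mult)
    then show ?thesis by (simp add: mult.assoc)
  qed
  then show ?case
    by (simp add: sum_distrib_left symideal_sum)
qed

text \<open>A triangularity argument, one variable at a time: the multiplier \<open>g\<close> pushes
  some Artin monomial with nonzero coefficient up to the staircase and all competing ones into the
  ideal.\<close>

lemma Artin_pairing:
  fixes c :: "nat list \<Rightarrow> 'k::field_char_0"
  assumes "distinct vs" "\<exists>ks\<in>exps (length vs). c ks \<noteq> 0"
  shows "\<exists>g\<in>polys (set vs). \<exists>\<kappa>. \<kappa> \<noteq> 0 \<and>
    (\<Sum>ks\<in>exps (length vs). const (c ks) * artin vs ks) * g - const \<kappa> * stair vs \<in> symideal (set vs)"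
  using assms
proof (induction vs arbitrary: c)
  case Nil
  then show ?case
    by (intro bexI [of _ 1] exI [of _ "c []"]) (auto simp: symideal_0)
next
  case (Cons v vs)
  let ?U = "set vs" and ?l = "length vs"
  let ?I = "symideal (insert v ?U) :: 'k mpoly set"
  have U: "finite ?U" "v \<notin> ?U" and card: "card ?U = ?l"
    using Cons.prems by (auto simp: distinct_card)
  define F where "F k = (\<Sum>ks\<in>exps ?l. const (c (k # ks)) * artin vs ks :: 'k mpoly)" for k
  define P where "P k \<longleftrightarrow> k \<le> ?l \<and> (\<exists>ks\<in>exps ?l. c (k # ks) \<noteq> 0)" for k
  \<comment> \<open>The least exponent of \<open>v\<close> that occurs. Multiplication by
    \<open>var v ^ (?l - k0)\<close> raises it to \<open>?l\<close>, the exponent in the staircase,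
    while every larger exponent then exceeds \<open>?l\<close> and falls into the ideal.\<close>
  define k0 where "k0 = (LEAST k. P k)"
  have "\<exists>k. P k" using Cons.prems(2) by (auto simp: P_def)
  then have k0: "P k0" unfolding k0_def by (rule LeastI_ex)
  have F0: "F k = 0" if "k < k0" for k
    using not_less_Least [of k P] that k0 by (auto simp: F_def P_def k0_def)
  obtain g \<kappa> where g: "g \<in> polys ?U" "\<kappa> \<noteq> 0" "F k0 * g - const \<kappa> * stair vs \<in> symideal ?U"
    using Cons.IH [of "\<lambda>ks. c (k0 # ks)"] Cons.prems(1) k0 by (auto simp: P_def F_def)
  define g' where "g' = var v ^ (?l - k0) * g"
  have pU: "p \<in> polys (insert v ?U)" if "p \<in> polys ?U" for p :: "'k mpoly"
    using polys_mono [of ?U "insert v ?U"] that by auto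
  have FU: "F k \<in> polys ?U" for k
    unfolding F_def by (auto intro!: polys_sum polys_mult artin_polys)
  have g': "g' \<in> polys (set (v # vs))"
    unfolding g'_def using pU [OF g(1)] by auto
  have "(\<Sum>ks\<in>exps (length (v # vs)). const (c ks) * artin (v # vs) ks) * g' =
      (\<Sum>k\<le>?l. F k * var v ^ k * g')"
    by (simp only: length_Cons sum_exps_Suc) (simp add: F_def sum_distrib_right mult.assoc)
  also have "\<dots> = F k0 * var v ^ k0 * g' + (\<Sum>k\<in>{..?l} - {k0}. F k * var v ^ k * g')"
    using k0 by (intro sum.remove) (auto simp: P_def)
  also have "F k0 * var v ^ k0 * g' = F k0 * g * var v ^ ?l"
    using k0 by (simp add: g'_def P_def mult_ac flip: power_add mult.assoc)
  finally have eq: "(\<Sum>ks\<in>exps (length (v # vs)). const (c ks) * artin (v # vs) ks) * g' - const \<kappa> * stair (v # vs)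
      = var v ^ card ?U * (F k0 * g - const \<kappa> * stair vs) + (\<Sum>k\<in>{..?l} - {k0}. F k * var v ^ k * g')"
    by (simp add: algebra_simps card)
  have "F k * var v ^ k * g' \<in> ?I" if "k \<in> {..?l} - {k0}" for k
  proof (cases "k < k0")
    case False
    then have "var v ^ (k + (?l - k0)) \<in> ?I"
      using that by (intro var_power_symideal U) (auto simp: card)
    then have "(F k * g) * var v ^ (k + (?l - k0)) \<in> ?I"
      by (intro symideal_mult' polys_mult pU FU g)
    then show ?thesis by (simp add: g'_def power_add mult_ac)
  qed (simp add: F0 symideal_0)
  then have "(\<Sum>ks\<in>exps (length (v # vs)). const (c ks) * artin (v # vs) ks) * g' - const \<kappa> * stair (v # vs) \<in> ?I"
    unfolding eq by (intro symideal_add var_power_mult_symideal symideal_sum U g)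
  with g' g(2) show ?case by auto
qed

text \<open>Modulo the ideal the Artin coefficients may be replaced by their constant terms; these
  cannot all vanish, as \<open>f\<close> would then lie in the ideal.\<close>

theorem symideal_pairing:
  assumes vs: "distinct vs" and f: "f \<in> polys (set vs)" "f \<notin> symideal (set vs)"
  shows "\<exists>g\<in>polys (set vs). \<exists>\<kappa>. \<kappa> \<noteq> 0 \<and> f * g - const \<kappa> * stair vs \<in> symideal (set vs)"
proof -
  let ?l = "length vs"
  have "f \<in> mspan (symalg (set vs)) (exps ?l) (artin vs)"
    using Artin_span [OF vs] f by auto
  then obtain q where q: "\<forall>ks\<in>exps ?l. q ks \<in> symalg (set vs)" "f = (\<Sum>ks\<in>exps ?l. artin vs ks * q ks)"
    by (elim mspanE) (rule that)
  define c where "c ks = ev0 (q ks)" for ks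
  define f' where "f' = (\<Sum>ks\<in>exps ?l. const (c ks) * artin vs ks)"
  have "f - f' = (\<Sum>ks\<in>exps ?l. artin vs ks * (q ks - const (c ks)))"
    unfolding f'_def q(2) by (simp add: algebra_simps sum_subtractf)
  also have "\<dots> \<in> symideal (set vs)"
    using q(1) unfolding c_def by (intro symideal_sum symideal_mult' symalg_mod_symideal artin_polys) auto
  finally have ff': "f - f' \<in> symideal (set vs)" .
  have "\<exists>ks\<in>exps ?l. c ks \<noteq> 0"
  proof (rule ccontr)
    assume "\<not> ?thesis"
    then have "f' = 0" by (simp add: f'_def)
    with ff' f(2) show False by simp
  qed
  from Artin_pairing [OF vs this] obtain g \<kappa> where g: "g \<in> polys (set vs)" "\<kappa> \<noteq> 0"
    "f' * g - const \<kappa> * stair vs \<in> symideal (set vs)"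
    unfolding f'_def by blast
  have "(f - f') * g + (f' * g - const \<kappa> * stair vs) \<in> symideal (set vs)"
    using ff' g by (intro symideal_add symideal_mult)
  also have "(f - f') * g + (f' * g - const \<kappa> * stair vs) = f * g - const \<kappa> * stair vs"
    by (simp add: algebra_simps)
  finally show ?thesis using g by blast
qed

section \<open>Antisymmetrization\<close>

definition anti :: "nat set set \<Rightarrow> 'k::field_char_0 mpoly \<Rightarrow> 'k mpoly" where
  "anti U f = (\<Sum>w | w permutes U. sgn_const w * actv w f)"

lemma anti_add: "anti U (f + g) = anti U f + anti U g"
  by (simp add: anti_def actv_simps distrib_left sum.distrib)

lemma anti_0 [simp]: "anti U 0 = 0"
  by (simp add: anti_def actv_simps)

lemma anti_sum: "anti U (\<Sum>i\<in>S. f i) = (\<Sum>i\<in>S. anti U (f i))"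
  by (induction S rule: infinite_finite_induct) (auto simp: anti_add)

lemma anti_minus: "anti U (f - g) = anti U f - anti U g"
  by (simp add: anti_def actv_minus right_diff_distrib sum_subtractf)

lemma anti_mult_invariant:
  assumes "\<And>w. w permutes U \<Longrightarrow> actv w s = s"
  shows "anti U (f * s) = anti U f * s"
  using assms by (auto simp: anti_def actv_simps sum_distrib_right mult.assoc intro!: sum.cong)

lemma anti_const_mult: "anti U (const c * f) = const c * anti U f"
  using anti_mult_invariant [of U "const c" f] by (simp add: actv_simps mult.commute)

lemma anti_symalg_mult: "s \<in> symalg U \<Longrightarrow> anti U (f * s) = anti U f * s"
  by (rule anti_mult_invariant) (rule actv_symalg)

lemma hcomp_anti: "hcomp d (anti U f) = anti U (hcomp d f)"
  by (simp add: anti_def hcomp_sum hcomp_const_mult hcomp_actv)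

lemma homogeneous_anti: "homogeneous d f \<Longrightarrow> homogeneous d (anti U f)"
  unfolding anti_def by (auto intro: homogeneous_actv)

lemma anti_actv:
  assumes U: "finite U" and \<tau>: "\<tau> permutes U"
  shows "anti U (actv \<tau> f) = sgn_const \<tau> * anti U f"
proof -
  have perm: "permutation w" if "w permutes U" for w
    using that U by (auto simp: permutation_permutes)
  have "anti U f = (\<Sum>w | w permutes U. const (of_int (sign (w \<circ> \<tau>))) * actv (w \<circ> \<tau>) f)"
    unfolding anti_def by (rule sum_permutations_compose_right [OF \<tau>])
  also have "\<dots> = (\<Sum>w | w permutes U. sgn_const \<tau> * (sgn_const w * actv w (actv \<tau> f)))"
    using perm \<tau> by (intro sum.cong refl)
      (simp add: sign_compose actv_comp const_mult mult_ac)
  also have "\<dots> = sgn_const \<tau> * anti U (actv \<tau> f)"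
    by (simp add: anti_def sum_distrib_left)
  finally have "sgn_const \<tau> * anti U f =
      const (of_int (sign \<tau> * sign \<tau>)) * anti U (actv \<tau> f)"
    by (simp only: of_int_mult const_mult mult.assoc)
  then show ?thesis by simp
qed

lemma mpoly_self_neg_0:
  assumes "(p :: 'k::field_char_0 mpoly) = - p"
  shows "p = 0"
proof (rule poly_mapping_eqI)
  fix a
  have "lookup p a = - lookup p a"
    by (subst assms) simp
  then show "lookup p a = lookup 0 a" by simp
qed

text \<open>The transposition has sign -1, so the antisymmetrization equals its own negative, and
  the characteristic is zero.\<close>

lemma anti_eq_0:
  assumes U: "finite U" and u: "u \<in> U" "w \<in> U" "u \<noteq> w"
    and f: "actv (tswap u w) f = f"
  shows "anti U f = 0"
proof -
  have "anti U (actv (tswap u w) f) =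
      const (of_int (sign (tswap u w))) * anti U f"
    by (rule anti_actv [OF U permutes_swap_id [OF u(1,2)]])
  then have "anti U f = - anti U f"
    using u by (simp add: f sign_swap_id const_uminus)
  then show ?thesis by (rule mpoly_self_neg_0)
qed

text \<open>The staircase has each exponent below \<open>length vs\<close> exactly once;
  \<open>u\<close> is the variable with exponent \<open>k\<close>, and \<open>r\<close> collects the
  others.\<close>

lemma stair_factor:
  assumes "distinct vs" "k < length vs"
  shows "\<exists>u\<in>set vs. \<exists>r\<in>polys (set vs - {u}). stair vs = r * var u ^ k"
  using assms
proof (induction vs)
  case (Cons v vs)
  show ?case
  proof (cases "k = length vs")
    case True
    then show ?thesis
      using Cons.prems stair_polys [of vs] by (intro bexI [of _ v] bexI [of _ "stair vs"]) auto
  next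
    case False
    with Cons obtain u r where ur: "u \<in> set vs" "r \<in> polys (set vs - {u})" "stair vs = (r :: 'a mpoly) * var u ^ k"
      by auto
    have "r \<in> polys (set (v # vs) - {u})"
      using ur(2) polys_mono [of "set vs - {u}" "set (v # vs) - {u}"] by auto
    moreover have "v \<noteq> u" using ur Cons.prems by auto
    ultimately have "r * var v ^ length vs \<in> polys (set (v # vs) - {u})"
      by (intro polys_mult polys_power polys_var) simp_all
    then show ?thesis
      using ur by (intro bexI [of _ u] bexI [of _ "r * var v ^ length vs"])
        (simp_all add: mult_ac)
  qed
qed auto

text \<open>Read the list from its end. At the first deviation from the staircase the exponent
  \<open>k\<close> of \<open>v\<close> is too small, hence it already occurs in the tail, which up
  to there is a staircase. Exchanging the two variables with equal exponent fixes the
  monomial.\<close>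

lemma artin_cases:
  assumes "distinct vs" "ks \<in> exps (length vs)"
  shows "artin vs ks = (stair vs :: 'k::field_char_0 mpoly) \<or>
    (\<exists>u\<in>set vs. \<exists>w\<in>set vs. u \<noteq> w \<and>
      actv (tswap u w) (artin vs ks) = (artin vs ks :: 'k mpoly))"
  using assms
proof (induction vs arbitrary: ks)
  case (Cons v vs)
  obtain k ks' where ks: "ks = k # ks'" "k \<le> length vs" "ks' \<in> exps (length vs)"
    using Cons.prems by auto
  have "distinct vs" using Cons.prems by simp
  from Cons.IH [OF this ks(3)] ks(2)
  consider (d) "artin vs ks' = (stair vs :: 'k mpoly)" "k = length vs"
    | (lt) "artin vs ks' = (stair vs :: 'k mpoly)" "k < length vs"
    | (tr) "\<exists>u\<in>set vs. \<exists>w\<in>set vs. u \<noteq> w \<and>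
        actv (tswap u w) (artin vs ks') = (artin vs ks' :: 'k mpoly)"
    unfolding le_less by argo
  then show ?case
  proof cases
    case d
    then show ?thesis by (simp add: ks)
  next
    case lt
    obtain u r where ur: "u \<in> set vs" "r \<in> polys (set vs - {u})" "stair vs = (r :: 'k mpoly) * var u ^ k"
      using stair_factor [of vs k] lt Cons.prems by auto
    have "actv (tswap u v) r = actv id r"
      using ur(2) Cons.prems(1)
      by (rule_tac actv_cong) (auto simp: Transposition.transpose_def)
    then have "actv (tswap u v) (artin (v # vs) ks) = (artin (v # vs) ks :: 'k mpoly)"
      by (simp add: ks lt ur actv_simps mult_ac)
    moreover have "u \<noteq> v" using ur Cons.prems by auto
    ultimately show ?thesis using ur(1) by (intro disjI2, rule_tac bexI [of _ u], rule_tac bexI [of _ v]) simp_all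
  next
    case tr
    then obtain u w where uw: "u \<in> set vs" "w \<in> set vs" "u \<noteq> w"
      "actv (tswap u w) (artin vs ks') = (artin vs ks' :: 'k mpoly)" by blast
    then have "v \<noteq> u" "v \<noteq> w" using Cons.prems by auto
    then show ?thesis
      using uw by (intro disjI2, rule_tac bexI [of _ u], rule_tac bexI [of _ w])
        (simp_all add: ks actv_simps Transposition.transpose_apply_other)
  qed
qed simp

text \<open>Antisymmetrization is linear over the symmetric polynomials, and of the Artin monomials
  only the staircase survives it.\<close>

lemma anti_factor:
  assumes vs: "distinct vs" and f: "f \<in> polys (set vs)"
  shows "\<exists>q\<in>symalg (set vs). anti (set vs) f = anti (set vs) (stair vs) * q"
proof -
  let ?l = "length vs" and ?U = "set vs"
  have "f \<in> mspan (symalg ?U) (exps ?l) (artin vs)"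
    using Artin_span [OF vs] f by auto
  then obtain q where q: "\<forall>ks\<in>exps ?l. q ks \<in> symalg ?U" "f = (\<Sum>ks\<in>exps ?l. artin vs ks * q ks)"
    by (elim mspanE) (rule that)
  let ?J = "{ks \<in> exps ?l. artin vs ks = (stair vs :: 'a mpoly)}"
  have "anti ?U f = (\<Sum>ks\<in>exps ?l. anti ?U (artin vs ks) * q ks)"
    using q(1) by (simp add: q(2) anti_sum anti_symalg_mult)
  also have "\<dots> = (\<Sum>ks\<in>exps ?l. if artin vs ks = (stair vs :: 'a mpoly) then anti ?U (stair vs) * q ks else 0)"
  proof (intro sum.cong refl)
    fix ks assume ks: "ks \<in> exps ?l"
    have "anti ?U (artin vs ks :: 'a mpoly) = 0" if ne: "artin vs ks \<noteq> (stair vs :: 'a mpoly)"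
    proof -
      obtain u w where "u \<in> ?U" "w \<in> ?U" "u \<noteq> w"
        "actv (tswap u w) (artin vs ks) = (artin vs ks :: 'a mpoly)"
        using artin_cases [OF vs ks, where 'k = 'a] ne by blast
      then show ?thesis by (intro anti_eq_0) auto
    qed
    then show "anti ?U (artin vs ks) * q ks =
      (if artin vs ks = (stair vs :: 'a mpoly) then anti ?U (stair vs) * q ks else 0)" by auto
  qed
  also have "\<dots> = anti ?U (stair vs) * (\<Sum>ks\<in>?J. q ks)"
    by (simp add: sum.inter_filter sum_distrib_left flip: sum.inter_filter)
  finally show ?thesis
    using q(1) by (intro bexI [of _ "\<Sum>ks\<in>?J. q ks"] subalg_sum [OF subalg_symalg]) auto
qed

section \<open>Evaluation at points with distinct coordinates\<close>

text \<open>A product over \<open>v\<close> of Lagrange polynomials in the single variable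
  \<open>v\<close> with nodes \<open>x u\<close>. Among the rearrangements of the point
  \<open>x\<close> it singles out \<open>x\<close> itself.\<close>

definition interp :: "nat set set \<Rightarrow> (nat set \<Rightarrow> 'k) \<Rightarrow> 'k::field_char_0 mpoly" where
  "interp U x = (\<Prod>v\<in>U. \<Prod>u\<in>U - {v}. const (inverse (x v - x u)) * (var v - const (x u)))"

lemma interp_polys: "interp U x \<in> polys U"
  unfolding interp_def by (auto intro!: polys_prod polys_mult polys_minus)

lemma ev_interp:
  assumes U: "finite U" and x: "inj_on x U" and w: "w permutes U"
  shows "ev (x \<circ> w) (interp U x) = (if w = id then 1 else 0)"
proof -
  have eq: "ev (x \<circ> w) (interp U x) =
      (\<Prod>v\<in>U. \<Prod>u\<in>U - {v}. inverse (x v - x u) * (x (w v) - x u))"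
    by (simp add: interp_def ev_simps ev_minus)
  show ?thesis
  proof (cases "w = id")
    case True
    have "inverse (x v - x u) * (x v - x u) = 1" if "v \<in> U" "u \<in> U - {v}" for u v
    proof -
      have "x v \<noteq> x u"
        using that inj_onD [OF x, of v u] by (metis DiffD1 DiffD2 singletonI)
      then show ?thesis by simp
    qed
    then have "ev (x \<circ> w) (interp U x) = 1"
      unfolding eq by (intro prod.neutral ballI) (simp_all add: True)
    then show ?thesis using True by simp
  next
    case False
    then obtain v where "w v \<noteq> v" by (auto simp: fun_eq_iff)
    moreover from this have "v \<in> U" using w by (auto simp: permutes_def)
    moreover from this have "w v \<in> U" using w by (simp add: permutes_in_image)
    ultimately have "(\<Prod>u\<in>U - {v}. inverse (x v - x u) * (x (w v) - x u)) = 0"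
      using U by (intro prod_zero bexI [of _ "w v"]) simp_all
    then have "\<exists>v\<in>U. (\<Prod>u\<in>U - {v}. inverse (x v - x u) * (x (w v) - x u)) = 0"
      using \<open>v \<in> U\<close> by (rule bexI)
    with U have "ev (x \<circ> w) (interp U x) = 0"
      unfolding eq by (rule prod_zero)
    then show ?thesis
      using False by simp
  qed
qed

lemma ev_anti: "ev x (anti U f) = (\<Sum>w | w permutes U. of_int (sign w) * ev (x \<circ> w) f)"
  by (simp add: anti_def ev_simps ev_actv)

text \<open>The antisymmetrization of \<open>interp\<close> has value 1 at \<open>x\<close>, since
  only the identity contributes, and it is a multiple of that of the staircase.\<close>

lemma ev_anti_stair_nonzero:
  assumes vs: "distinct vs" and x: "inj_on x (set vs)"
  shows "ev x (anti (set vs) (stair vs)) \<noteq> (0 :: 'k::field_char_0)"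
proof
  assume 0: "ev x (anti (set vs) (stair vs)) = (0 :: 'k)"
  let ?U = "set vs"
  obtain q where "anti ?U (interp ?U x) = anti ?U (stair vs) * q"
    using anti_factor [OF vs interp_polys] by blast
  then have "ev x (anti ?U (interp ?U x)) = 0"
    using 0 by (simp add: ev_simps)
  moreover have "ev x (anti ?U (interp ?U x)) = (\<Sum>w | w permutes ?U. if w = id then 1 else 0)"
    using x by (auto simp: ev_anti ev_interp intro!: sum.cong)
  moreover have "\<dots> = 1"
    by (simp add: sum.delta finite_permutations permutes_id)
  ultimately show False by simp
qed

section \<open>Points with distinct coordinates separate polynomials\<close>

lemma obtain_prime_labels:
  assumes "finite (U :: 'a set)"
  obtains f :: "'a \<Rightarrow> nat" where "inj_on f U" "\<And>v. v \<in> U \<Longrightarrow> prime (f v)"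
proof -
  obtain B where B: "B \<subseteq> {p::nat. prime p}" "finite B" "card B = card U"
    using infinite_arbitrarily_large [OF primes_infinite] by metis
  then obtain f where "bij_betw f U B"
    using finite_same_card_bij [OF assms B(2)] by metis
  with B that show ?thesis
    unfolding bij_betw_def by blast
qed

text \<open>
  Give the variables distinct primes as weights: by unique factorization the monomials take
  distinct values at such a point, so a polynomial vanishing at all its powers is zero.
\<close>

lemma zero_if_ev_zero:
  fixes p :: "'k::field_char_0 mpoly"
  assumes U: "finite U" and p: "p \<in> polys U"
    and ev0: "\<And>x. inj_on x U \<Longrightarrow> ev x p = 0"
  shows "p = 0"
proof (rule ccontr)
  assume "p \<noteq> 0"
  obtain f :: "nat set \<Rightarrow> nat" where f: "inj_on f U" "\<And>v. v \<in> U \<Longrightarrow> prime (f v)"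
    by (rule obtain_prime_labels [OF U]) (rule that)
  define M where "M a = (\<Prod>v\<in>U. f v ^ lookup a v)" for a
  have kU: "keys a \<subseteq> U" if "a \<in> keys p" for a
    using p that by (auto simp: polys_def)
  have Minj: "inj_on M (keys p)"
  proof (rule inj_onI)
    fix a b assume a: "a \<in> keys p" and b: "b \<in> keys p" and eq: "M a = M b"
    have mult: "multiplicity (f v) (M c) = lookup c v" if "v \<in> U" for v c
    proof -
      have "M c = (\<Prod>q\<in>f ` U. q ^ lookup c (the_inv_into U f q))"
        unfolding M_def by (subst prod.reindex [OF f(1)]) (simp add: the_inv_into_f_f [OF f(1)])
      also have "multiplicity (f v) \<dots> =
          (if f v \<in> f ` U then lookup c (the_inv_into U f (f v)) else 0)"
        using U f that by (intro multiplicity_prod_prime_powers) auto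
      finally show ?thesis
        using that by (simp add: the_inv_into_f_f [OF f(1)])
    qed
    show "a = b"
    proof (rule poly_mapping_eqI)
      fix v show "lookup a v = lookup b v"
      proof (cases "v \<in> U")
        case True
        then show ?thesis using mult [of v a] mult [of v b] eq by simp
      next
        case False
        then have "v \<notin> keys a" "v \<notin> keys b" using kU [OF a] kU [OF b] by blast+
        then show ?thesis by (simp add: in_keys_iff)
      qed
    qed
  qed
  have Mpos: "M a \<noteq> 0" for a
    unfolding M_def using U f(2) by (auto dest!: prime_gt_0_nat)
  \<comment> \<open>Exponents start at 1: zeroth powers of the primes would all coincide, and the
    hypothesis covers only points with distinct coordinates. The extra factor \<open>M a\<close> is
    nonzero by \<open>Mpos\<close>.\<close>
  have sum0: "(\<Sum>a\<in>keys p. lookup p a * of_nat (M a) ^ Suc k) = 0" for k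
  proof -
    define x :: "nat set \<Rightarrow> 'k" where "x v = of_nat (f v) ^ Suc k" for v
    have "inj_on x U"
    proof (rule inj_onI)
      fix u v assume "u \<in> U" "v \<in> U" "x u = x v"
      then have "of_nat (f u ^ Suc k) = (of_nat (f v ^ Suc k) :: 'k)"
        by (simp only: x_def of_nat_power)
      then have "f u ^ Suc k = f v ^ Suc k"
        by (simp only: of_nat_eq_iff)
      then have "f u = f v"
        by (rule power_inject_base) auto
      then show "u = v" using f(1) \<open>u \<in> U\<close> \<open>v \<in> U\<close> by (auto dest: inj_onD)
    qed
    then have "0 = ev x p" using ev0 by simp
    also have "\<dots> = (\<Sum>a\<in>keys p. lookup p a * mhom x a)"
      by (simp add: ev_def psubst_def)
    also have "\<dots> = (\<Sum>a\<in>keys p. lookup p a * of_nat (M a) ^ Suc k)"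
    proof (intro sum.cong refl)
      fix a assume "a \<in> keys p"
      have "mhom x a = (\<Prod>v\<in>U. x v ^ lookup a v)"
        using U kU [OF \<open>a \<in> keys p\<close>] by (rule mhom_superset)
      also have "\<dots> = (\<Prod>v\<in>U. (of_nat (f v) ^ lookup a v) ^ Suc k)"
        by (simp only: x_def power_mult [symmetric] mult.commute)
      also have "\<dots> = of_nat (M a) ^ Suc k"
        by (simp only: M_def of_nat_prod of_nat_power prod_power_distrib)
      finally show "lookup p a * mhom x a = lookup p a * of_nat (M a) ^ Suc k" by simp
    qed
    finally show ?thesis by simp
  qed
  have poly0: "(\<Sum>a\<in>keys p. lookup p a * of_nat (M a) * poly P (of_nat (M a))) = 0" for P :: "'k poly"
  proof -
    have "(\<Sum>a\<in>keys p. lookup p a * of_nat (M a) * poly P (of_nat (M a))) =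
        (\<Sum>a\<in>keys p. \<Sum>i\<le>degree P. coeff P i * (lookup p a * of_nat (M a) ^ Suc i))"
      by (simp add: poly_altdef sum_distrib_left mult_ac)
    also have "\<dots> = (\<Sum>i\<le>degree P. coeff P i * (\<Sum>a\<in>keys p. lookup p a * of_nat (M a) ^ Suc i))"
      by (subst sum.swap) (simp add: sum_distrib_left)
    finally show ?thesis by (simp only: sum0) simp
  qed
  obtain a where a: "a \<in> keys p" using \<open>p \<noteq> 0\<close> by fastforce
  \<comment> \<open>Vanishes at the values of all monomials except \<open>a\<close>, so the relation
    isolates the coefficient of \<open>a\<close>. This inverts the Vandermonde system by
    interpolation.\<close>
  let ?P = "\<Prod>b\<in>keys p - {a}. [:- of_nat (M b), 1:] :: 'k poly"
  have "0 = (\<Sum>b\<in>keys p. lookup p b * of_nat (M b) * poly ?P (of_nat (M b)))"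
    by (rule poly0 [symmetric])
  also have "\<dots> = (\<Sum>b\<in>keys p. if b = a then lookup p a * of_nat (M a) * poly ?P (of_nat (M a)) else 0)"
  proof (intro sum.cong refl)
    fix b assume "b \<in> keys p"
    then have "poly ?P (of_nat (M b)) = 0" if "b \<noteq> a"
      using that by (auto simp: poly_prod intro!: prod_zero bexI [of _ b])
    then show "lookup p b * of_nat (M b) * poly ?P (of_nat (M b)) =
        (if b = a then lookup p a * of_nat (M a) * poly ?P (of_nat (M a)) else 0)" by auto
  qed
  also have "\<dots> = lookup p a * of_nat (M a) * poly ?P (of_nat (M a))"
    using a by simp
  finally have "poly ?P (of_nat (M a)) = 0"
    using a Mpos [of a] by (auto simp: in_keys_iff)
  then obtain b where "b \<in> keys p - {a}" "of_nat (M a) = (of_nat (M b) :: 'k)"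
    by (auto simp: poly_prod)
  then show False
    using Minj a by (auto simp: inj_on_def)
qed

text \<open>At a point with distinct coordinates the first factor is nonzero, so \<open>q\<close>
  vanishes there, and such points detect polynomials.\<close>

lemma anti_stair_cancel:
  assumes vs: "distinct vs" and q: "q \<in> polys (set vs)" and eq: "anti (set vs) (stair vs) * q = 0"
  shows "q = 0"
proof (rule zero_if_ev_zero)
  fix x :: "nat set \<Rightarrow> 'a" assume x: "inj_on x (set vs)"
  have "ev x (anti (set vs) (stair vs)) * ev x q = 0"
    using eq by (simp flip: ev_simps(2) add: ev_simps)
  then show "ev x q = 0"
    using ev_anti_stair_nonzero [OF vs x] by simp
qed (use q in auto)

section \<open>Invariants of a permutation group\<close>

lemma ev_0_eq_lookup: "ev0 p = lookup p 0"
proof -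
  have mh: "mhom (\<lambda>_. 0) a = (if a = 0 then 1 else (0 :: 'a))" for a
  proof (cases "a = 0")
    case False
    then obtain v where "v \<in> keys a" by fastforce
    then have "mhom (\<lambda>_. 0 :: 'a) a = 0"
      unfolding mhom_def by (intro prod_zero bexI [of _ v]) (auto simp: in_keys_iff)
    with False show ?thesis by simp
  qed simp
  have "ev0 p = (\<Sum>a\<in>keys p. if a = 0 then lookup p 0 else 0)"
    unfolding ev_def psubst_def mh by (intro sum.cong refl) simp
  then show ?thesis
    by (simp add: in_keys_iff)
qed

lemma lookup_const_mult: "lookup (const c * q) a = c * lookup q a"
  by (simp add: const_def flip: mult_map_scale_conv_mult)
    (simp add: Poly_Mapping.map.rep_eq when_def)

text \<open>Any contribution involving a nonconstant monomial of \<open>h\<close> has degree larger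
  than that of \<open>a\<close>.\<close>

lemma lookup_mult_min:
  assumes min: "\<And>b. b \<in> keys q \<Longrightarrow> mon_degree a \<le> mon_degree b"
  shows "lookup (q * h) a = lookup q a * ev0 h"
proof -
  define h' where "h' = h - const (ev0 h)"
  have "lookup h' 0 = 0"
    unfolding ev_0_eq_lookup [symmetric] by (simp add: h'_def ev_minus ev_simps)
  then have h': "mon_degree b > 0" if "b \<in> keys h'" for b
    using that mon_degree_eq_0_iff [of b] by (cases "b = 0") (auto simp: in_keys_iff)
  have "a \<notin> keys (q * h')"
  proof
    assume "a \<in> keys (q * h')"
    then obtain b c where "a = b + c" "b \<in> keys q" "c \<in> keys h'"
      using keys_mult [of q h'] by blast
    then show False
      using min [of b] h' [of c] by (simp add: mon_degree_add)
  qed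
  then have "lookup (q * h') a = 0" by (simp add: in_keys_iff)
  moreover have "q * h = q * h' + const (ev0 h) * q"
    by (simp add: h'_def algebra_simps)
  ultimately show ?thesis
    by (simp add: lookup_add lookup_const_mult)
qed

lemma hcomp_0_symalg: "hcomp 0 q = const (ev0 q)"
  by (rule poly_mapping_eqI)
    (auto simp: lookup_hcomp const_def lookup_single mon_degree_eq_0_iff ev_0_eq_lookup when_def)

text \<open>The variables form a list because the Artin monomials depend on an order. The group is
  an arbitrary permutation group of the variables; vertices and pairs enter only when the locale is
  instantiated.\<close>

locale perm_invariants =
  fixes vs :: "nat set list" and G :: "(nat set \<Rightarrow> nat set) set"
  assumes vs: "distinct vs"
    and G_perm: "g \<in> G \<Longrightarrow> g permutes set vs"
    and G_id: "id \<in> G"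
    and G_comp: "g \<in> G \<Longrightarrow> h \<in> G \<Longrightarrow> g \<circ> h \<in> G"
    and G_inv: "g \<in> G \<Longrightarrow> inv g \<in> G"
begin

abbreviation "U \<equiv> set vs"
abbreviation "m \<equiv> length vs"

definition Inv :: "'k::field_char_0 mpoly set" where
  "Inv = {p \<in> polys U. \<forall>g\<in>G. actv g p = p}"

lemma card_U: "card U = m"
  using vs by (simp add: distinct_card)

lemma finite_G: "finite G"
  using G_perm by (intro finite_subset [OF _ finite_permutations [of U]]) auto

lemma card_G_pos: "card G > 0"
  using finite_G G_id by (auto simp: card_gt_0_iff)

lemma G_image: "g \<in> G \<Longrightarrow> g ` U \<subseteq> U"
  using permutes_image [OF G_perm] by simp

lemma G_permutation: "g \<in> G \<Longrightarrow> permutation g"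
  using G_perm by (auto simp: permutation_permutes)

lemma actv_polys_G: "g \<in> G \<Longrightarrow> f \<in> polys U \<Longrightarrow> actv g f \<in> polys U"
  using G_image by (intro actv_polys)

lemma sum_G_reindex:
  assumes h: "h \<in> G"
  shows "(\<Sum>g\<in>G. f (h \<circ> g)) = (\<Sum>g\<in>G. f g)"
proof (rule sum.reindex_bij_witness [of _ "\<lambda>g. inv h \<circ> g" "\<lambda>g. h \<circ> g"])
  have "inv h \<circ> (h \<circ> g) = g" "h \<circ> (inv h \<circ> g) = g" for g
    using permutes_inv_o [OF G_perm [OF h]] by (auto simp flip: comp_assoc)
  then show "\<And>g. g \<in> G \<Longrightarrow> inv h \<circ> (h \<circ> g) = g" "\<And>g. g \<in> G \<Longrightarrow> h \<circ> (inv h \<circ> g) = g"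
    by auto
qed (use G_comp G_inv h in auto)

lemma InvI: "p \<in> polys U \<Longrightarrow> (\<And>g. g \<in> G \<Longrightarrow> actv g p = p) \<Longrightarrow> p \<in> Inv"
  by (auto simp: Inv_def)

lemma Inv_polys: "p \<in> Inv \<Longrightarrow> p \<in> polys U"
  and actv_Inv: "p \<in> Inv \<Longrightarrow> g \<in> G \<Longrightarrow> actv g p = p"
  by (auto simp: Inv_def)

lemma subalg_Inv: "subalg Inv"
  by (auto simp: subalg_def Inv_def actv_simps)

lemma symalg_Inv: "symalg U \<subseteq> Inv"
  using symalg_polys actv_symalg [OF G_perm] by (auto simp: Inv_def)

lemma hcomp_Inv: "p \<in> Inv \<Longrightarrow> hcomp d p \<in> Inv"
  by (auto simp: Inv_def simp flip: hcomp_actv)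

text \<open>The Reynolds operator: a degree-preserving, \<open>Inv\<close>-linear projection onto
  \<open>Inv\<close>, available because \<open>card G\<close> is invertible in characteristic
  zero.\<close>

definition avg :: "'k::field_char_0 mpoly \<Rightarrow> 'k mpoly" where
  "avg f = const (inverse (of_nat (card G))) * (\<Sum>g\<in>G. actv g f)"

lemma avg_Inv:
  assumes "f \<in> polys U"
  shows "avg f \<in> Inv"
proof (rule InvI)
  show "avg f \<in> polys U"
    unfolding avg_def using assms by (intro polys_mult polys_sum actv_polys_G) auto
  fix h assume "h \<in> G"
  then show "actv h (avg f) = avg f"
    using sum_G_reindex [of h "\<lambda>g. actv g f"] by (simp add: avg_def actv_simps actv_comp)
qed

lemma avg_id:
  assumes "f \<in> Inv"
  shows "avg f = f"
proof -
  have "avg f = const (inverse (of_nat (card G))) * (of_nat (card G) * f)"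
    using assms by (simp add: avg_def actv_Inv)
  also have "of_nat (card G) = const (of_nat (card G) :: 'a)"
    by (simp add: const_def single_of_nat)
  also have "const (inverse (of_nat (card G))) * (const (of_nat (card G)) * f) =
      const (inverse (of_nat (card G)) * of_nat (card G)) * f"
    by (simp only: const_mult mult.assoc)
  finally show ?thesis
    using card_G_pos by simp
qed

lemma avg_mult: "s \<in> Inv \<Longrightarrow> avg (f * s) = avg f * s"
  by (simp add: avg_def actv_simps actv_Inv sum_distrib_right mult.assoc)

lemma avg_sum: "avg (\<Sum>i\<in>S. f i) = (\<Sum>i\<in>S. avg (f i))"
  unfolding avg_def actv_simps by (subst sum.swap) (simp add: sum_distrib_left)

lemma homogeneous_avg: "homogeneous d f \<Longrightarrow> homogeneous d (avg f)"
  unfolding avg_def by (auto intro: homogeneous_actv)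

lemma Inv_span: "Inv \<subseteq> mspan (symalg U) (exps m) (\<lambda>ks. avg (artin vs ks))"
proof
  fix f :: "'k::field_char_0 mpoly" assume f: "f \<in> Inv"
  then have "f \<in> mspan (symalg U) (exps m) (artin vs)"
    using Artin_span [OF vs] Inv_polys by blast
  then obtain q where q: "\<forall>ks\<in>exps m. q ks \<in> symalg U" "f = (\<Sum>ks\<in>exps m. artin vs ks * q ks)"
    by (elim mspanE) (rule that)
  have "f = avg f" using f by (simp add: avg_id)
  also have "\<dots> = (\<Sum>ks\<in>exps m. avg (artin vs ks) * q ks)"
    using q(1) symalg_Inv unfolding q(2) avg_sum by (intro sum.cong avg_mult) auto
  also have "\<dots> \<in> mspan (symalg U) (exps m) (\<lambda>ks. avg (artin vs ks))"
    using q(1) by (intro mspanI) auto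
  finally show "f \<in> mspan (symalg U) (exps m) (\<lambda>ks. avg (artin vs ks))" .
qed

text \<open>The generators are invariant, so applying the Reynolds operator makes the coefficients
  invariant as well.\<close>

lemma Inv_symidealE:
  assumes f: "f \<in> Inv" "f \<in> symideal U"
  obtains r where "\<And>k. k \<in> {1..m} \<Longrightarrow> r k \<in> Inv" "f = (\<Sum>k=1..m. esym U k * r k)"
proof -
  obtain r where r: "\<And>k. k \<in> {1..card U} \<Longrightarrow> r k \<in> polys U" "f = (\<Sum>k=1..card U. esym U k * r k)"
    using f(2) by (elim symidealE) (rule that)
  have e: "esym U k \<in> Inv" for k
    using symalg_Inv esym_symalg by blast
  have "f = avg f" using f by (simp add: avg_id)
  also have "\<dots> = (\<Sum>k=1..card U. avg (r k * esym U k))"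
    by (simp add: r(2) avg_sum mult.commute)
  also have "\<dots> = (\<Sum>k=1..m. esym U k * avg (r k))"
    by (simp add: avg_mult [OF e] mult.commute card_U)
  finally show ?thesis
    using r(1) by (intro that [of "\<lambda>k. avg (r k)"]) (auto simp: card_U avg_Inv)
qed

section \<open>The symmetrizing form\<close>

abbreviation disc :: "'k::field_char_0 mpoly" where
  "disc \<equiv> anti U (stair vs)"

lemma homogeneous_disc: "homogeneous (m choose 2) disc"
  by (intro homogeneous_anti homogeneous_stair)

lemma disc_nonzero: "disc \<noteq> 0"
  using anti_stair_cancel [OF vs polys_1] by auto

text \<open>The quotient exists by \<open>anti_factor\<close> and is unique by
  \<open>anti_stair_cancel\<close>, so the choice is determined on \<open>polys U\<close>.\<close>

definition form :: "'k::field_char_0 mpoly \<Rightarrow> 'k mpoly" where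
  "form f = (SOME q. q \<in> symalg U \<and> anti U f = disc * q)"

lemma form:
  assumes "f \<in> polys U"
  shows form_symalg: "form f \<in> symalg U" and anti_eq_form: "anti U f = disc * form f"
proof -
  have "\<exists>q. q \<in> symalg U \<and> anti U f = disc * q"
    using anti_factor [OF vs assms] by blast
  from someI_ex [OF this] show "form f \<in> symalg U" "anti U f = disc * form f"
    by (simp_all add: form_def)
qed

lemma form_polys: "f \<in> polys U \<Longrightarrow> form f \<in> polys U"
  using form_symalg symalg_polys by blast

lemma form_unique:
  assumes f: "f \<in> polys U" and q: "q \<in> polys U" "anti U f = disc * q"
  shows "form f = q"
proof -
  have "disc * (form f - q) = 0"
    using anti_eq_form [OF f] q by (simp add: right_diff_distrib)
  then have "form f - q = 0"
    by (rule anti_stair_cancel [OF vs polys_minus [OF form_polys [OF f] q(1)]])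
  then show ?thesis by simp
qed

lemma form_mult:
  assumes f: "f \<in> polys U" and s: "s \<in> symalg U"
  shows "form (f * s) = form f * s"
proof (rule form_unique)
  show "anti U (f * s) = disc * (form f * s)"
    using anti_symalg_mult [OF s] anti_eq_form [OF f] by (simp add: mult.assoc)
qed (use f s form_polys symalg_polys in auto)

lemma form_sum:
  assumes "\<And>i. i \<in> S \<Longrightarrow> f i \<in> polys U"
  shows "form (\<Sum>i\<in>S. f i) = (\<Sum>i\<in>S. form (f i))"
proof (rule form_unique)
  show "anti U (\<Sum>i\<in>S. f i) = disc * (\<Sum>i\<in>S. form (f i))"
    unfolding anti_sum sum_distrib_left by (intro sum.cong anti_eq_form assms refl)
qed (use assms form_polys in auto)

lemma form_minus:
  assumes "f \<in> polys U" "g \<in> polys U"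
  shows "form (f - g) = form f - form g"
proof (rule form_unique)
  show "anti U (f - g) = disc * (form f - form g)"
    using assms by (simp add: anti_minus anti_eq_form right_diff_distrib)
qed (use assms form_polys in auto)

text \<open>The form is linear over the symmetric polynomials; the generators come out as factors,
  and they vanish at 0.\<close>

lemma form_symideal:
  assumes "f \<in> symideal U"
  shows "ev0 (form f) = 0"
proof -
  obtain r where r: "\<And>k. k \<in> {1..card U} \<Longrightarrow> r k \<in> polys U" "f = (\<Sum>k=1..card U. esym U k * r k)"
    using assms by (elim symidealE) (rule that)
  have "form f = (\<Sum>k=1..card U. form (r k * esym U k))"
    using r(1) unfolding r(2) by (subst form_sum) (auto simp: mult.commute)
  also have "\<dots> = (\<Sum>k=1..card U. form (r k) * esym U k)"
    using r(1) by (intro sum.cong refl form_mult esym_symalg) auto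
  finally show ?thesis
    by (simp add: ev_simps ev_0_esym)
qed

lemma form_const_mult_stair: "form (const c * stair vs) = const c"
  by (rule form_unique) (auto simp: anti_const_mult mult.commute intro: stair_polys)

text \<open>The constant term of the form factors through the quotient by the ideal and takes the
  staircase to 1, so it reads off the scalar \<kappa> supplied by
  \<open>symideal_pairing\<close>.\<close>

lemma form_nondegenerate:
  assumes f: "f \<in> polys U" "f \<notin> symideal U"
  shows "\<exists>g\<in>polys U. ev0 (form (f * g)) \<noteq> 0"
proof -
  obtain g \<kappa> where g: "g \<in> polys U" "\<kappa> \<noteq> 0" "f * g - const \<kappa> * stair vs \<in> symideal U"
    using symideal_pairing [OF vs f] by blast
  have "form (f * g - const \<kappa> * stair vs) = form (f * g) - const \<kappa>"
    using f g by (subst form_minus) (auto intro: stair_polys simp: form_const_mult_stair)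
  with form_symideal [OF g(3)] have "ev0 (form (f * g)) = \<kappa>"
    by (simp add: ev_minus ev_simps)
  with g show ?thesis by blast
qed

text \<open>Since \<open>disc\<close> is homogeneous of exactly this degree, only the constant term
  of the form contributes.\<close>

lemma hcomp_anti_top:
  assumes "f \<in> polys U"
  shows "hcomp (m choose 2) (anti U f) = const (ev0 (form f)) * disc"
proof -
  have "hcomp (m choose 2) (anti U f) = disc * const (ev0 (form f))"
    by (simp add: anti_eq_form [OF assms] hcomp_homogeneous_mult [OF homogeneous_disc] hcomp_0_symalg)
  then show ?thesis by (simp only: mult.commute)
qed

lemma const_mult_eq_0:
  assumes "const c * p = 0" "c \<noteq> 0"
  shows "p = 0"
proof -
  have "p = const (inverse c * c) * p" using assms by simp
  also have "\<dots> = const (inverse c) * (const c * p)" by (simp only: const_mult mult.assoc)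
  finally show ?thesis using assms by simp
qed

text \<open>The constant term of the form depends only on the component of \<open>f * g\<close> in
  degree \<open>m choose 2\<close>. Its being nonzero bounds \<open>d\<close> and allows
  \<open>g\<close> to be replaced by its component of complementary degree.\<close>

lemma homogeneous_pairing:
  assumes f: "f \<in> polys U" "homogeneous d f" "f \<notin> symideal U"
  shows "d \<le> m choose 2 \<and> (\<exists>g\<in>polys U. homogeneous ((m choose 2) - d) g \<and> anti U (f * g) \<noteq> 0)"
proof -
  let ?N = "m choose 2"
  obtain g where g: "g \<in> polys U" "ev0 (form (f * g)) \<noteq> 0"
    using form_nondegenerate [OF f(1,3)] by blast
  have "hcomp ?N (anti U (f * g)) \<noteq> 0"
    using hcomp_anti_top [of "f * g"] f g const_mult_eq_0 disc_nonzero by fastforce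
  then have nz: "anti U (hcomp ?N (f * g)) \<noteq> 0"
    by (simp add: hcomp_anti)
  then have "d \<le> ?N"
    by (auto simp: hcomp_homogeneous_mult [OF f(2)] split: if_splits)
  then have "anti U (f * hcomp (?N - d) g) \<noteq> 0"
    using nz by (simp add: hcomp_homogeneous_mult [OF f(2)])
  then show ?thesis
    using \<open>d \<le> ?N\<close> g by blast
qed

text \<open>
  A relation with coefficients in the symmetric polynomials is reduced, via the form, to a linear
  relation modulo the ideal among the coefficients of one monomial of least degree.
\<close>

lemma symalg_independent:
  fixes b q :: "'i \<Rightarrow> 'k::field_char_0 mpoly"
  assumes J: "finite J" and b: "\<And>j. j \<in> J \<Longrightarrow> b j \<in> polys U"
    and indep: "\<And>u. (\<Sum>j\<in>J. const (u j) * b j) \<in> symideal U \<Longrightarrow> \<forall>j\<in>J. u j = 0"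
    and q: "\<And>j. j \<in> J \<Longrightarrow> q j \<in> symalg U" and rel: "(\<Sum>j\<in>J. b j * q j) = 0"
  shows "\<forall>j\<in>J. q j = 0"
proof (rule ccontr)
  assume "\<not> ?thesis"
  then obtain j0 where "j0 \<in> J" "keys (q j0) \<noteq> {}" by auto
  then obtain a0 where "a0 \<in> (\<Union>j\<in>J. keys (q j))" by blast
  then obtain a where a: "a \<in> (\<Union>j\<in>J. keys (q j))"
    and min: "\<And>b. b \<in> (\<Union>j\<in>J. keys (q j)) \<Longrightarrow> mon_degree a \<le> mon_degree b"
    using ex_has_least_nat [of "\<lambda>a. a \<in> (\<Union>j\<in>J. keys (q j))" a0 mon_degree] by blast
  define u where "u j = lookup (q j) a" for j
  have "\<not> (\<forall>j\<in>J. u j = 0)"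
    using a by (auto simp: u_def in_keys_iff)
  then have "(\<Sum>j\<in>J. const (u j) * b j) \<notin> symideal U"
    using indep by blast
  moreover have "(\<Sum>j\<in>J. const (u j) * b j) \<in> polys U"
    using b by auto
  ultimately obtain g where g: "g \<in> polys U" "ev0 (form ((\<Sum>j\<in>J. const (u j) * b j) * g)) \<noteq> 0"
    using form_nondegenerate by blast
  have bg: "b j * g \<in> polys U" if "j \<in> J" for j
    using b [OF that] g by auto
  have "form ((\<Sum>j\<in>J. const (u j) * b j) * g) = form (\<Sum>j\<in>J. (b j * g) * const (u j))"
    by (simp add: sum_distrib_left sum_distrib_right mult_ac)
  also have "\<dots> = (\<Sum>j\<in>J. form ((b j * g) * const (u j)))"
    using bg by (intro form_sum) auto
  also have "\<dots> = (\<Sum>j\<in>J. form (b j * g) * const (u j))"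
    using bg by (intro sum.cong refl form_mult subalg_const) auto
  finally have "(\<Sum>j\<in>J. u j * ev0 (form (b j * g))) \<noteq> 0"
    using g by (simp add: ev_simps mult.commute)
  moreover have "(\<Sum>j\<in>J. u j * ev0 (form (b j * g))) = 0"
  proof -
    have "0 = form ((\<Sum>j\<in>J. b j * q j) * g)"
      unfolding rel by (intro form_unique [symmetric]) auto
    also have "\<dots> = form (\<Sum>j\<in>J. (b j * g) * q j)"
      by (simp add: sum_distrib_left sum_distrib_right mult_ac)
    also have "\<dots> = (\<Sum>j\<in>J. form ((b j * g) * q j))"
      using bg q symalg_polys by (intro form_sum) blast
    also have "\<dots> = (\<Sum>j\<in>J. form (b j * g) * q j)"
      by (intro sum.cong refl form_mult bg q)
    also have "\<dots> = (\<Sum>j\<in>J. q j * form (b j * g))"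
      by (intro sum.cong refl mult.commute)
    finally have "0 = lookup (\<Sum>j\<in>J. q j * form (b j * g)) a" by simp
    also have "\<dots> = (\<Sum>j\<in>J. u j * ev0 (form (b j * g)))"
      unfolding lookup_sum u_def using min by (intro sum.cong refl lookup_mult_min) auto
    finally show ?thesis by simp
  qed
  ultimately show False by simp
qed

section \<open>Existence of secondary invariants\<close>

definition secondary :: "nat \<Rightarrow> (nat \<Rightarrow> 'k::field_char_0 mpoly) \<Rightarrow> (nat \<Rightarrow> nat) \<Rightarrow> bool" where
  "secondary t \<eta> e \<longleftrightarrow>
     (\<forall>i\<in>{1..t}. \<eta> i \<in> Inv \<and> homogeneous (e i) (\<eta> i)) \<and>
     (\<forall>f\<in>Inv. \<exists>!q. q \<in> {1..t} \<rightarrow>\<^sub>E symalg U \<and> f = (\<Sum>i=1..t. \<eta> i * q i))"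

definition hom_gens :: "'k::field_char_0 mpoly set \<Rightarrow> bool" where
  "hom_gens B \<longleftrightarrow> finite B \<and> B \<subseteq> Inv \<and> (\<forall>b\<in>B. \<exists>d. homogeneous d b) \<and> Inv \<subseteq> mspan (symalg U) B (\<lambda>b. b)"

lemma hom_gens_exist: "hom_gens ((\<lambda>ks. avg (artin vs ks)) ` exps m)"
proof -
  let ?B = "(\<lambda>ks. avg (artin vs ks)) ` exps m :: 'a mpoly set"
  have "?B \<subseteq> Inv" by (auto intro: avg_Inv artin_polys)
  moreover have "\<forall>b\<in>?B. \<exists>d. homogeneous d b"
    using homogeneous_avg homogeneous_artin by blast
  moreover have "Inv \<subseteq> mspan (symalg U) ?B (\<lambda>b. b)"
  proof
    fix f :: "'a mpoly" assume "f \<in> Inv"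
    then have "f \<in> mspan (symalg U) (exps m) (\<lambda>ks. avg (artin vs ks))"
      using Inv_span by blast
    then show "f \<in> mspan (symalg U) ?B (\<lambda>b. b)"
      by (rule mspan_trans [OF subalg_symalg]) (intro mspan_base subalg_symalg, auto)
  qed
  ultimately show ?thesis
    by (simp add: hom_gens_def)
qed

text \<open>A graded Nakayama argument: a nontrivial relation modulo the ideal would express one
  generator by the remaining ones, against minimality.\<close>

lemma minimal_hom_gens_independent:
  fixes u :: "'k::field_char_0 mpoly \<Rightarrow> 'k"
  assumes B: "hom_gens B" and min: "\<And>B' :: 'k mpoly set. hom_gens B' \<Longrightarrow> card B \<le> card B'"
    and rel: "(\<Sum>b\<in>B. const (u b) * b) \<in> symideal U"
  shows "\<forall>b\<in>B. u b = 0"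
proof (rule ccontr)
  assume "\<not> ?thesis"
  then obtain b0 where b0: "b0 \<in> B" "u b0 \<noteq> 0" by blast
  let ?B = "B - {b0}"
  let ?M = "mspan (symalg U) ?B (\<lambda>b. b) :: 'k mpoly set"
  have fin: "finite B" and BI: "B \<subseteq> Inv" using B by (auto simp: hom_gens_def)
  have "\<forall>b\<in>B. \<exists>d. homogeneous d b" using B by (simp add: hom_gens_def)
  then obtain dg where dg: "\<And>b. b \<in> B \<Longrightarrow> homogeneous (dg b) b" by metis
  define d where "d = dg b0"
  \<comment> \<open>The component in the degree of \<open>b0\<close>: it still lies in the ideal,
    and \<open>b0\<close> keeps its nonzero coefficient.\<close>
  define f where "f = hcomp d (\<Sum>b\<in>B. const (u b) * b)"
  have f_eq: "f = (\<Sum>b\<in>B. const (u b) * (if dg b = d then b else 0))"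
    unfolding f_def hcomp_sum hcomp_const_mult
    by (intro sum.cong refl) (auto simp: hcomp_homogeneous [OF dg])
  have fI: "f \<in> Inv"
    unfolding f_def using BI
    by (intro hcomp_Inv subalg_sum [OF subalg_Inv] subalg_mult [OF subalg_Inv] subalg_const [OF subalg_Inv]) auto
  have fS: "f \<in> symideal U"
    unfolding f_def by (rule hcomp_symideal [OF rel])
  obtain r where r: "\<And>k. k \<in> {1..m} \<Longrightarrow> r k \<in> Inv" "f = (\<Sum>k=1..m. esym U k * r k)"
    by (rule Inv_symidealE [OF fI fS]) (rule that)
  \<comment> \<open>In degrees below that of \<open>b0\<close> the generator \<open>b0\<close>
    cannot contribute. The generators of the ideal have positive degree, so the coefficients of
    \<open>f\<close> live in such degrees.\<close>
  have low: "hcomp d' p \<in> ?M" if p: "p \<in> Inv" and d': "d' < d" for p d'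
  proof -
    have "p \<in> mspan (symalg U) B (\<lambda>b. b)" using B p by (auto simp: hom_gens_def)
    then obtain q where q: "\<forall>b\<in>B. q b \<in> symalg U" "p = (\<Sum>b\<in>B. b * q b)"
      by (elim mspanE) (rule that)
    have "hcomp d' p = (\<Sum>b\<in>B. if dg b \<le> d' then b * hcomp (d' - dg b) (q b) else 0)"
      unfolding q(2) hcomp_sum by (intro sum.cong refl hcomp_homogeneous_mult dg)
    also have "\<dots> \<in> ?M"
    proof (intro mspan_sum [OF subalg_symalg])
      fix b assume b: "b \<in> B"
      show "(if dg b \<le> d' then b * hcomp (d' - dg b) (q b) else 0) \<in> ?M"
      proof (cases "dg b \<le> d'")
        case True
        then have "b \<in> ?B" using b d' by (auto simp: d_def)
        then have "b \<in> ?M"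
          using mspan_base [OF subalg_symalg, where J = ?B and j = b and \<phi> = "\<lambda>b. b"] fin by simp
        then show ?thesis
          using True q(1) b by (auto intro!: mspan_mult hcomp_symalg)
      qed (auto intro: mspan_0)
    qed
    finally show ?thesis .
  qed
  have "f = hcomp d f"
    unfolding f_def by (simp add: hcomp_homogeneous [OF homogeneous_hcomp])
  also have "\<dots> = (\<Sum>k=1..m. if k \<le> d then esym U k * hcomp (d - k) (r k) else 0)"
    unfolding r(2) hcomp_sum by (intro sum.cong refl hcomp_homogeneous_mult homogeneous_esym)
  also have "\<dots> \<in> ?M"
  proof (intro mspan_sum [OF subalg_symalg])
    fix k assume k: "k \<in> {1..m}"
    show "(if k \<le> d then esym U k * hcomp (d - k) (r k) else 0) \<in> ?M"
    proof (cases "k \<le> d")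
      case True
      then have "hcomp (d - k) (r k) * esym U k \<in> ?M"
        using k r(1) by (intro mspan_mult subalg_symalg low esym_symalg) auto
      then show ?thesis using True by (simp add: mult.commute)
    qed (auto intro: mspan_0)
  qed
  finally have fM: "f \<in> ?M" .
  have inc: "p * const c \<in> ?M" if "p \<in> ?M" for p c
    using that by (intro mspan_mult subalg_symalg subalg_const)
  define X where "X = (\<Sum>b\<in>?B. const (u b) * (if dg b = d then b else 0))"
  have eq: "f = const (u b0) * b0 + X"
    unfolding f_eq X_def using fin b0 by (subst sum.remove [of _ b0]) (auto simp: d_def)
  have "X = (\<Sum>b\<in>?B. (if dg b = d then b else 0) * const (u b))"
    unfolding X_def by (intro sum.cong refl mult.commute)
  also have "\<dots> \<in> ?M"
  proof (intro inc mspan_sum [OF subalg_symalg])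
    fix b assume "b \<in> ?B"
    then have "b \<in> ?M"
      using mspan_base [OF subalg_symalg, where J = ?B and j = b and \<phi> = "\<lambda>b. b"] fin by simp
    then show "(if dg b = d then b else 0) \<in> ?M"
      by (auto intro: mspan_0 [OF subalg_symalg])
  qed
  finally have "f + X * const (- 1) \<in> ?M"
    by (intro mspan_add [OF subalg_symalg] inc fM)
  then have diff: "f - X \<in> ?M"
    by (simp add: const_uminus)
  have "b0 = const (u b0 * inverse (u b0)) * b0"
    using b0(2) by simp
  also have "\<dots> = (f - X) * const (inverse (u b0))"
    unfolding eq const_mult by (simp add: mult_ac)
  also have "\<dots> \<in> ?M"
    by (rule inc [OF diff])
  finally have b0M: "b0 \<in> ?M" .
  have "Inv \<subseteq> ?M"
  proof
    fix p :: "'k mpoly" assume "p \<in> Inv"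
    then have "p \<in> mspan (symalg U) B (\<lambda>b. b)" using B by (auto simp: hom_gens_def)
    then show "p \<in> ?M"
    proof (rule mspan_trans [OF subalg_symalg])
      fix b assume b: "b \<in> B"
      show "b \<in> ?M"
        using b0M mspan_base [OF subalg_symalg, where J = ?B and j = b and \<phi> = "\<lambda>b. b"] fin b by (cases "b = b0") auto
    qed
  qed
  then have "hom_gens ?B"
    using B by (auto simp: hom_gens_def)
  then have "card B \<le> card ?B" by (rule min)
  then show False
    using card_Diff1_less [OF fin b0(1)] by simp
qed

theorem secondary_exists:
  "\<exists>t (\<eta> :: nat \<Rightarrow> 'k::field_char_0 mpoly) e. secondary t \<eta> e \<and> mono_on {1..t} e"
proof -
  obtain B :: "'k mpoly set" where B: "hom_gens B"
    and min: "\<And>B' :: 'k mpoly set. hom_gens B' \<Longrightarrow> card B \<le> card B'"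
    using ex_has_least_nat [of hom_gens _ card] hom_gens_exist by metis
  have fin: "finite B" and BI: "B \<subseteq> Inv" using B by (auto simp: hom_gens_def)
  have "\<forall>b\<in>B. \<exists>d. homogeneous d b" using B by (simp add: hom_gens_def)
  then obtain dg where dg: "\<And>b. b \<in> B \<Longrightarrow> homogeneous (dg b) b" by metis
  obtain xs0 where xs0: "set xs0 = B" "distinct xs0"
    using finite_distinct_list [OF fin] by blast
  define xs where "xs = sort_key dg xs0"
  have xs: "set xs = B" "distinct xs" "sorted (map dg xs)"
    using xs0 by (auto simp: xs_def)
  define t where "t = length xs"
  define \<eta> where "\<eta> i = xs ! (i - 1)" for i
  define e where "e i = dg (\<eta> i)" for i
  have bij: "bij_betw \<eta> {1..t} B"
  proof -
    have "bij_betw (\<lambda>i. i - 1) {1..t} {..<length xs}"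
      by (rule bij_betwI [of _ _ _ Suc]) (auto simp: t_def)
    moreover have "bij_betw ((!) xs) {..<length xs} B"
      using xs by (intro bij_betw_nth) auto
    ultimately have "bij_betw ((!) xs \<circ> (\<lambda>i. i - 1)) {1..t} B"
      by (rule bij_betw_trans)
    then show ?thesis
      by (simp add: \<eta>_def [abs_def] o_def)
  qed
  have reindex: "(\<Sum>i=1..t. \<eta> i * F (\<eta> i)) = (\<Sum>b\<in>B. b * F b)" for F
    using sum.reindex_bij_betw [OF bij, of "\<lambda>b. b * F b"] by simp
  have \<eta>B: "\<eta> i \<in> B" if "i \<in> {1..t}" for i
    using bij that by (auto simp: bij_betw_def)
  have indep: "\<forall>i\<in>{1..t}. q i = 0" if q: "\<And>i. i \<in> {1..t} \<Longrightarrow> q i \<in> symalg U"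
    and 0: "(\<Sum>i=1..t. \<eta> i * q i) = 0" for q
  proof (rule symalg_independent [OF _ _ _ q 0])
    fix u assume u: "(\<Sum>j=1..t. const (u j) * \<eta> j) \<in> symideal U"
    define u' where "u' b = u (the_inv_into {1..t} \<eta> b)" for b
    have u': "u' (\<eta> i) = u i" if "i \<in> {1..t}" for i
      unfolding u'_def using bij that by (simp add: the_inv_into_f_f bij_betw_def)
    have "(\<Sum>j=1..t. const (u j) * \<eta> j) = (\<Sum>j=1..t. const (u' (\<eta> j)) * \<eta> j)"
      by (intro sum.cong refl) (simp add: u')
    also have "\<dots> = (\<Sum>b\<in>B. const (u' b) * b)"
      by (rule sum.reindex_bij_betw [OF bij])
    finally have "\<forall>b\<in>B. u' b = 0"
      using minimal_hom_gens_independent [OF B min, of u'] u by simp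
    then show "\<forall>j\<in>{1..t}. u j = 0"
      using \<eta>B u' by force
  qed (use \<eta>B BI Inv_polys in auto)
  have "\<exists>!q. q \<in> {1..t} \<rightarrow>\<^sub>E symalg U \<and> f = (\<Sum>i=1..t. \<eta> i * q i)" if f: "f \<in> Inv" for f
  proof -
    have "f \<in> mspan (symalg U) B (\<lambda>b. b)" using B f by (auto simp: hom_gens_def)
    then obtain q0 where q0: "\<forall>b\<in>B. q0 b \<in> symalg U" "f = (\<Sum>b\<in>B. b * q0 b)"
      by (elim mspanE) (rule that)
    define q where "q = restrict (\<lambda>i. q0 (\<eta> i)) {1..t}"
    have "f = (\<Sum>i=1..t. \<eta> i * q i)"
      unfolding q0(2) reindex [symmetric] by (intro sum.cong refl) (simp add: q_def)
    moreover have "q \<in> {1..t} \<rightarrow>\<^sub>E symalg U"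
      using q0(1) \<eta>B by (auto simp: q_def)
    moreover have "q' = q" if q': "q' \<in> {1..t} \<rightarrow>\<^sub>E symalg U" "f = (\<Sum>i=1..t. \<eta> i * q' i)" for q'
    proof (rule PiE_ext [OF q'(1) \<open>q \<in> _\<close>])
      have "\<forall>i\<in>{1..t}. q' i - q i = 0"
      proof (rule indep)
        fix i assume "i \<in> {1..t}"
        then show "q' i - q i \<in> symalg U"
          using q' \<open>q \<in> _\<close> by (intro subalg_minus subalg_symalg) auto
      qed (use q'(2) \<open>f = (\<Sum>i=1..t. \<eta> i * q i)\<close> in \<open>simp add: right_diff_distrib sum_subtractf\<close>)
      then show "q' i = q i" if "i \<in> {1..t}" for i
        using that by simp
    qed
    ultimately show ?thesis by blast
  qed
  moreover have "\<forall>i\<in>{1..t}. \<eta> i \<in> Inv \<and> homogeneous (e i) (\<eta> i)"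
    using \<eta>B BI dg by (auto simp: e_def)
  ultimately have "secondary t \<eta> e"
    by (simp add: secondary_def)
  moreover have "mono_on {1..t} e"
  proof (rule mono_onI)
    fix i j assume "i \<in> {1..t}" "j \<in> {1..t}" "i \<le> j"
    then have "i - 1 \<le> j - 1" "j - 1 < length (map dg xs)" "i - 1 < length xs" by (auto simp: t_def)
    from sorted_nth_mono [OF xs(3) this(1,2)] this show "e i \<le> e j"
      by (simp add: e_def \<eta>_def)
  qed
  ultimately show ?thesis by blast
qed

end

section \<open>The number of secondary invariants\<close>

text \<open>Gaussian elimination: \<open>i0\<close> is a pivot for column \<open>j\<close>, and
  \<open>M'\<close> is the matrix cleared in that column. The value \<open>- s\<close> at
  \<open>i0\<close> restores the relation in column \<open>j\<close>. It serves for both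
  inequalities between \<open>t\<close> and the number of cosets.\<close>

lemma linear_dependency:
  fixes M :: "'i \<Rightarrow> 'j \<Rightarrow> 'k::field"
  assumes "finite J" "finite I" "card J < card I"
  shows "\<exists>u. (\<exists>i\<in>I. u i \<noteq> 0) \<and> (\<forall>j\<in>J. (\<Sum>i\<in>I. u i * M i j) = 0)"
  using assms
proof (induction J arbitrary: I M rule: finite_induct)
  case empty
  then have "I \<noteq> {}" by auto
  then show ?case by (intro exI [of _ "\<lambda>_. 1"]) auto
next
  case (insert j J)
  show ?case
  proof (cases "\<forall>i\<in>I. M i j = 0")
    case True
    obtain u where "\<exists>i\<in>I. u i \<noteq> 0" "\<forall>j\<in>J. (\<Sum>i\<in>I. u i * M i j) = 0"
      using insert.IH [of I M] insert.prems insert.hyps by auto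
    with True show ?thesis by (intro exI [of _ u]) simp
  next
    case False
    then obtain i0 where i0: "i0 \<in> I" "M i0 j \<noteq> 0" by blast
    define I' where "I' = I - {i0}"
    define M' where "M' i k = M i k - M i j / M i0 j * M i0 k" for i k
    have "card J < card I'"
      using insert.prems insert.hyps i0 by (simp add: I'_def)
    then obtain u' where u': "\<exists>i\<in>I'. u' i \<noteq> 0" "\<forall>k\<in>J. (\<Sum>i\<in>I'. u' i * M' i k) = 0"
      using insert.IH [of I' M'] insert.prems by (auto simp: I'_def)
    define s where "s = (\<Sum>i\<in>I'. u' i * (M i j / M i0 j))"
    define u where "u i = (if i = i0 then - s else u' i)" for i
    have split: "(\<Sum>i\<in>I. u i * M i k) = - s * M i0 k + (\<Sum>i\<in>I'. u' i * M i k)" for k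
    proof -
      have "(\<Sum>i\<in>I. u i * M i k) = u i0 * M i0 k + (\<Sum>i\<in>I'. u i * M i k)"
        unfolding I'_def using insert.prems i0 by (intro sum.remove) auto
      also have "(\<Sum>i\<in>I'. u i * M i k) = (\<Sum>i\<in>I'. u' i * M i k)"
        by (intro sum.cong) (auto simp: u_def I'_def)
      finally show ?thesis by (simp add: u_def)
    qed
    have "(\<Sum>i\<in>I. u i * M i k) = 0" if "k \<in> insert j J" for k
    proof (cases "k = j")
      case True
      have "s * M i0 j = (\<Sum>i\<in>I'. u' i * M i j)"
        using i0 by (simp add: s_def sum_distrib_right)
      then show ?thesis using True by (simp add: split)
    next
      case False
      then have "0 = (\<Sum>i\<in>I'. u' i * M' i k)" using that u' by simp
      also have "\<dots> = (\<Sum>i\<in>I'. u' i * M i k) - s * M i0 k"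
        by (simp add: M'_def s_def right_diff_distrib sum_subtractf sum_distrib_right mult.assoc)
      finally show ?thesis by (simp add: split)
    qed
    moreover have "\<exists>i\<in>I. u i \<noteq> 0"
      using u'(1) by (auto simp: u_def I'_def)
    ultimately show ?thesis by blast
  qed
qed

lemma ev_actv_interp:
  assumes U: "finite U" and x: "inj_on x U" and w: "w permutes U" and r: "r permutes U"
  shows "ev (x \<circ> w) (actv (inv r) (interp U x)) = (if w = r then 1 else 0)"
proof -
  have "ev (x \<circ> w) (actv (inv r) (interp U x)) = ev (x \<circ> (w \<circ> inv r)) (interp U x)"
    by (simp add: ev_actv comp_assoc)
  also have "\<dots> = (if w \<circ> inv r = id then 1 else 0)"
    by (intro ev_interp U x permutes_compose permutes_inv w r)
  also have "w \<circ> inv r = id \<longleftrightarrow> w = r"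
  proof
    assume "w \<circ> inv r = id"
    then have "w \<circ> inv r \<circ> r = r" by simp
    then show "w = r" using permutes_inv_o(2) [OF r] by (simp add: comp_assoc)
  qed (use permutes_inv_o(1) [OF r] in simp)
  finally show ?thesis .
qed

context perm_invariants
begin

lemma ev_symalg:
  assumes "w permutes U" "q \<in> symalg U"
  shows "ev (x \<circ> w) q = ev x q"
  using actv_symalg [OF assms] ev_actv [of x w q] by simp

text \<open>The values of the Artin monomials on the orbit of \<open>x\<close> form a square matrix
  of size \<open>fact m\<close>. A relation between its columns yields one between its rows, that
  is, a functional killing every polynomial on the orbit; interpolation excludes that.\<close>

lemma Artin_ev_independent:
  fixes x :: "nat set \<Rightarrow> 'k::field_char_0"
  assumes x: "inj_on x U"
    and c: "\<And>w. w permutes U \<Longrightarrow> (\<Sum>ks\<in>exps m. c ks * ev (x \<circ> w) (artin vs ks)) = 0"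
  shows "\<forall>ks\<in>exps m. c ks = 0"
proof (rule ccontr)
  assume "\<not> ?thesis"
  then obtain k0 where k0: "k0 \<in> exps m" "c k0 \<noteq> 0" by blast
  let ?S = "{w. w permutes U}" and ?J = "exps m - {k0}"
  have "card ?J < card (exps m)"
    using k0 by (intro psubset_card_mono) auto
  then have "card ?J < card ?S"
    by (simp add: card_exps card_permutations [OF card_U])
  then obtain u where u: "\<exists>w\<in>?S. u w \<noteq> 0" "\<forall>ks\<in>?J. (\<Sum>w\<in>?S. u w * ev (x \<circ> w) (artin vs ks)) = 0"
    using linear_dependency [of ?J ?S "\<lambda>w ks. ev (x \<circ> w) (artin vs ks)"] finite_permutations [of U]
    by auto
  \<comment> \<open>The row relation \<open>u\<close> was chosen on the columns other than
    \<open>k0\<close>. As \<open>c k0\<close> is nonzero, the column relation makes it hold on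
    column \<open>k0\<close> too.\<close>
  have "(\<Sum>w\<in>?S. u w * ev (x \<circ> w) (artin vs k0)) = 0"
  proof -
    have "0 = (\<Sum>w\<in>?S. u w * (\<Sum>ks\<in>exps m. c ks * ev (x \<circ> w) (artin vs ks)))"
      using c by simp
    also have "\<dots> = (\<Sum>ks\<in>exps m. c ks * (\<Sum>w\<in>?S. u w * ev (x \<circ> w) (artin vs ks)))"
      by (simp add: sum_distrib_left mult_ac sum.swap [of _ ?S])
    also have "\<dots> = c k0 * (\<Sum>w\<in>?S. u w * ev (x \<circ> w) (artin vs k0)) +
        (\<Sum>ks\<in>?J. c ks * (\<Sum>w\<in>?S. u w * ev (x \<circ> w) (artin vs ks)))"
      using k0 by (intro sum.remove) auto
    also have "(\<Sum>ks\<in>?J. c ks * (\<Sum>w\<in>?S. u w * ev (x \<circ> w) (artin vs ks))) = 0"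
      using u(2) by (intro sum.neutral) auto
    finally have "c k0 * (\<Sum>w\<in>?S. u w * ev (x \<circ> w) (artin vs k0)) = 0"
      by (simp only: add_0_right)
    then show ?thesis
      unfolding mult_eq_0_iff using k0(2) by blast
  qed
  with u(2) have vm0: "(\<Sum>w\<in>?S. u w * ev (x \<circ> w) (artin vs ks)) = 0" if "ks \<in> exps m" for ks
    using that by (cases "ks = k0") auto
  have all0: "(\<Sum>w\<in>?S. u w * ev (x \<circ> w) f) = 0" if f: "f \<in> polys U" for f
  proof -
    have "f \<in> mspan (symalg U) (exps m) (artin vs)"
      using Artin_span [OF vs] f by blast
    then obtain q where q: "\<forall>ks\<in>exps m. q ks \<in> symalg U" "f = (\<Sum>ks\<in>exps m. artin vs ks * q ks)"
      by (elim mspanE) (rule that)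
    have "(\<Sum>w\<in>?S. u w * ev (x \<circ> w) f) =
        (\<Sum>w\<in>?S. \<Sum>ks\<in>exps m. u w * ev (x \<circ> w) (artin vs ks) * ev x (q ks))"
      unfolding q(2) using q(1)
      by (intro sum.cong refl) (auto simp: ev_simps ev_symalg sum_distrib_left mult_ac intro!: sum.cong)
    also have "\<dots> = (\<Sum>ks\<in>exps m. (\<Sum>w\<in>?S. u w * ev (x \<circ> w) (artin vs ks)) * ev x (q ks))"
      by (simp add: sum.swap [of _ ?S] sum_distrib_right)
    also have "\<dots> = 0"
      using vm0 by (intro sum.neutral) auto
    finally show ?thesis .
  qed
  obtain w0 where w0: "w0 permutes U" "u w0 \<noteq> 0" using u(1) by auto
  have "ev (x \<circ> w) (actv (inv w0) (interp U x)) = (if w = w0 then 1 else 0)" if "w permutes U" for w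
    by (intro ev_actv_interp x that w0(1)) simp
  then have "(\<Sum>w\<in>?S. u w * ev (x \<circ> w) (actv (inv w0) (interp U x))) =
      (\<Sum>w\<in>?S. if w = w0 then u w0 else 0)"
    by (intro sum.cong) auto
  also have "\<dots> = u w0"
    using w0 by (simp add: finite_permutations)
  moreover have "actv (inv w0) (interp U x) \<in> polys U"
    using permutes_image [OF permutes_inv [OF w0(1)]] by (intro actv_polys [OF interp_polys]) auto
  ultimately show False
    using all0 w0 by simp
qed

context
  fixes t and \<eta> :: "nat \<Rightarrow> 'k::field_char_0 mpoly" and e
  assumes sec: "secondary t \<eta> e"
begin

lemma secondary_Inv: "i \<in> {1..t} \<Longrightarrow> \<eta> i \<in> Inv"
  and secondary_homogeneous: "i \<in> {1..t} \<Longrightarrow> homogeneous (e i) (\<eta> i)"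
  using sec by (auto simp: secondary_def)

lemma secondary_span:
  assumes "f \<in> Inv"
  obtains q where "\<forall>i\<in>{1..t}. q i \<in> symalg U" "f = (\<Sum>i=1..t. \<eta> i * q i)"
proof -
  have "\<exists>!q. q \<in> {1..t} \<rightarrow>\<^sub>E symalg U \<and> f = (\<Sum>i=1..t. \<eta> i * q i)"
    using sec assms unfolding secondary_def by blast
  then obtain q where "q \<in> {1..t} \<rightarrow>\<^sub>E symalg U" "f = (\<Sum>i=1..t. \<eta> i * q i)"
    by blast
  then show ?thesis by (intro that [of q]) auto
qed

lemma secondary_unique:
  assumes q: "\<And>i. i \<in> {1..t} \<Longrightarrow> q i \<in> symalg U" and q': "\<And>i. i \<in> {1..t} \<Longrightarrow> q' i \<in> symalg U"
    and eq: "(\<Sum>i=1..t. \<eta> i * q i) = (\<Sum>i=1..t. \<eta> i * q' i)" and i: "i \<in> {1..t}"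
  shows "q i = q' i"
proof -
  let ?f = "\<Sum>i=1..t. \<eta> i * q i"
  have "?f \<in> Inv"
    using q symalg_Inv secondary_Inv
    by (intro subalg_sum [OF subalg_Inv] subalg_mult [OF subalg_Inv]) auto
  moreover define P where "P r \<longleftrightarrow> r \<in> {1..t} \<rightarrow>\<^sub>E symalg U \<and> ?f = (\<Sum>i=1..t. \<eta> i * r i)" for r
  ultimately have "\<exists>!r. P r"
    using sec unfolding secondary_def by blast
  moreover have "P (restrict q {1..t})" "P (restrict q' {1..t})"
    using q q' eq by (auto simp: P_def)
  ultimately have "restrict q {1..t} = restrict q' {1..t}"
    by blast
  then show ?thesis using i by (metis restrict_apply')
qed

text \<open>Otherwise expand the invariant coefficients of \<open_placeholder> in the basis: the
  coefficient 1 of the given element would equal a symmetric polynomial vanishing at 0.\<close>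

lemma secondary_not_symideal:
  assumes i: "i \<in> {1..t}"
  shows "\<eta> i \<notin> symideal U"
proof
  assume "\<eta> i \<in> symideal U"
  then obtain r where r: "\<And>k. k \<in> {1..m} \<Longrightarrow> r k \<in> Inv" "\<eta> i = (\<Sum>k=1..m. esym U k * r k)"
    using Inv_symidealE [OF secondary_Inv [OF i]] by blast
  have "\<exists>q. (\<forall>j\<in>{1..t}. q j \<in> symalg U) \<and> r k = (\<Sum>j=1..t. \<eta> j * q j)" if "k \<in> {1..m}" for k
    by (rule secondary_span [OF r(1) [OF that]]) blast
  then obtain Q where Q: "\<And>k j. k \<in> {1..m} \<Longrightarrow> j \<in> {1..t} \<Longrightarrow> Q k j \<in> symalg U"
    "\<And>k. k \<in> {1..m} \<Longrightarrow> r k = (\<Sum>j=1..t. \<eta> j * Q k j)"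
    by metis
  have "(\<Sum>j=1..t. \<eta> j * (if j = i then 1 else 0)) = \<eta> i"
    using i by (simp add: if_distrib cong: if_cong)
  also have "\<dots> = (\<Sum>k=1..m. \<Sum>j=1..t. esym U k * (\<eta> j * Q k j))"
    unfolding r(2) by (intro sum.cong refl) (simp add: Q(2) sum_distrib_left)
  also have "\<dots> = (\<Sum>j=1..t. \<eta> j * (\<Sum>k=1..m. esym U k * Q k j))"
    by (subst sum.swap) (simp add: sum_distrib_left mult_ac)
  finally have eq: "(\<Sum>j=1..t. \<eta> j * (if j = i then 1 else 0)) =
      (\<Sum>j=1..t. \<eta> j * (\<Sum>k=1..m. esym U k * Q k j))" .
  have "(if i = i then 1 else 0) = (\<Sum>k=1..m. esym U k * Q k i)"
  proof (rule secondary_unique [OF _ _ eq i])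
    show "(if j = i then 1 else 0) \<in> symalg U" for j
      by (auto intro: subalg_0 subalg_1)
    show "(\<Sum>k=1..m. esym U k * Q k j) \<in> symalg U" if "j \<in> {1..t}" for j
      using that by (intro subalg_sum [OF subalg_symalg] subalg_mult [OF subalg_symalg] esym_symalg Q) auto
  qed
  then have "ev0 1 = ev0 (\<Sum>k=1..m. esym U k * Q k i)" by simp
  then show False by (simp add: ev_simps ev_0_esym)
qed

text \<open>The combination \<open>f\<close> vanishes on the orbit, so its Artin coefficients vanish
  at \<open>x\<close>. Averaging and re-expanding in the secondary invariants writes each constant
  \<open>u i\<close> as a combination of these coefficients, hence it is 0 at
  \<open>x\<close>.\<close>

lemma secondary_ev_independent:
  assumes x: "inj_on x U" and u: "\<And>w. w permutes U \<Longrightarrow> (\<Sum>i=1..t. u i * ev (x \<circ> w) (\<eta> i)) = 0"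
    and i: "i \<in> {1..t}"
  shows "u i = 0"
proof -
  define f where "f = (\<Sum>i=1..t. \<eta> i * const (u i))"
  have fI: "f \<in> Inv"
    unfolding f_def
    by (intro subalg_sum [OF subalg_Inv] subalg_mult [OF subalg_Inv] subalg_const [OF subalg_Inv] secondary_Inv)
  then have "f \<in> mspan (symalg U) (exps m) (artin vs)"
    using Artin_span [OF vs] Inv_polys by blast
  then obtain q where q: "\<forall>ks\<in>exps m. q ks \<in> symalg U" "f = (\<Sum>ks\<in>exps m. artin vs ks * q ks)"
    by (elim mspanE) (rule that)
  have "\<forall>ks\<in>exps m. ev x (q ks) = 0"
  proof (rule Artin_ev_independent [OF x])
    fix w assume w: "w permutes U"
    have "(\<Sum>ks\<in>exps m. ev x (q ks) * ev (x \<circ> w) (artin vs ks)) = ev (x \<circ> w) f"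
      using q(1) w by (auto simp: q(2) ev_simps ev_symalg intro!: sum.cong)
    also have "\<dots> = 0"
      using u [OF w] by (simp add: f_def ev_simps mult.commute)
    finally show "(\<Sum>ks\<in>exps m. ev x (q ks) * ev (x \<circ> w) (artin vs ks)) = 0" .
  qed
  then have q0: "ev x (q ks) = 0" if "ks \<in> exps m" for ks using that by blast
  have "\<exists>r. (\<forall>j\<in>{1..t}. r j \<in> symalg U) \<and> avg (artin vs ks) = (\<Sum>j=1..t. \<eta> j * r j)" for ks
    by (rule secondary_span [OF avg_Inv [OF artin_polys]]) blast
  then have "\<forall>ks. \<exists>r. (\<forall>j\<in>{1..t}. r j \<in> symalg U) \<and> avg (artin vs ks) = (\<Sum>j=1..t. \<eta> j * r j)"
    by (rule allI)
  from choice [OF this] obtain r where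
    "\<forall>ks. (\<forall>j\<in>{1..t}. r ks j \<in> symalg U) \<and> avg (artin vs ks) = (\<Sum>j=1..t. \<eta> j * r ks j)" ..
  then have r: "\<And>ks j. j \<in> {1..t} \<Longrightarrow> r ks j \<in> symalg U"
    "\<And>ks. avg (artin vs ks) = (\<Sum>j=1..t. \<eta> j * r ks j)"
    by blast+
  have "(\<Sum>j=1..t. \<eta> j * const (u j)) = avg f"
    by (simp add: avg_id [OF fI]) (simp add: f_def)
  also have "\<dots> = (\<Sum>ks\<in>exps m. avg (artin vs ks) * q ks)"
    using q(1) symalg_Inv unfolding q(2) avg_sum by (intro sum.cong avg_mult) auto
  also have "\<dots> = (\<Sum>j=1..t. \<eta> j * (\<Sum>ks\<in>exps m. r ks j * q ks))"
    unfolding r(2) by (simp add: sum_distrib_left sum_distrib_right mult.assoc) (rule sum.swap)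
  finally have eq: "(\<Sum>j=1..t. \<eta> j * const (u j)) = (\<Sum>j=1..t. \<eta> j * (\<Sum>ks\<in>exps m. r ks j * q ks))" .
  have "const (u i) = (\<Sum>ks\<in>exps m. r ks i * q ks)"
  proof (rule secondary_unique [OF _ _ eq i])
    show "const (u j) \<in> symalg U" for j by (intro subalg_const subalg_symalg)
    show "(\<Sum>ks\<in>exps m. r ks j * q ks) \<in> symalg U" if "j \<in> {1..t}" for j
      using that q(1) r(1) by (intro subalg_sum [OF subalg_symalg] subalg_mult [OF subalg_symalg]) auto
  qed
  then have "ev x (const (u i)) = ev x (\<Sum>ks\<in>exps m. r ks i * q ks)" by simp
  then show ?thesis by (simp add: ev_simps q0)
qed

text \<open>On the orbit of a point with distinct coordinates an invariant is constant on left
  cosets of \<open>G\<close>. The secondary invariants restrict to a basis of the functions on the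
  cosets, of which there are \<open>fact m\<close> divided by \<open>card G\<close>.\<close>

theorem secondary_count: "t * card G = fact m"
proof -
  let ?S = "{w. w permutes U}"
  define coset where "coset w = (\<lambda>g. w \<circ> g) ` G" for w :: "nat set \<Rightarrow> nat set"
  define C where "C = coset ` ?S"
  define rep where "rep c = (SOME w. w \<in> c)" for c :: "(nat set \<Rightarrow> nat set) set"
  have OS: "coset w \<subseteq> ?S" if "w permutes U" for w
    using that by (auto simp: coset_def intro: permutes_compose G_perm)
  have self: "w \<in> coset w" for w
    unfolding coset_def using G_id by (intro image_eqI [of _ _ id]) auto
  have Osub: "coset w' \<subseteq> coset w" if "w' \<in> coset w" for w w'
    using that by (auto simp: coset_def comp_assoc intro!: imageI G_comp)
  have Osym: "w \<in> coset w'" if mem: "w' \<in> coset w" for w w'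
  proof -
    obtain g where g: "g \<in> G" "w' = w \<circ> g" using mem by (auto simp: coset_def)
    then have "w = w' \<circ> inv g"
      using permutes_inv_o(1) [OF G_perm [OF g(1)]] by (simp add: comp_assoc)
    then show ?thesis unfolding coset_def using G_inv [OF g(1)] by blast
  qed
  have Oeq: "coset w = coset w'" if "w' \<in> coset w" for w w'
    using Osub [OF that] Osub [OF Osym [OF that]] by blast
  have finS: "finite ?S" by (simp add: finite_permutations)
  have finC: "finite C" unfolding C_def using finS by simp
  have repC: "rep c permutes U" "coset (rep c) = c" if c: "c \<in> C" for c
  proof -
    obtain w where w: "w permutes U" "c = coset w" using c by (auto simp: C_def)
    have "w \<in> c" using self [of w] w by simp
    then have "rep c \<in> c" unfolding rep_def by (rule someI [of "\<lambda>w. w \<in> c"])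
    then show "rep c permutes U" "coset (rep c) = c"
      using w OS [OF w(1)] Oeq [of "rep c" w] by auto
  qed
  have inj: "inj_on (\<lambda>g. w \<circ> g) G" if "w permutes U" for w
    by (rule inj_onI) (use permutes_inj [OF that] in \<open>auto simp: fun_eq_iff inj_def\<close>)
  have "card G * card C = card (\<Union>C)"
  proof (rule card_partition [OF finC])
    show "finite (\<Union>C)" using finC finite_G by (auto simp: C_def coset_def)
    show "card c = card G" if "c \<in> C" for c
      using that by (auto simp: C_def coset_def card_image inj)
    show "c \<inter> d = {}" if "c \<in> C" "d \<in> C" "c \<noteq> d" for c d
      using that Oeq unfolding C_def by blast
  qed
  also have "\<Union>C = ?S"
    using OS self by (auto simp: C_def)
  finally have card: "card C * card G = fact m"
    using card_permutations [OF card_U] by (simp add: mult.commute)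
  obtain f :: "nat set \<Rightarrow> nat" where "inj_on f U"
    using obtain_prime_labels [of U] by auto
  define x :: "nat set \<Rightarrow> 'k" where "x v = of_nat (f v)" for v
  have x: "inj_on x U"
    using \<open>inj_on f U\<close> by (auto simp: x_def [abs_def] inj_on_def)
  \<comment> \<open>With more secondary invariants than cosets some nontrivial combination would
    vanish on the whole orbit.\<close>
  have "t \<le> card C"
  proof (rule ccontr)
    assume "\<not> ?thesis"
    then obtain u where u: "\<exists>i\<in>{1..t}. u i \<noteq> 0"
      "\<forall>c\<in>C. (\<Sum>i=1..t. u i * ev (x \<circ> rep c) (\<eta> i)) = 0"
      using linear_dependency [OF finC, of "{1..t}" "\<lambda>i c. ev (x \<circ> rep c) (\<eta> i)"] by auto
    have "(\<Sum>i=1..t. u i * ev (x \<circ> w) (\<eta> i)) = 0" if w: "w permutes U" for w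
    proof -
      have "coset w \<in> C" using w by (auto simp: C_def)
      then have "w \<in> coset (rep (coset w))" using repC self by blast
      then obtain g where g: "g \<in> G" "w = rep (coset w) \<circ> g" by (auto simp: coset_def)
      have "ev (x \<circ> w) (\<eta> i) = ev (x \<circ> rep (coset w)) (\<eta> i)" if "i \<in> {1..t}" for i
        using ev_actv [of "x \<circ> rep (coset w)" g "\<eta> i"] actv_Inv [OF secondary_Inv [OF that] g(1)]
          g(2) by (simp add: comp_assoc)
      then show ?thesis
        using u(2) \<open>coset w \<in> C\<close> by simp
    qed
    then show False
      using secondary_ev_independent [OF x] u(1) by blast
  qed
  moreover have "card C \<le> t"
  proof (rule ccontr)
    assume "\<not> ?thesis"
    then obtain u where u: "\<exists>c\<in>C. u c \<noteq> 0"
      "\<forall>i\<in>{1..t}. (\<Sum>c\<in>C. u c * ev (x \<circ> rep c) (\<eta> i)) = 0"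
      using linear_dependency [of "{1..t}" C "\<lambda>c i. ev (x \<circ> rep c) (\<eta> i)"] finC by auto
    then obtain c0 where c0: "c0 \<in> C" "u c0 \<noteq> 0" by blast
    \<comment> \<open>\<open>L\<close> is 1 at the orbit point belonging to \<open>rep c0\<close>
      and 0 at the others; its sum \<open>f\<close> over \<open>G\<close> is an invariant that is
      the indicator of the coset \<open>c0\<close>. A functional killing all secondary invariants
      must kill it as well.\<close>
    define L where "L = actv (inv (rep c0)) (interp U x)"
    define f where "f = (\<Sum>g\<in>G. actv g L)"
    have LU: "L \<in> polys U"
      unfolding L_def using permutes_image [OF permutes_inv [OF repC(1) [OF c0(1)]]]
      by (intro actv_polys [OF interp_polys]) auto
    have "f \<in> Inv"
    proof (rule InvI)
      show "f \<in> polys U" unfolding f_def by (intro polys_sum actv_polys_G LU)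
      show "actv h f = f" if "h \<in> G" for h
        using sum_G_reindex [OF that, of "\<lambda>g. actv g L"] by (simp add: f_def actv_simps actv_comp)
    qed
    then obtain q where q: "\<forall>i\<in>{1..t}. q i \<in> symalg U" "f = (\<Sum>i=1..t. \<eta> i * q i)"
      by (rule secondary_span)
    have evL: "ev (x \<circ> w) L = (if w = rep c0 then 1 else 0)" if w: "w permutes U" for w
      unfolding L_def by (intro ev_actv_interp x w repC(1) c0(1)) simp
    have evf: "ev (x \<circ> rep c) f = (if c = c0 then 1 else 0)" if c: "c \<in> C" for c
    proof -
      have "ev (x \<circ> rep c) f = (\<Sum>g\<in>G. ev (x \<circ> (rep c \<circ> g)) L)"
        by (simp add: f_def ev_simps ev_actv comp_assoc)
      also have "\<dots> = (\<Sum>g\<in>G. if rep c \<circ> g = rep c0 then 1 else 0)"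
        by (intro sum.cong refl evL permutes_compose [OF G_perm repC(1) [OF c]])
      also have "\<dots> = (\<Sum>g\<in>G. if g = id then (if c = c0 then 1 else 0) else 0)"
      proof (intro sum.cong refl)
        fix g assume g: "g \<in> G"
        have "rep c \<circ> g = rep c0 \<longleftrightarrow> g = id \<and> c = c0"
        proof
          assume *: "rep c \<circ> g = rep c0"
          then have "rep c0 \<in> coset (rep c)"
            unfolding coset_def using g by (intro image_eqI [of _ _ g]) simp_all
          then have "c = c0" using Oeq repC c c0 by metis
          with * have "rep c \<circ> g = rep c \<circ> id" by simp
          then show "g = id \<and> c = c0"
            using inj_onD [OF inj [OF repC(1) [OF c]] _ g G_id] \<open>c = c0\<close> by blast
        qed auto
        then show "(if rep c \<circ> g = rep c0 then 1 else 0) =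
            (if g = id then (if c = c0 then 1 else 0) else (0 :: 'k))" by simp
      qed
      finally show ?thesis using finite_G G_id by simp
    qed
    have "u c0 = (\<Sum>c\<in>C. u c * ev (x \<circ> rep c) f)"
      using finC c0 by (simp add: evf if_distrib cong: if_cong)
    also have "\<dots> = (\<Sum>c\<in>C. \<Sum>i=1..t. u c * ev (x \<circ> rep c) (\<eta> i) * ev x (q i))"
      unfolding q(2) using q(1) repC(1)
      by (intro sum.cong refl) (auto simp: ev_simps ev_symalg sum_distrib_left mult_ac intro!: sum.cong)
    also have "\<dots> = (\<Sum>i=1..t. (\<Sum>c\<in>C. u c * ev (x \<circ> rep c) (\<eta> i)) * ev x (q i))"
      by (simp add: sum.swap [of _ C] sum_distrib_right)
    also have "\<dots> = 0"
      using u(2) by (intro sum.neutral) auto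
    finally show False using c0 by simp
  qed
  ultimately show ?thesis
    using card by simp
qed

end

section \<open>Semi-invariants and the top degree\<close>

text \<open>The sign is that of the permutation of the variables, not of the vertices.\<close>

definition semi :: "'k::field_char_0 mpoly \<Rightarrow> bool" where
  "semi g \<longleftrightarrow> g \<in> polys U \<and> (\<forall>h\<in>G. actv h g = sgn_const h * g)"

text \<open>The Reynolds operator of the sign character, left unnormalized: on semi-invariants it
  multiplies by \<open>card G\<close>.\<close>

definition savg :: "'k::field_char_0 mpoly \<Rightarrow> 'k mpoly" where
  "savg f = (\<Sum>h\<in>G. sgn_const h * actv h f)"

lemma sign_sq: "sgn_const h * (sgn_const h * f) = f"
proof -
  have "sgn_const h * (sgn_const h * f) =
      const (of_int (sign h * sign h)) * f"
    by (simp only: of_int_mult const_mult mult.assoc)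
  then show ?thesis by simp
qed

lemma savg_semi:
  assumes "f \<in> polys U"
  shows "semi (savg f)"
  unfolding semi_def
proof (intro conjI ballI)
  show "savg f \<in> polys U"
    unfolding savg_def using assms by (intro polys_sum polys_mult actv_polys_G) auto
  fix h assume h: "h \<in> G"
  have "savg f = (\<Sum>g\<in>G. const (of_int (sign (h \<circ> g))) * actv (h \<circ> g) f)"
    unfolding savg_def by (rule sum_G_reindex [OF h, symmetric])
  also have "\<dots> = (\<Sum>g\<in>G. sgn_const h * (sgn_const g * actv h (actv g f)))"
    using h by (intro sum.cong refl)
      (simp add: sign_compose G_permutation actv_comp const_mult mult_ac)
  also have "\<dots> = sgn_const h * actv h (savg f)"
    by (simp add: savg_def actv_simps sum_distrib_left)
  finally have "sgn_const h * savg f =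
      sgn_const h * (sgn_const h * actv h (savg f))"
    by (rule arg_cong)
  also have "\<dots> = actv h (savg f)"
    by (rule sign_sq)
  finally show "actv h (savg f) = sgn_const h * savg f" ..
qed

lemma of_nat_card_G: "of_nat (card G) \<noteq> (0 :: 'k::field_char_0)"
  unfolding of_nat_eq_0_iff using card_G_pos by linarith

lemma of_nat_eq_const: "of_nat n = const (of_nat n)"
  by (simp add: const_def)

lemma savg_eq:
  assumes "semi g"
  shows "savg g = const (of_nat (card G)) * g"
proof -
  have "savg g = (\<Sum>h\<in>G. g)"
    unfolding savg_def using assms by (intro sum.cong refl) (simp add: semi_def sign_sq)
  then show ?thesis by (simp add: of_nat_eq_const)
qed

lemma savg_mult_Inv: "s \<in> Inv \<Longrightarrow> savg (s * f) = s * savg f"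
  by (simp add: savg_def actv_simps actv_Inv sum_distrib_left mult_ac)

text \<open>Each summand contributes the sign of \<open>h\<close> twice.\<close>

lemma anti_savg: "anti U (savg f) = const (of_nat (card G)) * anti U f"
proof -
  have "anti U (savg f) = (\<Sum>h\<in>G. sgn_const h * (sgn_const h * anti U f))"
    unfolding savg_def anti_sum anti_const_mult
    by (intro sum.cong refl) (simp add: anti_actv G_perm)
  then show ?thesis by (simp add: sign_sq of_nat_eq_const)
qed

lemma hcomp_savg: "hcomp d (savg f) = savg (hcomp d f)"
  by (simp add: savg_def hcomp_sum hcomp_const_mult hcomp_actv)

lemma semi_hcomp: "semi g \<Longrightarrow> semi (hcomp d g)"
  by (auto simp: semi_def simp flip: hcomp_actv hcomp_const_mult)

lemma savg_sum: "savg (\<Sum>i\<in>S. f i) = (\<Sum>i\<in>S. savg (f i))"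
  unfolding savg_def actv_simps sum_distrib_left by (rule sum.swap)

text \<open>Applying \<open>savg\<close> to a representation of \<open>g\<close> by the generators
  of the ideal makes the coefficients semi-invariant. In degree \<mu> they have smaller degree, so
  they vanish by minimality.\<close>

lemma minimal_semi_not_symideal:
  fixes g :: "'k::field_char_0 mpoly"
  assumes g: "semi g" "homogeneous \<mu> g" "g \<noteq> 0"
    and min: "\<And>d (g :: 'k mpoly). semi g \<Longrightarrow> homogeneous d g \<Longrightarrow> g \<noteq> 0 \<Longrightarrow> \<mu> \<le> d"
  shows "g \<notin> symideal U"
proof
  assume "g \<in> symideal U"
  then obtain r where r: "\<And>k. k \<in> {1..card U} \<Longrightarrow> r k \<in> polys U" "g = (\<Sum>k=1..card U. esym U k * r k)"
    by (elim symidealE) (rule that)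
  have e: "esym U k \<in> Inv" for k
    using symalg_Inv esym_symalg by blast
  have "const (of_nat (card G)) * g = savg g"
    by (simp add: savg_eq [OF g(1)])
  also have "\<dots> = hcomp \<mu> (savg g)"
    using g(2) by (simp add: hcomp_savg hcomp_homogeneous)
  also have "\<dots> = (\<Sum>k=1..card U. if k \<le> \<mu> then esym U k * hcomp (\<mu> - k) (savg (r k)) else 0)"
    by (subst r(2)) (simp add: savg_sum savg_mult_Inv [OF e] hcomp_sum
        hcomp_homogeneous_mult [OF homogeneous_esym])
  also have "\<dots> = 0"
  proof (intro sum.neutral ballI)
    fix k assume k: "k \<in> {1..card U}"
    show "(if k \<le> \<mu> then esym U k * hcomp (\<mu> - k) (savg (r k)) else 0) = 0"
    proof (cases "k \<le> \<mu>")
      case True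
      have "hcomp (\<mu> - k) (savg (r k)) = 0"
      proof (rule ccontr)
        assume nz: "hcomp (\<mu> - k) (savg (r k)) \<noteq> 0"
        have "\<mu> \<le> \<mu> - k"
          by (rule min [OF semi_hcomp [OF savg_semi [OF r(1) [OF k]]] homogeneous_hcomp nz])
        then show False using k True by auto
      qed
      then show ?thesis by simp
    qed simp
  qed
  finally have "g = 0"
    using of_nat_card_G by (rule const_mult_eq_0)
  with g show False by simp
qed

context
  fixes t and \<eta> :: "nat \<Rightarrow> 'k::field_char_0 mpoly" and e and \<mu> and g0 :: "'k mpoly"
  assumes sec: "secondary t \<eta> e"
    and g0: "semi g0" "homogeneous \<mu> g0" "g0 \<noteq> 0"
    and min: "\<And>d (g :: 'k mpoly). semi g \<Longrightarrow> homogeneous d g \<Longrightarrow> g \<noteq> 0 \<Longrightarrow> \<mu> \<le> d"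
begin

text \<open>A secondary invariant lies outside the ideal, so it pairs nontrivially with some
  \<open>g\<close> of complementary degree, and still does with \<open>savg g\<close>. That degree
  is therefore the degree of a nonzero semi-invariant.\<close>

lemma secondary_degree_le:
  assumes i: "i \<in> {1..t}"
  shows "e i + \<mu> \<le> m choose 2"
proof -
  have \<eta>: "\<eta> i \<in> Inv" "homogeneous (e i) (\<eta> i)"
    using secondary_Inv [OF sec i] secondary_homogeneous [OF sec i] by auto
  obtain g where g: "e i \<le> m choose 2" "g \<in> polys U" "homogeneous ((m choose 2) - e i) g"
    "anti U (\<eta> i * g) \<noteq> 0"
    using homogeneous_pairing [OF Inv_polys [OF \<eta>(1)] \<eta>(2) secondary_not_symideal [OF sec i]] by blast
  have "anti U (\<eta> i * savg g) = const (of_nat (card G)) * anti U (\<eta> i * g)"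
    by (simp add: anti_savg flip: savg_mult_Inv [OF \<eta>(1)])
  also have "\<dots> \<noteq> 0"
    using g(4) of_nat_card_G const_mult_eq_0 by blast
  finally have "savg g \<noteq> 0" by auto
  moreover have "homogeneous ((m choose 2) - e i) (savg g)"
    using g(3) unfolding savg_def by (auto intro: homogeneous_actv)
  ultimately have "\<mu> \<le> (m choose 2) - e i"
    using min savg_semi [OF g(2)] by blast
  then show ?thesis using g(1) by simp
qed

text \<open>Conversely, a semi-invariant of least degree pairs nontrivially with some
  \<open>f\<close>, and with the average of \<open>f\<close>. This produces an invariant outside the
  ideal in degree \<open>(m choose 2) - \<mu>\<close>.\<close>

lemma secondary_degree_attained: "\<exists>i\<in>{1..t}. e i + \<mu> = m choose 2"
proof -
  let ?N = "m choose 2"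
  have g0U: "g0 \<in> polys U" using g0 by (simp add: semi_def)
  have "g0 \<notin> symideal U" by (rule minimal_semi_not_symideal [OF g0 min])
  then obtain f where f: "\<mu> \<le> ?N" "f \<in> polys U" "homogeneous (?N - \<mu>) f" "anti U (g0 * f) \<noteq> 0"
    using homogeneous_pairing [OF g0U g0(2)] by blast
  define f' where "f' = avg f"
  have f': "f' \<in> Inv" "homogeneous (?N - \<mu>) f'"
    unfolding f'_def using f by (auto intro: avg_Inv homogeneous_avg)
  \<comment> \<open>Both \<open>g0\<close> and the antisymmetrization pick up the sign of
    \<open>h\<close>, and the two signs cancel.\<close>
  have "anti U (g0 * actv h f) = anti U (g0 * f)" if h: "h \<in> G" for h
  proof -
    have "anti U (actv h (g0 * f)) = sgn_const h * anti U (g0 * actv h f)"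
      using g0(1) h by (simp add: actv_simps semi_def mult.assoc anti_const_mult)
    then have "sgn_const h * anti U (g0 * f) = sgn_const h * anti U (g0 * actv h f)"
      by (simp add: anti_actv G_perm h)
    then have "sgn_const h * (sgn_const h * anti U (g0 * f)) =
        sgn_const h * (sgn_const h * anti U (g0 * actv h f))"
      by simp
    then show ?thesis by (simp only: sign_sq)
  qed
  then have "(\<Sum>h\<in>G. anti U (g0 * actv h f)) = const (of_nat (card G)) * anti U (g0 * f)"
    by (simp add: of_nat_eq_const)
  moreover have "anti U (g0 * f') = const (inverse (of_nat (card G))) * (\<Sum>h\<in>G. anti U (g0 * actv h f))"
  proof -
    have "g0 * f' = const (inverse (of_nat (card G))) * (\<Sum>h\<in>G. g0 * actv h f)"
      by (simp add: f'_def avg_def sum_distrib_left mult_ac)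
    then show ?thesis by (simp add: anti_const_mult anti_sum)
  qed
  ultimately have alt0: "anti U (g0 * f') \<noteq> 0"
    using f(4) of_nat_card_G nonzero_imp_inverse_nonzero [OF of_nat_card_G] const_mult_eq_0 by metis
  have f'I: "f' \<notin> symideal U"
  proof
    assume "f' \<in> symideal U"
    then have "g0 * f' \<in> symideal U" using g0U by (rule symideal_mult')
    moreover from this have "g0 * f' \<in> polys U" using symideal_polys by blast
    ultimately have "hcomp ?N (anti U (g0 * f')) = 0"
      by (simp add: hcomp_anti_top form_symideal)
    moreover have "homogeneous ?N (anti U (g0 * f'))"
      using homogeneous_anti [OF homogeneous_mult [OF g0(2) f'(2)]] f(1) by simp
    ultimately show False
      using alt0 by (simp add: hcomp_homogeneous)
  qed
  obtain q where q: "\<forall>i\<in>{1..t}. q i \<in> symalg U" "f' = (\<Sum>i=1..t. \<eta> i * q i)"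
    by (rule secondary_span [OF sec f'(1)])
  \<comment> \<open>Modulo the ideal \<open>f'\<close> is a combination of secondary invariants with
    constant coefficients, so one of them must have the degree of \<open>f'\<close>.\<close>
  have "\<exists>i\<in>{1..t}. e i = ?N - \<mu>"
  proof (rule ccontr)
    assume no: "\<not> ?thesis"
    have "(\<Sum>i=1..t. \<eta> i * (q i - const (ev0 (q i)))) \<in> symideal U"
      using q(1) Inv_polys secondary_Inv [OF sec]
      by (intro symideal_sum symideal_mult' symalg_mod_symideal) auto
    also have "(\<Sum>i=1..t. \<eta> i * (q i - const (ev0 (q i)))) =
        f' - (\<Sum>i=1..t. const (ev0 (q i)) * \<eta> i)"
      by (simp add: q(2) algebra_simps sum_subtractf)
    finally have "hcomp (?N - \<mu>) (f' - (\<Sum>i=1..t. const (ev0 (q i)) * \<eta> i)) \<in> symideal U"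
      by (rule hcomp_symideal)
    moreover have "hcomp (?N - \<mu>) (\<Sum>i=1..t. const (ev0 (q i)) * \<eta> i) = 0"
      unfolding hcomp_sum hcomp_const_mult
      using no by (intro sum.neutral) (auto simp: hcomp_homogeneous [OF secondary_homogeneous [OF sec]])
    ultimately show False
      using f'I by (simp add: hcomp_minus hcomp_homogeneous [OF f'(2)])
  qed
  then obtain i where "i \<in> {1..t}" "e i = ?N - \<mu>" by blast
  then show ?thesis using f(1) by (intro bexI [of _ i]) simp_all
qed

lemma secondary_top_degree:
  assumes "mono_on {1..t} e"
  shows "e t + \<mu> = m choose 2"
proof -
  obtain i where i: "i \<in> {1..t}" "e i + \<mu> = m choose 2"
    using secondary_degree_attained by blast
  then have "t \<in> {1..t}" by auto
  then have "e i \<le> e t" using i by (intro mono_onD [OF assms]) simp_all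
  then show ?thesis
    using i secondary_degree_le [OF \<open>t \<in> {1..t}\<close>] by simp
qed

text \<open>Secondary invariants satisfy the degree bound by \<open>secondary_degree_le\<close>; the
  hypothesis places the elementary symmetric polynomials, of degree at most \<open>m\<close>, below
  it as well.\<close>

lemma Inv_generated:
  assumes "m + \<mu> \<le> m choose 2"
  shows "generated_algebra {f \<in> Inv. degree_at_most ((m choose 2) - \<mu>) f} = (Inv :: 'k mpoly set)"
    (is "generated_algebra ?S = _")
proof
  show "generated_algebra ?S \<subseteq> Inv"
    by (intro generated_algebra_subset [OF subalg_Inv]) auto
  have hom: "f \<in> generated_algebra ?S" if "f \<in> Inv" "homogeneous d f" "d + \<mu> \<le> m choose 2" for f d
    using that by (intro generated_algebra.gen) (auto simp: degree_at_most_def homogeneous_def)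
  have sub: "symalg U \<subseteq> generated_algebra ?S"
    unfolding symalg_def [of U]
  proof (intro generated_algebra_subset subalg_generated subsetI)
    fix p :: "'k mpoly" assume "p \<in> esym U ` {1..card U}"
    then obtain k where "p = esym U k" "k \<le> m" by (auto simp: card_U)
    then show "p \<in> generated_algebra ?S"
      using hom [of p k] assms symalg_Inv esym_symalg [of U k] by auto
  qed
  show "Inv \<subseteq> generated_algebra ?S"
  proof
    fix f :: "'k mpoly" assume "f \<in> Inv"
    then obtain q where q: "\<forall>i\<in>{1..t}. q i \<in> symalg U" "f = (\<Sum>i=1..t. \<eta> i * q i)"
      by (rule secondary_span [OF sec])
    show "f \<in> generated_algebra ?S"
      unfolding q(2)
    proof (intro subalg_sum [OF subalg_generated] subalg_mult [OF subalg_generated])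
      fix i assume i: "i \<in> {1..t}"
      show "\<eta> i \<in> generated_algebra ?S"
        by (rule hom [OF secondary_Inv [OF sec i] secondary_homogeneous [OF sec i] secondary_degree_le [OF i]])
      show "q i \<in> generated_algebra ?S"
        using q(1) sub i by blast
    qed
  qed
qed

end

end

section \<open>The action on pairs\<close>

lemma pairs_eq: "pairs n = {v. v \<subseteq> {1..n} \<and> card v = 2}"
proof (intro equalityI subsetI)
  fix v assume "v \<in> {v. v \<subseteq> {1..n} \<and> card v = 2}"
  then obtain i j where v: "v = {i, j}" "i \<noteq> j" "i \<in> {1..n}" "j \<in> {1..n}"
    by (auto simp: card_2_iff)
  show "v \<in> pairs n"
  proof (cases "i < j")
    case True
    then show ?thesis unfolding pairs_def using v by (intro CollectI exI [of _ i] exI [of _ j]) simp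
  next
    case False
    then show ?thesis unfolding pairs_def using v
      by (intro CollectI exI [of _ j] exI [of _ i]) (auto simp: insert_commute)
  qed
qed (auto simp: pairs_def)

lemma finite_pairs [simp, intro]: "finite (pairs n)"
  by (rule finite_subset [of _ "Pow {1..n}"]) (auto simp: pairs_eq)

lemma card_pairs: "card (pairs n) = n choose 2"
  using n_subsets [of "{1..n}" 2] by (simp add: pairs_eq)

lemma doubleton_pairs_iff: "{i, j} \<in> pairs n \<longleftrightarrow> i \<in> {1..n} \<and> j \<in> {1..n} \<and> i \<noteq> j"
  by (auto simp: pairs_eq card_2_iff doubleton_eq_iff)

lemma pairsE:
  assumes "v \<in> pairs n"
  obtains i j where "v = {i, j}" "i \<noteq> j" "i \<in> {1..n}" "j \<in> {1..n}"
  using assms by (auto simp: pairs_eq card_2_iff)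

text \<open>The identity off \<open>pairs n\<close>, as \<open>permutes\<close> requires; taking
  images under \<sigma> would also move other sets of vertices.\<close>

definition pperm :: "nat \<Rightarrow> (nat \<Rightarrow> nat) \<Rightarrow> nat set \<Rightarrow> nat set" where
  "pperm n \<sigma> v = (if v \<in> pairs n then \<sigma> ` v else v)"

definition pair_group :: "nat \<Rightarrow> (nat set \<Rightarrow> nat set) set" where
  "pair_group n = pperm n ` {\<sigma>. \<sigma> permutes {1..n}}"

lemma image_pairs:
  assumes "\<sigma> permutes {1..n}" "v \<in> pairs n"
  shows "\<sigma> ` v \<in> pairs n"
  using assms(2)
proof (rule pairsE)
  fix i j assume "v = {i, j}" "i \<noteq> j" "i \<in> {1..n}" "j \<in> {1..n}"
  then show ?thesis
    using permutes_in_image [OF assms(1)] inj_eq [OF permutes_inj [OF assms(1)]]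
    by (simp add: doubleton_pairs_iff)
qed

lemma pperm_id: "pperm n id = id"
  by (rule ext) (simp add: pperm_def)

lemma pperm_comp:
  assumes "\<tau> permutes {1..n}"
  shows "pperm n (\<sigma> \<circ> \<tau>) = pperm n \<sigma> \<circ> pperm n \<tau>"
  using image_pairs [OF assms] by (intro ext) (simp add: pperm_def image_comp)

lemma pperm_inv_left:
  assumes "\<sigma> permutes {1..n}"
  shows "pperm n (inv \<sigma>) \<circ> pperm n \<sigma> = id"
  using pperm_comp [OF assms, of "inv \<sigma>"] permutes_inv_o(2) [OF assms] by (simp add: pperm_id)

lemma pperm_inv_right:
  assumes "\<sigma> permutes {1..n}"
  shows "pperm n \<sigma> \<circ> pperm n (inv \<sigma>) = id"
  using pperm_comp [OF permutes_inv [OF assms], of \<sigma>] permutes_inv_o(1) [OF assms] by (simp add: pperm_id)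

lemma pperm_permutes:
  assumes "\<sigma> permutes {1..n}"
  shows "pperm n \<sigma> permutes pairs n"
proof (rule bij_imp_permutes)
  have inv: "pperm n (inv \<sigma>) (pperm n \<sigma> v) = v" "pperm n \<sigma> (pperm n (inv \<sigma>) v) = v" for v
    using pperm_inv_left [OF assms] pperm_inv_right [OF assms] by (simp_all add: fun_eq_iff)
  have "pperm n \<rho> v \<in> pairs n" if "\<rho> permutes {1..n}" "v \<in> pairs n" for \<rho> v
    using image_pairs [OF that] that by (simp add: pperm_def)
  then show "bij_betw (pperm n \<sigma>) (pairs n) (pairs n)"
    using inv assms permutes_inv [OF assms]
    by (intro bij_betw_byWitness [of _ "pperm n (inv \<sigma>)"]) blast+
qed (simp add: pperm_def)

lemma inv_pperm:
  assumes "\<sigma> permutes {1..n}"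
  shows "inv (pperm n \<sigma>) = pperm n (inv \<sigma>)"
  by (rule inv_unique_comp [OF pperm_inv_right [OF assms] pperm_inv_left [OF assms]])

text \<open>A vertex \<open>i\<close> is recovered as the intersection of the pairs
  \<open>{i, j}\<close> and \<open>{i, k}\<close>, which takes two further vertices. For
  \<open>n = 2\<close> the exchange of both vertices fixes the only pair.\<close>

lemma inj_on_pperm:
  assumes n: "n \<ge> 3"
  shows "inj_on (pperm n) {\<sigma>. \<sigma> permutes {1..n}}"
proof (rule inj_onI, clarify)
  fix \<sigma> \<tau> assume \<sigma>: "\<sigma> permutes {1..n}" and \<tau>: "\<tau> permutes {1..n}" and eq: "pperm n \<sigma> = pperm n \<tau>"
  have im: "\<sigma> ` v = \<tau> ` v" if "v \<in> pairs n" for v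
    using fun_cong [OF eq, of v] that by (simp add: pperm_def)
  show "\<sigma> = \<tau>"
  proof
    fix i show "\<sigma> i = \<tau> i"
    proof (cases "i \<in> {1..n}")
      case True
      have "card ({1..n} - {i}) \<ge> 2" using n True by simp
      then obtain T where T: "T \<subseteq> {1..n} - {i}" "card T = 2"
        by (rule obtain_subset_with_card_n)
      then obtain j k where jk: "j \<in> {1..n}" "k \<in> {1..n}" "j \<noteq> i" "k \<noteq> i" "j \<noteq> k"
        by (auto simp: card_2_iff)
      have int: "{\<rho> i} = \<rho> ` {i, j} \<inter> \<rho> ` {i, k}" if "\<rho> permutes {1..n}" for \<rho>
        using jk inj_eq [OF permutes_inj [OF that]] by auto
      have "{\<sigma> i} = {\<tau> i}"
        unfolding int [OF \<sigma>] int [OF \<tau>]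
        using im [of "{i, j}"] im [of "{i, k}"] True jk by (simp only: doubleton_pairs_iff) simp
      then show ?thesis by simp
    next
      case False
      then show ?thesis using \<sigma> \<tau> by (simp add: permutes_not_in)
    qed
  qed
qed

lemma card_pair_group: "n \<ge> 3 \<Longrightarrow> card (pair_group n) = fact n"
  unfolding pair_group_def by (subst card_image [OF inj_on_pperm]) (simp_all add: card_permutations)

lemma perm_invariants_pairs:
  assumes "distinct vs" "set vs = pairs n"
  shows "perm_invariants vs (pair_group n)"
proof
  show "id \<in> pair_group n"
    unfolding pair_group_def using pperm_id by (intro image_eqI [of _ _ id]) (auto simp: permutes_id)
  show "g \<circ> h \<in> pair_group n" if g: "g \<in> pair_group n" and h: "h \<in> pair_group n" for g h
  proof -
    obtain \<sigma> \<tau> where "\<sigma> permutes {1..n}" "g = pperm n \<sigma>" "\<tau> permutes {1..n}" "h = pperm n \<tau>"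
      using g h by (auto simp: pair_group_def)
    then have "g \<circ> h = pperm n (\<sigma> \<circ> \<tau>)" "\<sigma> \<circ> \<tau> permutes {1..n}"
      by (simp_all add: pperm_comp permutes_compose)
    then show ?thesis
      unfolding pair_group_def by blast
  qed
  show "inv g \<in> pair_group n" if g: "g \<in> pair_group n" for g
  proof -
    obtain \<sigma> where "\<sigma> permutes {1..n}" "g = pperm n \<sigma>"
      using g by (auto simp: pair_group_def)
    then have "inv g = pperm n (inv \<sigma>)" "inv \<sigma> permutes {1..n}"
      by (simp_all add: inv_pperm permutes_inv)
    then show ?thesis
      unfolding pair_group_def by blast
  qed
qed (use assms pperm_permutes in \<open>auto simp: pair_group_def\<close>)

lemma act_pperm: "p \<in> polys (pairs n) \<Longrightarrow> act \<sigma> p = actv (pperm n \<sigma>) p"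
  unfolding act_eq by (rule actv_cong) (auto simp: pperm_def)

section \<open>The sign of a vertex permutation on the pairs\<close>

definition partial_swap :: "nat \<Rightarrow> nat \<Rightarrow> nat set \<Rightarrow> nat set \<Rightarrow> nat set" where
  "partial_swap a b C v = (if \<exists>c\<in>C. v = {a, c} \<or> v = {b, c} then tswap a b ` v else v)"

lemma partial_swap_in:
  "d \<in> C \<Longrightarrow> v = {a, d} \<or> v = {b, d} \<Longrightarrow> partial_swap a b C v = tswap a b ` v"
  unfolding partial_swap_def by (rule if_P) blast

text \<open>The exchanges of \<open>{a, c}\<close> with \<open>{b, c}\<close> for different
  \<open>c\<close> are disjoint. Restricting the action of a vertex transposition to the pairs with
  \<open>c\<close> in \<open>C\<close> lets these exchanges be split off one at a time.\<close>

lemma partial_swap_insert: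
  assumes "a \<noteq> b" "c \<notin> {a, b}" "C \<inter> {a, b} = {}" "c \<notin> C"
  shows "partial_swap a b (insert c C) = tswap {a, c} {b, c} \<circ> partial_swap a b C"
proof
  fix v
  have im: "tswap a b ` {a, d} = {b, d}" "tswap a b ` {b, d} = {a, d}"
    if "d \<in> insert c C" for d
    using that assms by (auto simp: Transposition.transpose_def)
  consider (c) "v = {a, c} \<or> v = {b, c}" | (C) d where "d \<in> C" "v = {a, d} \<or> v = {b, d}"
    | (n) "v \<noteq> {a, c}" "v \<noteq> {b, c}" "\<not> (\<exists>d\<in>C. v = {a, d} \<or> v = {b, d})"
    by blast
  then show "partial_swap a b (insert c C) v =
      (tswap {a, c} {b, c} \<circ> partial_swap a b C) v"
  proof cases
    case c
    then have "partial_swap a b C v = v"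
      using assms by (auto simp: partial_swap_def doubleton_eq_iff)
    then show ?thesis
      using c im [of c] assms by (auto simp: partial_swap_def Transposition.transpose_def doubleton_eq_iff)
  next
    case C
    have d: "d \<noteq> c" "d \<noteq> a" "d \<noteq> b" using C(1) assms by auto
    have "tswap a b ` v = {a, d} \<or> tswap a b ` v = {b, d}"
      using C(2) im [of d] C(1) by (elim disjE) simp_all
    then have "{a, c} \<noteq> tswap a b ` v" "{b, c} \<noteq> tswap a b ` v"
      using d assms by (elim disjE; simp add: doubleton_eq_iff)+
    moreover have "partial_swap a b C v = tswap a b ` v"
      by (rule partial_swap_in [OF C])
    moreover have "partial_swap a b (insert c C) v = tswap a b ` v"
      by (rule partial_swap_in [OF insertI2 [OF C(1)] C(2)])
    ultimately show ?thesis
      by (simp add: Transposition.transpose_apply_other)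
  next
    case n
    then have "partial_swap a b C v = v" "partial_swap a b (insert c C) v = v"
      by (auto simp: partial_swap_def)
    then show ?thesis
      using n by (simp add: Transposition.transpose_apply_other)
  qed
qed

lemma sign_partial_swap:
  assumes "finite C" "a \<noteq> b" "C \<inter> {a, b} = {}"
  shows "permutation (partial_swap a b C) \<and> sign (partial_swap a b C) = (- 1) ^ card C"
  using assms
proof (induction C rule: finite_induct)
  case empty
  have "partial_swap a b {} = id" by (auto simp: partial_swap_def)
  then show ?case by simp
next
  case (insert c C)
  have eq: "partial_swap a b (insert c C) = tswap {a, c} {b, c} \<circ> partial_swap a b C"
    using insert by (intro partial_swap_insert) auto
  have "{a, c} \<noteq> {b, c}" using insert.prems by (auto simp: doubleton_eq_iff)
  have IH: "permutation (partial_swap a b C)" "sign (partial_swap a b C) = (- 1) ^ card C"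
    using insert.IH insert.prems by auto
  have "permutation (partial_swap a b (insert c C))"
    unfolding eq by (intro permutation_compose permutation_swap_id IH)
  moreover have "sign (partial_swap a b (insert c C)) = (- 1) ^ card (insert c C)"
    unfolding eq sign_compose [OF permutation_swap_id IH(1)]
    using IH(2) insert.hyps \<open>{a, c} \<noteq> {b, c}\<close> by (simp add: sign_swap_id)
  ultimately show ?case ..
qed

lemma sign_pperm_transpose:
  assumes ab: "a \<in> {1..n}" "b \<in> {1..n}" "a \<noteq> b"
  shows "sign (pperm n (tswap a b)) = (- 1) ^ n"
proof -
  let ?C = "{1..n} - {a, b}" and ?t = "tswap a b"
  have "pperm n ?t = partial_swap a b ?C"
  proof
    fix v show "pperm n ?t v = partial_swap a b ?C v"
    proof (cases "\<exists>c\<in>?C. v = {a, c} \<or> v = {b, c}")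
      case True
      then have "v \<in> pairs n" using ab by (auto simp: doubleton_pairs_iff)
      with True show ?thesis by (simp add: partial_swap_def pperm_def)
    next
      case False
      \<comment> \<open>A pair not of the form \<open>{a, c}\<close> or \<open>{b, c}\<close> either
        avoids both vertices or equals \<open>{a, b}\<close>.\<close>
      have "?t ` v = v" if "v \<in> pairs n"
        using that
      proof (rule pairsE)
        fix i j assume v: "v = {i, j}" "i \<noteq> j" "i \<in> {1..n}" "j \<in> {1..n}"
        have F: "v \<noteq> {a, c}" "v \<noteq> {b, c}" if "c \<in> ?C" for c
          using False that by blast+
        have "v = {j, i}" using v by (simp add: insert_commute)
        then have "i \<in> {a, b} \<Longrightarrow> j \<notin> ?C" "j \<in> {a, b} \<Longrightarrow> i \<notin> ?C"
          using F [of j] F [of i] v(1) by blast+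
        then have "(i \<notin> {a, b} \<and> j \<notin> {a, b}) \<or> v = {a, b}"
          using v by blast
        then show ?thesis
          using v by (auto simp: Transposition.transpose_def)
      qed
      with False show ?thesis by (simp only: partial_swap_def pperm_def if_False) simp
    qed
  qed
  then have "sign (pperm n ?t) = (- 1) ^ card ?C"
    using sign_partial_swap [of ?C a b] ab by auto
  also have "card ?C + 2 = n"
  proof -
    have "card {a, b} \<le> card {1..n}" using ab by (intro card_mono) auto
    then show ?thesis using ab by (subst card_Diff_subset) auto
  qed
  then have "(- 1 :: int) ^ card ?C = (- 1) ^ n"
    by (metis even_add even_numeral minus_one_power_iff)
  finally show ?thesis .
qed

lemma sign_pperm:
  assumes "\<sigma> permutes {1..n}"
  shows "sign (pperm n \<sigma>) = (if even n then 1 else sign \<sigma>)"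
  using assms finite_atLeastAtMost [of 1 n]
proof (induction \<sigma> rule: permutes_induct)
  case id
  show ?case by (simp only: pperm_id sign_id if_cancel)
next
  case (swap a b p)
  have perm: "permutation (pperm n \<tau>)" if "\<tau> permutes {1..n}" for \<tau>
    using pperm_permutes [OF that] by (auto simp: permutation_permutes)
  have t: "tswap a b permutes {1..n}"
    using swap by (intro permutes_swap_id) auto
  have p: "permutation p" using swap by (auto simp: permutation_permutes)
  have pair_sign: "sign (pperm n (tswap a b \<circ> p)) = (- 1) ^ n * sign (pperm n p)"
    unfolding pperm_comp [OF swap(4)] sign_compose [OF perm [OF t] perm [OF swap(4)]]
      sign_pperm_transpose [OF swap(1-3)] ..
  have comp_sign: "sign (tswap a b \<circ> p) = - sign p"
    unfolding sign_compose [OF permutation_swap_id p] using swap(3) by (simp add: sign_swap_id)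
  show ?case
    unfolding pair_sign comp_sign swap(5) by (cases "even n") simp_all
qed

section \<open>Multigraphs without odd automorphisms\<close>

text \<open>The monomial with exponent \<open>b\<close> goes to the one with exponent
  \<open>b\<close> composed with the inverse of \<pi>; hence the exponent is pulled back along \<pi>
  itself.\<close>

lemma lookup_actv:
  fixes g :: "'k::field_char_0 mpoly"
  assumes \<pi>: "bij \<pi>"
  shows "lookup (actv \<pi> g) a = lookup g (map_key \<pi> a)"
proof -
  have inj: "inj \<pi>" "inj (inv \<pi>)" and surj: "surj \<pi>"
    using \<pi> bij_is_inj [OF bij_imp_bij_inv [OF \<pi>]] by (auto simp: bij_def)
  have mono: "mhom (\<lambda>v. var (\<pi> v)) b = (single (map_key (inv \<pi>) b) 1 :: 'k mpoly)" for b
  proof -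
    let ?b = "map_key (inv \<pi>) b"
    have keys: "keys ?b = \<pi> ` keys b"
      unfolding Poly_Mapping.keys_map_key [OF inj(2)]
      by (simp add: bij_vimage_eq_inv_image [OF bij_imp_bij_inv [OF \<pi>]] inv_inv_eq [OF \<pi>])
    have "lookup ?b (\<pi> v) = lookup b v" for v
      by (simp add: Poly_Mapping.map_key.rep_eq [OF inj(2)] inj(1))
    then have "mhom var ?b = (\<Prod>v\<in>keys b. var (\<pi> v) ^ lookup b v :: 'k mpoly)"
      unfolding mhom_def keys by (subst prod.reindex) (use inj in \<open>auto intro: inj_on_subset\<close>)
    then show ?thesis
      unfolding mhom_var by (simp add: mhom_def)
  qed
  have iff: "map_key (inv \<pi>) b = a \<longleftrightarrow> b = map_key \<pi> a" for b
  proof -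
    have "map_key \<pi> (map_key (inv \<pi>) b) = b"
      "map_key (inv \<pi>) (map_key \<pi> a) = a"
      by (rule poly_mapping_eqI,
          simp add: Poly_Mapping.map_key.rep_eq inj surj_f_inv_f [OF surj] inv_f_f [OF inj(1)])+
    then show ?thesis by auto
  qed
  have "actv \<pi> g = (\<Sum>b\<in>keys g. single (map_key (inv \<pi>) b) (lookup g b))"
    by (simp add: actv_def psubst_def mono const_def mult_single)
  then have "lookup (actv \<pi> g) a = (\<Sum>b\<in>keys g. if b = map_key \<pi> a then lookup g b else 0)"
    by (auto simp: lookup_sum lookup_single when_def iff intro!: sum.cong)
  then show ?thesis
    by (simp add: in_keys_iff)
qed

text \<open>
  The exponent \<open>a\<close> is a multigraph on \<open>{1..n}\<close>. At most one vertex is isolated, and mapping each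
  leaf to its neighbour injects the leaves into the vertices of degree at least two.
\<close>

lemma multigraph_size:
  fixes a :: expo
  assumes a: "keys a \<subseteq> pairs n"
    and nosym: "\<And>i j. i \<in> {1..n} \<Longrightarrow> j \<in> {1..n} \<Longrightarrow> i \<noteq> j \<Longrightarrow>
      \<exists>k\<in>{1..n} - {i, j}. lookup a {i, k} \<noteq> lookup a {j, k}"
  shows "3 * (n - 1) \<le> 4 * mon_degree a"
proof -
  define dg where "dg i = (\<Sum>v\<in>keys a. if i \<in> v then lookup a v else 0)" for i
  have total: "(\<Sum>i=1..n. dg i) = 2 * mon_degree a"
  proof -
    have "(\<Sum>i=1..n. dg i) = (\<Sum>v\<in>keys a. \<Sum>i=1..n. if i \<in> v then lookup a v else 0)"
      unfolding dg_def by (rule sum.swap)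
    also have "\<dots> = (\<Sum>v\<in>keys a. 2 * lookup a v)"
    proof (intro sum.cong refl)
      fix v assume "v \<in> keys a"
      then have v: "v \<subseteq> {1..n}" "card v = 2" using a by (auto simp: pairs_eq)
      have "(\<Sum>i=1..n. if i \<in> v then lookup a v else 0) = (\<Sum>i\<in>{1..n} \<inter> v. lookup a v)"
        by (subst sum.inter_restrict) auto
      also have "{1..n} \<inter> v = v" using v by auto
      finally show "(\<Sum>i=1..n. if i \<in> v then lookup a v else 0) = 2 * lookup a v" using v by simp
    qed
    finally show ?thesis by (simp add: mon_degree_def sum_distrib_left)
  qed
  have dg_ge: "lookup a v \<le> dg i" if "i \<in> v" for i v
  proof (cases "v \<in> keys a")
    case True
    have "(if i \<in> v then lookup a v else 0) \<le> dg i"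
      unfolding dg_def using True by (intro member_le_sum) auto
    then show ?thesis using that by simp
  qed (simp add: in_keys_iff)
  have dg_ge2: "lookup a v + lookup a w \<le> dg i" if "i \<in> v" "i \<in> w" "v \<noteq> w" for i v w
  proof (cases "v \<in> keys a \<and> w \<in> keys a")
    case True
    have "(\<Sum>v\<in>{v, w}. if i \<in> v then lookup a v else 0) \<le> dg i"
      unfolding dg_def using True by (intro sum_mono2) auto
    then show ?thesis using that by simp
  next
    case False
    then show ?thesis using dg_ge [OF that(1)] dg_ge [OF that(2)] by (auto simp: in_keys_iff)
  qed
  define N0 where "N0 = {i\<in>{1..n}. dg i = 0}"
  define N1 where "N1 = {i\<in>{1..n}. dg i = 1}"
  define N2 where "N2 = {i\<in>{1..n}. dg i \<ge> 2}"
  \<comment> \<open>Two isolated vertices agree on every third vertex.\<close>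
  have "card N0 \<le> 1"
  proof (rule ccontr)
    assume "\<not> ?thesis"
    moreover have "finite N0" by (simp add: N0_def)
    ultimately obtain i j where ij: "i \<in> N0" "j \<in> N0" "i \<noteq> j"
      unfolding One_nat_def using card_le_Suc0_iff_eq by blast
    then have "lookup a {i, k} = 0" "lookup a {j, k} = 0" for k
      using dg_ge [of i "{i, k}"] dg_ge [of j "{j, k}"] by (auto simp: N0_def)
    then show False
      using nosym [of i j] ij by (auto simp: N0_def)
  qed
  moreover have "card N1 \<le> card N2"
  proof -
    have leaf: "\<exists>u\<in>{1..n}. u \<noteq> i \<and> lookup a {i, u} = 1 \<and> (\<forall>k. k \<noteq> u \<longrightarrow> lookup a {i, k} = 0)"
      if i: "i \<in> N1" for i
    proof -
      have "dg i \<noteq> 0" using i by (simp add: N1_def)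
      then obtain v where "v \<in> keys a" "(if i \<in> v then lookup a v else 0) \<noteq> 0"
        unfolding dg_def by (rule sum.not_neutral_contains_not_neutral)
      then have v: "v \<in> keys a" "i \<in> v"
        by (simp_all split: if_splits)
      then have "v \<in> pairs n" using a by auto
      then obtain u where u: "v = {i, u}" "u \<noteq> i" "u \<in> {1..n}"
        using v(2) by (elim pairsE) (auto simp: insert_commute)
      have "lookup a v \<noteq> 0" using v by (simp add: in_keys_iff)
      then have one: "lookup a {i, u} = 1"
        using dg_ge [OF v(2)] i u by (simp add: N1_def)
      have "lookup a {i, k} = 0" if "k \<noteq> u" for k
        using dg_ge2 [of i "{i, u}" "{i, k}"] one i that by (auto simp: N1_def doubleton_eq_iff)
      with one u show ?thesis by blast
    qed
    then obtain f where f: "\<And>i. i \<in> N1 \<Longrightarrow> f i \<in> {1..n} \<and> f i \<noteq> i \<and> lookup a {i, f i} = 1 \<and>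
        (\<forall>k. k \<noteq> f i \<longrightarrow> lookup a {i, k} = 0)"
      by metis
    \<comment> \<open>If the neighbour of a leaf were a leaf too, the two would form an isolated
      edge and agree on every third vertex.\<close>
    have "f ` N1 \<subseteq> N2"
    proof (rule image_subsetI)
      fix i assume i: "i \<in> N1"
      have "1 \<le> dg (f i)" using dg_ge [of "f i" "{i, f i}"] f [OF i] by auto
      moreover have "dg (f i) \<noteq> 1"
      proof
        assume 1: "dg (f i) = 1"
        obtain k where k: "k \<in> {1..n} - {i, f i}" "lookup a {i, k} \<noteq> lookup a {f i, k}"
        proof -
          have "i \<in> {1..n}" "f i \<in> {1..n}" "i \<noteq> f i"
            using f [OF i] i by (simp_all add: N1_def)
          from nosym [OF this] that show ?thesis by blast
        qed
        have "lookup a {i, k} = 0" using f [OF i] k by auto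
        moreover have "lookup a {i, f i} + lookup a {f i, k} \<le> 1"
          using dg_ge2 [of "f i" "{i, f i}" "{f i, k}"] k 1 by (auto simp: doubleton_eq_iff)
        ultimately show False using k f [OF i] by auto
      qed
      ultimately show "f i \<in> N2" using f [OF i] by (auto simp: N2_def)
    qed
    \<comment> \<open>Two leaves with the same neighbour agree on every third vertex.\<close>
    moreover have "inj_on f N1"
    proof (rule inj_onI, rule ccontr)
      fix i j assume ij: "i \<in> N1" "j \<in> N1" "f i = f j" "i \<noteq> j"
      obtain k where "k \<in> {1..n} - {i, j}" "lookup a {i, k} \<noteq> lookup a {j, k}"
      proof -
        have "i \<in> {1..n}" "j \<in> {1..n}"
          using ij by (simp_all add: N1_def)
        from nosym [OF this ij(4)] that show ?thesis by blast
      qed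
      then show False
        using f [OF ij(1)] f [OF ij(2)] ij by (cases "k = f i") auto
    qed
    ultimately show ?thesis
      by (intro card_inj_on_le [of f]) (auto simp: N2_def)
  qed
  moreover have "n = card N0 + card N1 + card N2"
  proof -
    have "card {1..n} = card (N0 \<union> (N1 \<union> N2))"
      by (intro arg_cong [of _ _ card]) (auto simp: N0_def N1_def N2_def)
    also have "\<dots> = card N0 + card (N1 \<union> N2)"
      by (intro card_Un_disjoint) (auto simp: N0_def N1_def N2_def)
    also have "card (N1 \<union> N2) = card N1 + card N2"
      by (intro card_Un_disjoint) (auto simp: N1_def N2_def)
    finally show ?thesis by simp
  qed
  moreover have "card N1 + 2 * card N2 \<le> (\<Sum>i=1..n. dg i)"
  proof -
    have "card N1 + 2 * card N2 = (\<Sum>i\<in>N1. 1) + (\<Sum>i\<in>N2. 2)" by simp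
    also have "\<dots> \<le> (\<Sum>i\<in>N1. dg i) + (\<Sum>i\<in>N2. dg i)"
      by (intro add_mono sum_mono) (auto simp: N1_def N2_def)
    also have "\<dots> = (\<Sum>i\<in>N1 \<union> N2. dg i)"
      by (intro sum.union_disjoint [symmetric]) (auto simp: N1_def N2_def)
    also have "\<dots> \<le> (\<Sum>i=1..n. dg i)"
      by (intro sum_mono2) (auto simp: N1_def N2_def)
    finally show ?thesis .
  qed
  \<comment> \<open>With \<open>x\<close>, \<open>y\<close> the sizes of \<open>N1\<close>,
    \<open>N2\<close>: four times the number of edges is at least \<open>2 * x + 4 * y\<close>,
    which is at least \<open>3 * (x + y)\<close> because \<open>x \<le> y\<close>, and
    \<open>x + y \<ge> n - 1\<close>.\<close>
  ultimately show ?thesis using total by linarith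
qed

text \<open>
  On \<open>2 * h + 1\<close> vertices attach a leaf \<open>i + h\<close> to each vertex \<open>i \<le> h\<close> of a smallest
  graph without isolated vertices on \<open>{1..h}\<close>; vertex \<open>2 * h + 1\<close> stays isolated.
\<close>

definition core_edge :: "nat \<Rightarrow> nat \<Rightarrow> nat set" where
  "core_edge h k = (if 2 * k + 2 \<le> h then {2 * k + 1, 2 * k + 2} else {h - 1, h})"

definition corona :: "nat \<Rightarrow> nat set set" where
  "corona h = (\<lambda>i. {i, i + h}) ` {1..h} \<union> core_edge h ` {..<(h + 1) div 2}"

text \<open>An upper bound suffices: equality follows later from the lower bound on degrees of
  semi-invariants.\<close>

lemma card_corona: "card (corona h) \<le> h + (h + 1) div 2"
proof -
  have "card (corona h) \<le> card ((\<lambda>i. {i, i + h}) ` {1..h}) + card (core_edge h ` {..<(h + 1) div 2})"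
    unfolding corona_def by (rule card_Un_le)
  also have "\<dots> \<le> card {1..h} + card {..<(h + 1) div 2}"
    by (intro add_mono card_image_le) auto
  finally show ?thesis by simp
qed

lemma finite_corona: "finite (corona h)"
  by (simp add: corona_def)

lemma core_edge_eq:
  assumes "h \<ge> 2" "k < (h + 1) div 2"
  obtains i j where "core_edge h k = {i, j}" "i \<in> {1..h}" "j \<in> {1..h}" "i \<noteq> j"
proof (cases "2 * k + 2 \<le> h")
  case True
  then show ?thesis by (intro that [of "2 * k + 1" "2 * k + 2"]) (auto simp: core_edge_def)
next
  case False
  then show ?thesis using assms by (intro that [of "h - 1" h]) (auto simp: core_edge_def)
qed

lemma core_edge_subset:
  assumes "h \<ge> 2" "k < (h + 1) div 2"
  shows "core_edge h k \<subseteq> {1..h}"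
  using core_edge_eq [OF assms] by (metis empty_subsetI insert_subset)

lemma core_edge_cover:
  assumes "i \<in> {1..h}"
  shows "\<exists>k<(h + 1) div 2. i \<in> core_edge h k"
proof -
  have "(i - 1) div 2 < (h + 1) div 2" using assms by auto
  moreover have "i \<in> core_edge h ((i - 1) div 2)"
  proof -
    \<comment> \<open>If \<open>i = h\<close> is odd, its edge is the exceptional one,
      \<open>{h - 1, h}\<close>.\<close>
    have "i = 2 * ((i - 1) div 2) + 1 \<or> i = 2 * ((i - 1) div 2) + 2"
      using assms by auto
    then show ?thesis using assms unfolding core_edge_def by auto
  qed
  ultimately show ?thesis by blast
qed

lemma corona_pairs:
  assumes "h \<ge> 2"
  shows "corona h \<subseteq> pairs (2 * h + 1)"
proof
  fix v assume "v \<in> corona h"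
  then consider i where "i \<in> {1..h}" "v = {i, i + h}" | k where "k < (h + 1) div 2" "v = core_edge h k"
    by (auto simp: corona_def)
  then show "v \<in> pairs (2 * h + 1)"
  proof cases
    case 1
    then show ?thesis by (simp add: doubleton_pairs_iff)
  next
    case 2
    obtain i j where "core_edge h k = {i, j}" "i \<in> {1..h}" "j \<in> {1..h}" "i \<noteq> j"
      using core_edge_eq [OF assms 2(1)] by blast
    then show ?thesis using 2 by (simp add: doubleton_pairs_iff)
  qed
qed

text \<open>The number of edges at a vertex is 1 at a leaf, 0 at the isolated vertex and at least 2
  at a core vertex. Automorphisms therefore preserve the three kinds of vertices.\<close>

lemma corona_star_leaf:
  assumes h: "h \<ge> 2" and i: "i \<in> {1..h}"
  shows "{v \<in> corona h. i + h \<in> v} = {{i, i + h}}"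
proof -
  have "i + h \<notin> core_edge h k" if "k < (h + 1) div 2" for k
    using core_edge_subset [OF h that] i by auto
  then show ?thesis using i by (auto simp: corona_def)
qed

lemma corona_star_isolated:
  assumes h: "h \<ge> 2"
  shows "{v \<in> corona h. 2 * h + 1 \<in> v} = {}"
proof -
  have "2 * h + 1 \<notin> core_edge h k" if "k < (h + 1) div 2" for k
    using core_edge_subset [OF h that] by auto
  then show ?thesis by (auto simp: corona_def)
qed

lemma corona_star_core:
  assumes h: "h \<ge> 2" and i: "i \<in> {1..h}"
  shows "card {v \<in> corona h. i \<in> v} \<ge> 2"
proof -
  obtain k where k: "k < (h + 1) div 2" "i \<in> core_edge h k"
    using core_edge_cover [OF i] by blast
  have "i + h \<notin> core_edge h k"
    using core_edge_subset [OF h k(1)] i by auto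
  then have "{i, i + h} \<noteq> core_edge h k" by auto
  then have "2 = card {{i, i + h}, core_edge h k}" by simp
  also have "\<dots> \<le> card {v \<in> corona h. i \<in> v}"
    using k i finite_corona by (intro card_mono) (auto simp: corona_def)
  finally show ?thesis .
qed

text \<open>
  An automorphism acts on the leaves as it acts on their neighbours, so its sign is a square.
\<close>

lemma corona_automorphism_even:
  assumes h: "h \<ge> 2" and \<sigma>: "\<sigma> permutes {1..2 * h + 1}"
    and aut: "\<And>v. v \<in> pairs (2 * h + 1) \<Longrightarrow> \<sigma> ` v \<in> corona h \<longleftrightarrow> v \<in> corona h"
  shows "sign \<sigma> = 1"
proof -
  define n where "n = 2 * h + 1"
  define st where "st i = {v \<in> corona h. i \<in> v}" for i
  have inj: "inj \<sigma>" using \<sigma> by (rule permutes_inj)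
  have st: "st (\<sigma> i) = image \<sigma> ` st i" for i
  proof (intro equalityI subsetI)
    fix v assume v: "v \<in> st (\<sigma> i)"
    define w where "w = inv \<sigma> ` v"
    have vw: "v = \<sigma> ` w"
      using permutes_surj [OF \<sigma>] by (simp add: w_def image_comp surj_iff)
    have "v \<in> pairs (2 * h + 1)" using v corona_pairs [OF h] by (auto simp: st_def)
    then have "w \<in> pairs (2 * h + 1)"
      unfolding w_def by (rule image_pairs [OF permutes_inv [OF \<sigma>]])
    then have "w \<in> corona h" using aut v vw by (simp add: st_def)
    moreover have "i \<in> w" using v vw inj by (auto simp: st_def inj_image_mem_iff)
    ultimately show "v \<in> image \<sigma> ` st i" using vw by (auto simp: st_def)
  next
    fix v assume "v \<in> image \<sigma> ` st i"
    then show "v \<in> st (\<sigma> i)"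
      using aut corona_pairs [OF h] by (auto simp: st_def)
  qed
  have cst: "card (st (\<sigma> i)) = card (st i)" for i
    unfolding st using inj by (intro card_image) (auto simp: inj_on_def inj_image_eq_iff)
  have cL: "card (st (i + h)) = 1" if "i \<in> {1..h}" for i
    using corona_star_leaf [OF h that] by (simp add: st_def)
  have cM: "card (st i) \<ge> 2" if "i \<in> {1..h}" for i
    using corona_star_core [OF h that] by (simp add: st_def)
  have cn: "card (st n) = 0"
    unfolding st_def n_def corona_star_isolated [OF h] by simp
  have range: "\<sigma> i \<in> {1..n} \<longleftrightarrow> i \<in> {1..n}" for i
    unfolding n_def by (rule permutes_in_image [OF \<sigma>])
  have cases: "i \<in> {1..h} \<or> (\<exists>j\<in>{1..h}. i = j + h) \<or> i = n" if "i \<in> {1..n}" for i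
  proof (cases "i \<le> h \<or> i = n")
    case False
    then have "i - h \<in> {1..h}" "i = (i - h) + h" using that by (auto simp: n_def)
    then show ?thesis by blast
  qed (use that in auto)
  have M: "\<sigma> i \<in> {1..h}" if i: "i \<in> {1..h}" for i
  proof -
    have "\<sigma> i \<in> {1..n}" using range [of i] i by (auto simp: n_def)
    with cases [OF this] cM [OF i] cst [of i] cL cn show ?thesis by fastforce
  qed
  have \<sigma>n: "\<sigma> n = n"
  proof -
    have "\<sigma> n \<in> {1..n}" using range [of n] by (auto simp: n_def)
    with cases [OF this] cn cst [of n] cL cM show ?thesis by fastforce
  qed
  have leaf: "\<sigma> (i + h) = \<sigma> i + h" if i: "i \<in> {1..h}" for i
  proof -
    have "\<sigma> (i + h) \<in> {1..n}" using range [of "i + h"] i by (auto simp: n_def)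
    with cases [OF this] cL [OF i] cst [of "i + h"] cn cM
    obtain j where j: "j \<in> {1..h}" "\<sigma> (i + h) = j + h" by fastforce
    \<comment> \<open>The only edge at a leaf goes to its core vertex, so its image is the only edge
      at the image leaf.\<close>
    have "{i, i + h} \<in> st (i + h)" using i by (auto simp: st_def corona_def)
    then have "\<sigma> ` {i, i + h} \<in> image \<sigma> ` st (i + h)" by (rule imageI)
    then have "\<sigma> ` {i, i + h} \<in> st (j + h)" unfolding st [symmetric] j(2) .
    then have "\<sigma> ` {i, i + h} = {j, j + h}"
      using corona_star_leaf [OF h j(1)] by (simp add: st_def)
    moreover have "\<sigma> i \<noteq> j + h" using M [OF i] j by auto
    ultimately have "\<sigma> i = j" by auto
    then show ?thesis using j by simp
  qed
  \<comment> \<open>The restriction of \<sigma> to the core; \<open>\<rho>'\<close> is its copy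
    shifted by \<open>h\<close> to the leaves. The two have equal signs and compose to
    \<sigma>.\<close>
  define \<rho> where "\<rho> i = (if i \<in> {1..h} then \<sigma> i else i)" for i
  have \<rho>: "\<rho> permutes {1..h}"
  proof (rule inj_imp_permutes)
    show "inj_on \<rho> {1..h}" using inj by (auto simp: \<rho>_def inj_on_def inj_def)
    show "\<rho> i \<in> {1..h}" if "i \<in> {1..h}" for i using M [OF that] that by (simp add: \<rho>_def)
  qed (auto simp: \<rho>_def)
  define \<rho>' where "\<rho>' = map_permutation {1..h} (\<lambda>i. i + h) \<rho>"
  have inj_h: "inj_on (\<lambda>i. i + h) {1..h}" by (simp add: inj_on_def)
  have \<rho>'1: "\<rho>' (i + h) = \<sigma> i + h" if "i \<in> {1..h}" for i
    using that inv_into_f_f [OF inj_h that]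
    by (simp add: \<rho>'_def map_permutation_def restrict_id_def \<rho>_def)
  have \<rho>'2: "\<rho>' i = i" if "\<And>j. j \<in> {1..h} \<Longrightarrow> i \<noteq> j + h" for i
  proof -
    have "i \<notin> (\<lambda>i. i + h) ` {1..h}" using that by blast
    then show ?thesis
      by (simp only: \<rho>'_def map_permutation_def restrict_id_def if_False)
  qed
  have "\<rho>' permutes (\<lambda>i. i + h) ` {1..h}"
    unfolding \<rho>'_def by (rule map_permutation_permutes [OF _ \<rho>]) (use inj_h in \<open>auto simp: bij_betw_def\<close>)
  then have perm: "permutation \<rho>" "permutation \<rho>'"
    using \<rho> by (auto simp: permutation_permutes)
  have "\<sigma> = \<rho> \<circ> \<rho>'"
  proof
    fix i show "\<sigma> i = (\<rho> \<circ> \<rho>') i"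
    proof (cases "i \<in> {1..n}")
      case True
      then consider "i \<in> {1..h}" | j where "j \<in> {1..h}" "i = j + h" | "i = n"
        using cases by blast
      then show ?thesis
      proof cases
        case 1
        then have "\<rho>' i = i" by (intro \<rho>'2) auto
        then show ?thesis using 1 by (simp add: \<rho>_def)
      next
        case 2
        have "\<sigma> j + h \<notin> {1..h}" using M [OF 2(1)] by auto
        then show ?thesis using 2 leaf \<rho>'1 by (simp add: \<rho>_def)
      next
        case 3
        have "\<rho>' i = i" using 3 by (intro \<rho>'2) (auto simp: n_def)
        then show ?thesis using 3 \<sigma>n by (simp add: \<rho>_def n_def)
      qed
    next
      case False
      then have "\<rho>' i = i" by (intro \<rho>'2) (auto simp: n_def)
      moreover have "\<sigma> i = i" using False \<sigma> by (intro permutes_not_in) (auto simp: n_def)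
      moreover have "i \<notin> {1..h}" using False by (auto simp: n_def)
      ultimately show ?thesis by (simp add: \<rho>_def)
    qed
  qed
  moreover have "sign \<rho>' = sign \<rho>"
    unfolding \<rho>'_def by (rule sign_map_permutation [OF inj_h \<rho>]) simp
  ultimately show ?thesis
    using perm by (simp add: sign_compose)
qed

section \<open>The minimal semi-invariant\<close>

text \<open>Consequently a monomial fixed by some odd element of \<open>G\<close> has coefficient 0
  in every semi-invariant.\<close>

lemma (in perm_invariants) semi_lookup:
  assumes "semi g" "h \<in> G"
  shows "lookup g (map_key h a) = of_int (sign h) * lookup g a"
proof -
  have "lookup (actv h g) a = of_int (sign h) * lookup g a"
    using assms by (simp add: semi_def lookup_const_mult)
  then show ?thesis
    using lookup_actv [OF permutes_bij [OF G_perm [OF assms(2)]], of g a] by simp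
qed

text \<open>Take any monomial of \<open>g\<close>. If two vertices had equal multiplicities to every
  third vertex, exchanging them would fix the monomial; for odd \<open>n\<close> this exchange is
  odd on pairs, so the coefficient would vanish.\<close>

lemma semi_degree_ge:
  fixes g :: "'k::field_char_0 mpoly"
  assumes ds: "distinct vs" "set vs = pairs n" and n: "odd n"
    and g: "perm_invariants.semi vs (pair_group n) g" "homogeneous d g" "g \<noteq> 0"
  shows "3 * (n - 1) \<le> 4 * d"
proof -
  interpret perm_invariants vs "pair_group n"
    by (rule perm_invariants_pairs [OF ds])
  obtain a where a: "a \<in> keys g" using g(3) by fastforce
  have deg: "mon_degree a = d" using g(2) a by (simp add: homogeneous_def)
  have aU: "keys a \<subseteq> pairs n"
    using g(1) a ds(2) by (auto simp: semi_def polys_def)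
  have "\<exists>k\<in>{1..n} - {i, j}. lookup a {i, k} \<noteq> lookup a {j, k}"
    if ij: "i \<in> {1..n}" "j \<in> {1..n}" "i \<noteq> j" for i j
  proof (rule ccontr)
    assume "\<not> ?thesis"
    then have sym: "lookup a {i, k} = lookup a {j, k}" if "k \<in> {1..n}" "k \<notin> {i, j}" for k
      using that by blast
    define t where "t = tswap i j"
    have t: "t permutes {1..n}" unfolding t_def using ij by (intro permutes_swap_id)
    have tG: "pperm n t \<in> pair_group n" using t by (auto simp: pair_group_def)
    have sw: "lookup a (t ` {x, y}) = lookup a {x, y}" if x: "x \<in> {i, j}" and y: "y \<in> {1..n}" "x \<noteq> y" for x y
    proof (cases "y \<in> {i, j}")
      case True
      then have "{x, y} = {i, j}" using x y by auto
      then show ?thesis by (simp add: t_def insert_commute)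
    next
      case False
      then have "t y = y" by (simp add: t_def Transposition.transpose_apply_other)
      moreover have "t x = j \<and> x = i \<or> t x = i \<and> x = j" using x by (auto simp: t_def)
      ultimately show ?thesis using sym [OF y(1) False] by auto
    qed
    have "lookup a (pperm n t v) = lookup a v" for v
    proof (cases "v \<in> pairs n")
      case True
      then obtain x y where v: "v = {x, y}" "x \<noteq> y" "x \<in> {1..n}" "y \<in> {1..n}"
        by (rule pairsE)
      have "lookup a (t ` v) = lookup a v"
      proof (cases "x \<in> {i, j} \<or> y \<in> {i, j}")
        case True
        then show ?thesis
          using sw [of x y] sw [of y x] v by (auto simp: insert_commute)
      next
        case False
        then have "t x = x" "t y = y" by (simp_all add: t_def Transposition.transpose_apply_other)
        then show ?thesis using v by simp
      qed
      then show ?thesis using True by (simp add: pperm_def)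
    qed (simp add: pperm_def)
    then have "map_key (pperm n t) a = a"
      using permutes_inj [OF pperm_permutes [OF t]]
      by (intro poly_mapping_eqI) (simp add: Poly_Mapping.map_key.rep_eq)
    moreover have "sign (pperm n t) = - 1"
      unfolding sign_pperm [OF t] using n ij by (simp add: t_def sign_swap_id)
    ultimately have "lookup g a = - lookup g a"
      using semi_lookup [OF g(1) tG, of a] by simp
    then show False using a by (simp add: in_keys_iff)
  qed
  then show ?thesis
    using multigraph_size [OF aU] deg by simp
qed

text \<open>In the signed sum over \<open>G\<close> of the corona monomial, the coefficient of this
  monomial is the signed count of its stabilizer. All automorphisms are even, so the count is a
  positive integer, nonzero in characteristic zero.\<close>

lemma corona_semi:
  assumes ds: "distinct vs" "set vs = pairs (2 * h + 1)" and h: "h \<ge> 2"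
  shows "\<exists>g :: 'k::field_char_0 mpoly. perm_invariants.semi vs (pair_group (2 * h + 1)) g \<and>
    homogeneous (card (corona h)) g \<and> g \<noteq> 0"
proof -
  let ?n = "2 * h + 1"
  interpret perm_invariants vs "pair_group ?n"
    by (rule perm_invariants_pairs [OF ds])
  define a :: expo where "a = (\<Sum>v\<in>corona h. single v 1)"
  have la: "lookup a v = (if v \<in> corona h then 1 else 0)" for v
    using finite_corona by (simp add: a_def lookup_sum lookup_single when_def)
  have ka: "keys a = corona h"
    by (auto simp: in_keys_iff la split: if_splits)
  have deg: "mon_degree a = card (corona h)"
    by (simp add: mon_degree_def ka la)
  let ?x = "single a 1 :: 'k mpoly"
  have x: "?x \<in> polys U" "homogeneous (card (corona h)) ?x"
    using corona_pairs [OF h] by (simp_all add: polys_def homogeneous_def ka deg ds)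
  have inj: "inj \<pi>" "bij \<pi>" if "\<pi> \<in> pair_group ?n" for \<pi>
    using permutes_inj [OF G_perm [OF that]] permutes_bij [OF G_perm [OF that]] by auto
  let ?S = "{\<pi> \<in> pair_group ?n. map_key \<pi> a = a}"
  have even: "sign \<pi> = 1" if \<pi>: "\<pi> \<in> ?S" for \<pi>
  proof -
    obtain \<sigma> where \<sigma>: "\<sigma> permutes {1..?n}" "\<pi> = pperm ?n \<sigma>"
      using \<pi> by (auto simp: pair_group_def)
    have fix_a: "lookup a (\<pi> v) = lookup a v" for v
    proof -
      have "\<pi> \<in> pair_group ?n" "map_key \<pi> a = a" using \<pi> by auto
      then show ?thesis
        using Poly_Mapping.map_key.rep_eq [OF inj(1), of \<pi> a] by (metis comp_apply)
    qed
    have "sign \<sigma> = 1"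
    proof (rule corona_automorphism_even [OF h \<sigma>(1)])
      fix v assume "v \<in> pairs ?n"
      then have "lookup a (\<sigma> ` v) = lookup a v"
        using fix_a [of v] by (simp add: \<sigma>(2) pperm_def)
      then show "\<sigma> ` v \<in> corona h \<longleftrightarrow> v \<in> corona h"
        by (simp add: la split: if_splits)
    qed
    then show ?thesis
      unfolding \<sigma>(2) sign_pperm [OF \<sigma>(1)] by simp
  qed
  have "lookup (savg ?x) a = (\<Sum>\<pi>\<in>pair_group ?n. if map_key \<pi> a = a then 1 else 0)"
    unfolding savg_def lookup_sum
  proof (intro sum.cong refl)
    fix \<pi> assume "\<pi> \<in> pair_group ?n"
    then show "lookup (sgn_const \<pi> * actv \<pi> ?x) a =
        (if map_key \<pi> a = a then 1 else 0)"
      using even [of \<pi>] by (auto simp: lookup_const_mult lookup_actv inj lookup_single when_def)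
  qed
  also have "\<dots> = of_nat (card ?S)"
    using finite_G by (simp flip: sum.inter_filter)
  also have "\<dots> \<noteq> (0 :: 'k)"
  proof -
    have "map_key id a = a"
      by (rule poly_mapping_eqI) (simp add: Poly_Mapping.map_key.rep_eq)
    then have "id \<in> ?S" using G_id by simp
    moreover have "finite ?S" using finite_G by (rule rev_finite_subset) blast
    ultimately have "card ?S \<noteq> 0" unfolding card_eq_0_iff by blast
    then show ?thesis unfolding of_nat_eq_0_iff .
  qed
  finally have "savg ?x \<noteq> 0" by auto
  moreover have "homogeneous (card (corona h)) (savg ?x)"
    using x(2) unfolding savg_def by (intro homogeneous_sum homogeneous_const_mult homogeneous_actv)
  ultimately show ?thesis
    using savg_semi [OF x(1)] by blast
qed

text \<open>For even \<open>n\<close> the constant 1 is semi-invariant; for odd \<open>n\<close> the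
  corona attains the lower bound. The estimate \<mu> \<le> n is kept for the bound on
  \<open>beta\<close>.\<close>

lemma minimal_semi_pairs:
  assumes ds: "distinct vs" "set vs = pairs n" and n: "n \<ge> 4"
  shows "\<exists>\<mu> (g :: 'k::field_char_0 mpoly). mu n = int \<mu> \<and> \<mu> \<le> n \<and>
    perm_invariants.semi vs (pair_group n) g \<and> homogeneous \<mu> g \<and> g \<noteq> 0 \<and>
    (\<forall>d (g :: 'k mpoly). perm_invariants.semi vs (pair_group n) g \<longrightarrow> homogeneous d g \<longrightarrow> g \<noteq> 0 \<longrightarrow> \<mu> \<le> d)"
proof (cases "even n")
  case True
  interpret perm_invariants vs "pair_group n"
    by (rule perm_invariants_pairs [OF ds])
  have "sign h = 1" if "h \<in> pair_group n" for h
    using that True sign_pperm by (auto simp: pair_group_def)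
  then have "semi 1"
    by (auto simp: semi_def actv_simps)
  then show ?thesis
    using True by (intro exI [of _ 0] exI [of _ 1]) (auto simp: mu_def)
next
  case False
  then obtain h where h: "n = 2 * h + 1" by (auto elim: oddE)
  with n have h2: "h \<ge> 2" by simp
  \<comment> \<open>This is \<open>3 * h / 2\<close> rounded up, where \<open>3 * h / 2\<close> is
    3/4 of \<open>n - 1\<close>: \<open>h\<close> leaf edges and half as many core edges, rounded
    up.\<close>
  define \<mu> where "\<mu> = h + (h + 1) div 2"
  have mu: "mu n = int \<mu>"
  proof -
    have "mu n = \<lceil>3 / 4 * (real n - 1)\<rceil>"
      using False by (simp only: mu_def if_False)
    also have "3 / 4 * (real n - 1) = 3 * real h / 2" by (simp add: h)
    also have "\<lceil>3 * real h / 2\<rceil> = int \<mu>"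
    proof (rule ceiling_unique)
      have "2 * \<mu> < 3 * h + 2" "3 * h \<le> 2 * \<mu>" by (auto simp: \<mu>_def)
      then have "real (2 * \<mu>) < real (3 * h + 2)" "real (3 * h) \<le> real (2 * \<mu>)"
        by (simp_all only: of_nat_less_iff of_nat_le_iff)
      then show "real_of_int (int \<mu>) - 1 < 3 * real h / 2" "3 * real h / 2 \<le> real_of_int (int \<mu>)"
        by simp_all
    qed
    finally show ?thesis .
  qed
  have ge: "\<mu> \<le> d" if "perm_invariants.semi vs (pair_group n) g" "homogeneous d g" "g \<noteq> 0"
    for d and g :: "'k mpoly"
    using semi_degree_ge [OF ds False that] by (auto simp: h \<mu>_def)
  obtain g :: "'k mpoly" where g: "perm_invariants.semi vs (pair_group n) g"
    "homogeneous (card (corona h)) g" "g \<noteq> 0"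
    using corona_semi [OF ds(1) ds(2) [unfolded h] h2] unfolding h by blast
  have "card (corona h) = \<mu>"
    using ge [OF g] card_corona [of h] by (simp add: \<mu>_def)
  moreover have "\<mu> \<le> n" by (simp add: \<mu>_def h)
  ultimately show ?thesis
    using mu g ge by blast
qed

section \<open>The elementary symmetric polynomials of the pairs as parameters\<close>

lemma ev_1_esym:
  assumes "finite U"
  shows "ev (\<lambda>_. 1) (esym U k) = of_nat (card U choose k)"
  using n_subsets [OF assms, of k] by (simp add: esym_def ev_simps)

text \<open>They have different degrees, and none is zero because the value at the all-ones point is
  a binomial coefficient. This gives the cardinality required of a system of parameters.\<close>

lemma inj_on_esym:
  assumes "finite U"
  shows "inj_on (esym U :: nat \<Rightarrow> 'k::field_char_0 mpoly) {1..card U}"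
proof (rule inj_onI, rule ccontr)
  fix k l assume kl: "k \<in> {1..card U}" "(esym U k :: 'k mpoly) = esym U l" "k \<noteq> l"
  have "esym U k = hcomp k (esym U k :: 'k mpoly)"
    by (simp add: hcomp_homogeneous [OF homogeneous_esym])
  also have "\<dots> = hcomp k (esym U l)" by (simp only: kl(2))
  also have "\<dots> = 0" using kl(3) by (simp add: hcomp_homogeneous [OF homogeneous_esym])
  finally have "ev (\<lambda>_. 1) (esym U k) = (0 :: 'k)" by (simp add: ev_simps)
  then show False using kl(1) by (simp add: ev_1_esym [OF assms])
qed

theorem proposition3p1:
  fixes n m :: nat and \<Theta> :: "'k::field_char_0 mpoly set"
  assumes "n \<ge> 4" and "m = n choose 2"
    and "\<Theta> = elem_sym n ` {1..m}"
  shows "system_of_parameters n \<Theta> \<and>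
    (\<exists>t \<eta> e. secondary_invariants n \<Theta> t \<eta> e \<and> mono_on {1..t} e) \<and>
    (\<forall>t \<eta> e. secondary_invariants n \<Theta> t \<eta> e \<and> mono_on {1..t} e \<longrightarrow>
       real t = fact m / fact n \<and>
       int (e t) = int (m choose 2) - mu n) \<and>
    int (beta TYPE('k) n) \<le> int (m choose 2) - mu n"
proof -
  obtain vs where vs: "set vs = pairs n" "distinct vs"
    using finite_distinct_list [OF finite_pairs] by blast
  interpret G: perm_invariants vs "pair_group n"
    by (rule perm_invariants_pairs [OF vs(2,1)])
  have len: "length vs = m"
    using G.card_U vs(1) card_pairs assms(2) by simp
  have inv: "invariants n = (G.Inv :: 'k mpoly set)"
  proof -
    have "(\<forall>\<sigma>. \<sigma> permutes {1..n} \<longrightarrow> act \<sigma> p = p) \<longleftrightarrow> (\<forall>g\<in>pair_group n. actv g p = p)"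
      if "p \<in> polys (pairs n)" for p :: "'k mpoly"
      using act_pperm [OF that] by (auto simp: pair_group_def)
    then show ?thesis
      by (auto simp: invariants_def G.Inv_def pair_polys_eq vs(1))
  qed
  have \<Theta>: "\<Theta> = esym (pairs n) ` {1..m}"
    by (simp add: assms(3) elem_sym_eq)
  have alg: "generated_algebra \<Theta> = symalg (set vs)"
    by (simp add: \<Theta> symalg_def vs(1) card_pairs assms(2))
  have sec_iff: "secondary_invariants n \<Theta> t \<eta> e \<longleftrightarrow> G.secondary t \<eta> e" for t \<eta> e
    by (simp add: secondary_invariants_def G.secondary_def inv alg)
  obtain \<mu> and g :: "'k mpoly" where \<mu>: "mu n = int \<mu>" "\<mu> \<le> n"
    and g: "G.semi g" "homogeneous \<mu> g" "g \<noteq> 0"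
    and min: "\<And>d (g :: 'k mpoly). G.semi g \<Longrightarrow> homogeneous d g \<Longrightarrow> g \<noteq> 0 \<Longrightarrow> \<mu> \<le> d"
    using minimal_semi_pairs [OF vs(2,1) assms(1), where 'k = 'k] by blast
  obtain t0 and \<eta>0 :: "nat \<Rightarrow> 'k mpoly" and e0 where sec0: "G.secondary t0 \<eta>0 e0" "mono_on {1..t0} e0"
    using G.secondary_exists by blast
  have "system_of_parameters n \<Theta>"
  proof -
    let ?B = "(\<lambda>ks. G.avg (artin vs ks)) ` exps (length vs) :: 'k mpoly set"
    have "card \<Theta> = n choose 2"
      using inj_on_esym [OF finite_pairs [of n], where 'k = 'k]
      by (simp add: \<Theta> card_image card_pairs assms(2))
    moreover have "\<Theta> \<subseteq> invariants n"
    proof -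
      have "\<Theta> \<subseteq> generated_algebra \<Theta>" by (auto intro: generated_algebra.gen)
      then show ?thesis
        unfolding inv alg by (rule subset_trans [OF _ G.symalg_Inv])
    qed
    moreover have "\<forall>\<theta>\<in>\<Theta>. \<exists>d. homogeneous d \<theta>"
      by (auto simp: \<Theta>)
    moreover have "\<exists>q. (\<forall>s\<in>?B. q s \<in> generated_algebra \<Theta>) \<and> f = (\<Sum>s\<in>?B. s * q s)"
      if "f \<in> invariants n" for f
    proof -
      have "f \<in> mspan (symalg (set vs)) ?B (\<lambda>b. b)"
        using G.hom_gens_exist that by (auto simp: G.hom_gens_def inv)
      then show ?thesis
        unfolding alg by (elim mspanE) blast
    qed
    moreover have "finite ?B" "?B \<subseteq> invariants n"
      using G.hom_gens_exist by (auto simp: G.hom_gens_def inv)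
    ultimately show ?thesis
      unfolding system_of_parameters_def by (intro conjI exI [of _ ?B]) (auto simp: \<Theta>)
  qed
  moreover have "\<exists>t \<eta> e. secondary_invariants n \<Theta> t \<eta> e \<and> mono_on {1..t} e"
    using sec0 unfolding sec_iff by blast
  moreover have "real t = fact m / fact n" "int (e t) = int (m choose 2) - mu n"
    if "secondary_invariants n \<Theta> t \<eta> e" "mono_on {1..t} e" for t \<eta> e
  proof -
    have sec: "G.secondary t \<eta> e" using that(1) by (simp add: sec_iff)
    have "t * fact n = fact m"
      using G.secondary_count [OF sec] assms(1) by (simp add: card_pair_group len)
    then have "real t * fact n = fact m"
      by (metis of_nat_fact of_nat_mult)
    then show "real t = fact m / fact n"
      by (simp add: field_simps)
    have "e t + \<mu> = m choose 2"
      using G.secondary_top_degree [OF sec g min that(2)] by (simp add: len)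
    then show "int (e t) = int (m choose 2) - mu n"
      by (simp add: \<mu>(1) flip: of_nat_add)
  qed
  moreover have "int (beta TYPE('k) n) \<le> int (m choose 2) - mu n"
  proof -
    \<comment> \<open>From \<open>n \<ge> 4\<close> follow \<open>m \<ge> n\<close> and
      \<open>m \<ge> 6\<close>, hence \<open>m choose 2\<close> is at least \<open>2 * m\<close> and
      so at least \<open>m + \<mu>\<close>, the hypothesis of \<open>Inv_generated\<close>.\<close>
    have "n * 2 \<le> n * (n - 1)" using assms(1) by (intro mult_le_mono2) simp
    moreover have "4 * 3 \<le> n * (n - 1)" using assms(1) by (intro mult_le_mono) simp_all
    ultimately have m: "n \<le> m" "6 \<le> m"
      unfolding assms(2) choose_two by (simp_all only: less_eq_div_iff_mult_less_eq zero_less_numeral)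
    have "2 * m * 2 \<le> m * (m - 1)" using m(2) mult_le_mono2 [of 4 "m - 1" m] by simp
    then have "2 * m \<le> m choose 2"
      unfolding choose_two by (simp only: less_eq_div_iff_mult_less_eq zero_less_numeral)
    then have le: "m + \<mu> \<le> m choose 2" using \<mu>(2) m(1) by simp
    have "generated_algebra {f \<in> invariants n. degree_at_most ((m choose 2) - \<mu>) f} =
        (invariants n :: 'k mpoly set)"
      using G.Inv_generated [OF sec0(1) g min] le by (simp add: len inv)
    then have "beta TYPE('k) n \<le> (m choose 2) - \<mu>"
      unfolding beta_def by (rule Least_le)
    then show ?thesis using le by (simp add: \<mu>(1))
  qed
  ultimately show ?thesis by blast
qed

end
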